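(* Let $D$ be the set of $\beta\in(1,2]$ such that the symmetric tent map $f_\beta$ has finite critical orbit. For every $\beta\in D$, $f_\beta$ can be modified via Denjoy like surgery to a $C^1$ unimodal map $\tilde g_\beta$ on $[0,1]$ that admits a thick hyperbolic repelling invariant Cantor set $\tilde A_\beta$ and has a wild attractor $\tilde A_\beta^\ast\subset\tilde A_\beta$.
   Context: **Tent maps.** For $1<\beta\le 2$, $f_\beta:[0,1]\to[0,1]$ is given by $f_\beta(x)=\beta x$ for $0\le x\le\frac12$ and $f_\beta(x)=\beta(1-x)$ for $\frac12<x\le1$. Its critical (turning) point is $c=\frac12$, and its critical orbit is $\mathrm{orb}(c)=\{f_\beta^i(c):i\ge0\}$. **Dynamical notions.** Let $I$ be a compact interval, $f:I\to I$ a $C^1$ map, and $m$ Lebesgue measure. - $f$ is unimodal if it is continuous with a unique interior turning point, increasing to its left and decreasing to its right. - $K\subset I$ is forward invariant if $f(K)\subset K$. It is hyperbolic repelling if it is forward invariant and there are constants $C>0$, $\lambda>1$ with $|Df^n(x)|>C\lambda^n$ for all $x\in K$ and all $n\in\mathbb N$. It is thick if $m(K)>0$. A Cantor set is a nonempty compact, perfect, totally disconnected set. - The basin of attraction of a forward invariant closed set $A$ is $\mathbb B(A)=\{x\in I:\omega_f(x)\subset A\}$, where $\omega_f(x)$ is the $\omega$-limit set of $x$. - A forward invariant closed set $A$ is a metric attractor if $m(\mathbb B(A))>0$ and no forward invariant closed set strictly contained in $A$ has a basin of positive Lebesgue measure. - A forward invariant closed set $A$ is a topological attractor if $\mathbb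 B(A)$ is residual, while $\mathbb B(A_0)$ is meager for every forward invariant closed set $A_0$ strictly contained in $A$. - $A$ is a wild attractor if it is a metric attractor but not a topological attractor. **Denjoy like surgery.** Here this means the following kind of modification of $f_\beta$, for $\beta\in D$. Let $C_\beta$ be the (countable) set of all points of $[0,1]$ that some iterate $f_\beta^n$, $n\ge0$, maps into the periodic orbit in which $\mathrm{orb}(c)$ ends; it contains $\mathrm{orb}(c)$. At each point of $C_\beta$ insert an interval of positive length, with finite total length, so that $[0,1]$ is enlarged to a compact interval $I_\beta$. On the closed interval inserted at each $x\in C_\beta$ define a suitable map onto the closed interval inserted at $f_\beta(x)$ (a diffeomorphism if $x\ne c$, a map with a unique turning point if $x=c$). Extend these maps to a map of $I_\beta$ that follows $f_\beta$ on the remaining points, and conjugate it to a map of $[0,1]$ by the affine bijection $I_\beta\to[0,1]$. *)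

theory Defs
  imports "HOL-Analysis.Analysis"
begin

section \<open>Maps of an interval\<close>

text \<open>Derivatives are taken within the set, i.e. they are one-sided at the endpoints of an interval.\<close>

definition C1_on :: "real set \<Rightarrow> (real \<Rightarrow> real) \<Rightarrow> bool" where
  "C1_on S f \<longleftrightarrow>
     (\<exists>f'. (\<forall>x\<in>S. (f has_real_derivative f' x) (at x within S)) \<and> continuous_on S f')"

definition C1_diffeo :: "real set \<Rightarrow> real set \<Rightarrow> (real \<Rightarrow> real) \<Rightarrow> bool" where
  "C1_diffeo S T f \<longleftrightarrow> bij_betw f S T \<and> C1_on S f \<and> C1_on T (inv_into S f)"

definition unimodal_on :: "real \<Rightarrow> real \<Rightarrow> (real \<Rightarrow> real) \<Rightarrow> bool" where
  "unimodal_on a b f \<longleftrightarrow> continuous_on {a..b} f \<and>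
     (\<exists>!t. t \<in> {a<..<b} \<and> strict_mono_on {a..t} f \<and> strict_antimono_on {t..b} f)"

definition forward_invariant :: "real set \<Rightarrow> (real \<Rightarrow> real) \<Rightarrow> real set \<Rightarrow> bool" where
  "forward_invariant I f K \<longleftrightarrow> K \<subseteq> I \<and> f ` K \<subseteq> K"

definition hyperbolic_repelling :: "real set \<Rightarrow> (real \<Rightarrow> real) \<Rightarrow> real set \<Rightarrow> bool" where
  "hyperbolic_repelling I f K \<longleftrightarrow> forward_invariant I f K \<and>
     (\<exists>C \<Lambda>. C > 0 \<and> \<Lambda> > 1 \<and>
       (\<forall>x\<in>K. \<forall>n::nat. \<exists>d. ((f ^^ n) has_real_derivative d) (at x within I) \<and> \<bar>d\<bar> > C * \<Lambda> ^ n))"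

definition thick :: "real set \<Rightarrow> bool" where
  "thick K \<longleftrightarrow> emeasure lebesgue K > 0"

definition Cantor_set :: "real set \<Rightarrow> bool" where
  "Cantor_set K \<longleftrightarrow> K \<noteq> {} \<and> compact K \<and> (\<forall>x\<in>K. x islimpt K) \<and>
     (\<forall>S. S \<subseteq> K \<and> connected S \<longrightarrow> (\<exists>x. S \<subseteq> {x}))"

section \<open>Attractors\<close>

definition nowhere_dense_in :: "'a topology \<Rightarrow> 'a set \<Rightarrow> bool" where
  "nowhere_dense_in X S \<longleftrightarrow> S \<subseteq> topspace X \<and> X interior_of (X closure_of S) = {}"

definition meager_in :: "'a topology \<Rightarrow> 'a set \<Rightarrow> bool" where
  "meager_in X S \<longleftrightarrow> (\<exists>\<N>. countable \<N> \<and> (\<forall>N\<in>\<N>. nowhere_dense_in X N) \<and> S = \<Union>\<N>)"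

definition residual_in :: "'a topology \<Rightarrow> 'a set \<Rightarrow> bool" where
  "residual_in X S \<longleftrightarrow> S \<subseteq> topspace X \<and> meager_in X (topspace X - S)"

definition omega_limit :: "(real \<Rightarrow> real) \<Rightarrow> real \<Rightarrow> real set" where
  "omega_limit f x = {y. \<exists>r::nat \<Rightarrow> nat. strict_mono r \<and> (\<lambda>k. (f ^^ r k) x) \<longlonglongrightarrow> y}"

text \<open>For a continuous self-map of a compact interval the basin of a closed set is a Borel set,
  so that its Lebesgue measure is the genuine one (and not the default value 0 of
  a non-measurable set).\<close>

definition basin :: "real set \<Rightarrow> (real \<Rightarrow> real) \<Rightarrow> real set \<Rightarrow> real set" where
  "basin I f A = {x\<in>I. omega_limit f x \<subseteq> A}"

definition metric_attractor :: "real set \<Rightarrow> (real \<Rightarrow> real) \<Rightarrow> real set \<Rightarrow> bool" where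
  "metric_attractor I f A \<longleftrightarrow> forward_invariant I f A \<and> closed A \<and>
     emeasure lebesgue (basin I f A) > 0 \<and>
     \<not> (\<exists>A0. A0 \<subset> A \<and> forward_invariant I f A0 \<and> closed A0 \<and>
            emeasure lebesgue (basin I f A0) > 0)"

definition topological_attractor :: "real set \<Rightarrow> (real \<Rightarrow> real) \<Rightarrow> real set \<Rightarrow> bool" where
  "topological_attractor I f A \<longleftrightarrow> forward_invariant I f A \<and> closed A \<and>
     residual_in (top_of_set I) (basin I f A) \<and>
     (\<forall>A0. A0 \<subset> A \<and> forward_invariant I f A0 \<and> closed A0 \<longrightarrow>
            meager_in (top_of_set I) (basin I f A0))"

definition wild_attractor :: "real set \<Rightarrow> (real \<Rightarrow> real) \<Rightarrow> real set \<Rightarrow> bool" where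
  "wild_attractor I f A \<longleftrightarrow> metric_attractor I f A \<and> \<not> topological_attractor I f A"

section \<open>Tent maps\<close>

definition tent :: "real \<Rightarrow> real \<Rightarrow> real" where
  "tent \<beta> x = (if x \<le> 1/2 then \<beta> * x else \<beta> * (1 - x))"

definition crit_orbit :: "real \<Rightarrow> real set" where
  "crit_orbit \<beta> = range (\<lambda>i::nat. (tent \<beta> ^^ i) (1/2))"

definition finite_crit_params :: "real set" where
  "finite_crit_params = {\<beta>. 1 < \<beta> \<and> \<beta> \<le> 2 \<and> finite (crit_orbit \<beta>)}"

text \<open>When the critical orbit is finite, its periodic points form a single periodic orbit:
  the one in which the critical orbit ends.\<close>

definition crit_cycle :: "real \<Rightarrow> real set" where
  "crit_cycle \<beta> = {y \<in> crit_orbit \<beta>. \<exists>p::nat. p > 0 \<and> (tent \<beta> ^^ p) y = y}"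

definition surgery_points :: "real \<Rightarrow> real set" where
  "surgery_points \<beta> = {x \<in> {0..1}. \<exists>n::nat. (tent \<beta> ^^ n) x \<in> crit_cycle \<beta>}"

section \<open>Denjoy like surgery\<close>

text \<open>Insert into \<open>{0..1}\<close> an interval of length \<open>len y\<close> at each \<open>y \<in> C\<close>. A point \<open>x\<close> is
  then replaced by the closed interval from \<open>ins_left C len x\<close> to \<open>ins_right C len x\<close>, which has
  length \<open>len x\<close> if \<open>x \<in> C\<close> and is a single point otherwise. These intervals partition the enlarged
  interval \<open>{0..ins_right C len 1}\<close>.\<close>

definition ins_left :: "real set \<Rightarrow> (real \<Rightarrow> real) \<Rightarrow> real \<Rightarrow> real" where
  "ins_left C len x = x + infsum len {y\<in>C. y < x}"

definition ins_right :: "real set \<Rightarrow> (real \<Rightarrow> real) \<Rightarrow> real \<Rightarrow> real" where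
  "ins_right C len x = x + infsum len {y\<in>C. y \<le> x}"

definition ins_interval :: "real set \<Rightarrow> (real \<Rightarrow> real) \<Rightarrow> real \<Rightarrow> real set" where
  "ins_interval C len x = {ins_left C len x..ins_right C len x}"

text \<open>\<open>G\<close> is the map of the enlarged interval and \<open>g\<close> its affine conjugate on \<open>{0..1}\<close>.\<close>

definition denjoy_like_surgery :: "real \<Rightarrow> (real \<Rightarrow> real) \<Rightarrow> bool" where
  "denjoy_like_surgery \<beta> g \<longleftrightarrow>
     (let C = surgery_points \<beta>; f = tent \<beta>; c = 1/2 in
      \<exists>len G. (\<forall>x\<in>C. len x > 0) \<and> len summable_on C \<and>
        (\<forall>x\<in>C - {c}. C1_diffeo (ins_interval C len x) (ins_interval C len (f x)) G) \<and>
        unimodal_on (ins_left C len c) (ins_right C len c) G \<and>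
        G ` ins_interval C len c = ins_interval C len (f c) \<and>
        (\<forall>x\<in>{0..1} - C. G (ins_left C len x) = ins_left C len (f x)) \<and>
        (\<forall>t\<in>{0..1}. g t = G (ins_right C len 1 * t) / ins_right C len 1))"

end

theory Submission
  imports Defs
begin

text \<open>Insert at a point \<open>x\<close> of backward level \<open>n\<close> over the critical cycle an interval of length
  \<open>\<beta>\<^sup>-\<^sup>n / (n + 1)\<^sup>2\<close>. There are \<open>O(\<beta>\<^sup>n)\<close> such points, so the total length is finite, and the
  ratios \<open>len (f x) / len x\<close> tend to \<open>\<beta>\<close>, so that the modified map is \<open>C\<^sup>1\<close> with slope exactly \<open>\<plusminus>\<beta>\<close>
  on the closure \<open>A\<close> of the set of points that are not inserted; this set has positive measure.

  Lebesgue measure on \<open>A\<close> corresponds to Lebesgue measure on \<open>[0, 1]\<close>. Iterates of \<open>f\<close> map laps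
  linearly onto intervals with endpoints in the finite set \<open>Q\<close>, so an invariant set of positive
  measure is dense in one of finitely many intervals. If \<open>W\<close> is a minimal union of the forward images of
  such an interval, then almost every orbit that approaches \<open>W\<close> is dense in \<open>W\<close>, which makes the part
  \<open>A'\<close> of \<open>A\<close> over \<open>W\<close> a metric attractor. In the inserted intervals, however, only
  countably many points have their limit set in \<open>A\<close>, because the endpoints of the periodic
  inserted intervals are repelling, so by Baire's theorem the basin of \<open>A'\<close> is not residual.\<close>

section \<open>Post-critically finite tent maps\<close>

text \<open>The lengths are squeezed from two sides. With \<open>\<beta>\<close> to the power -n
  alone, the count of points gives only a bounded total for each level, not a summable one; a faster
  exponential decay would keep the ratios away from \<open>\<beta>\<close>. A polynomial factor
  settles both. The tight spot is the critical cycle, where lengths cannot grow: an inserted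
  interval is mapped onto one of the same length, although the slope at its ends has to be
  \<open>\<beta>\<close>. The slope must dip in between and still stay positive. With a cubic bump
  it stays at least (3 - \<open>\<beta>\<close>)/2, which is where \<open>\<beta> \<le> 2\<close>
  enters. In general [0, 1] cannot serve as \<open>W\<close>: for \<open>\<beta> < 2\<close> orbits
  are drawn into a smaller core, and for small \<open>\<beta>\<close> several intervals are permuted
  inside it. Taking a minimal member of a finite family avoids analysing this, and replaces
  invariant measures and ergodicity.\<close>

lemma card_separated_le:
  fixes S :: "real set"
  assumes "S \<subseteq> {0..1}" "0 < d" "\<And>x y. x \<in> S \<Longrightarrow> y \<in> S \<Longrightarrow> x \<noteq> y \<Longrightarrow> d \<le> \<bar>x - y\<bar>"
  shows "finite S" "real (card S) \<le> 1 / d + 1"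
proof -
  let ?h = "\<lambda>x. nat \<lfloor>x / d\<rfloor>"
  have inj: "inj_on ?h S"
  proof (rule inj_onI, rule ccontr)
    fix x y assume xy: "x \<in> S" "y \<in> S" "?h x = ?h y" "x \<noteq> y"
    then have "\<lfloor>x / d\<rfloor> = \<lfloor>y / d\<rfloor>" using assms(1,2) by (auto simp: subset_iff nat_eq_iff)
    then have "\<bar>x / d - y / d\<bar> < 1" by linarith
    then have "\<bar>x - y\<bar> < d" using assms(2) by (simp add: abs_divide flip: diff_divide_distrib)
    then show False using assms(3)[of x y] xy by auto
  qed
  have sub: "?h ` S \<subseteq> {..nat \<lfloor>1 / d\<rfloor>}"
    using assms(1,2) by (auto intro!: nat_mono floor_mono divide_right_mono)
  show "finite S" using finite_imageD[OF finite_subset[OF sub finite_atMost] inj] .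
  have "card S \<le> card {..nat \<lfloor>1 / d\<rfloor>}"
    using inj sub by (metis card_image card_mono finite_atMost)
  moreover have "real (nat \<lfloor>1 / d\<rfloor>) \<le> 1 / d" using assms(2) by (simp add: of_nat_nat)
  ultimately show "real (card S) \<le> 1 / d + 1" by simp
qed

locale pcf_tent =
  fixes \<beta> :: real
  assumes pcf: "\<beta> \<in> finite_crit_params"
begin

abbreviation f where "f \<equiv> tent \<beta>"
abbreviation P where "P \<equiv> crit_cycle \<beta>"
abbreviation C where "C \<equiv> surgery_points \<beta>"

text \<open>Adding 0 and 1 makes the whole interval a lap of order 0. Both are mapped to 0, so this
  finite set stays forward invariant, and it contains 1/2, where laps are cut.\<close>

definition Q :: "real set" where
  "Q = crit_orbit \<beta> \<union> {0, 1}"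

lemma beta_gt_1: "1 < \<beta>" and beta_le_2: "\<beta> \<le> 2" and finite_crit_orbit: "finite (crit_orbit \<beta>)"
  using pcf by (auto simp: finite_crit_params_def)

lemma beta_pow_ge_1: "1 \<le> \<beta> ^ n" and beta_pow_pos: "0 < \<beta> ^ n"
  using beta_gt_1 by auto

lemma tent_eq_min: "f x = \<beta> * min x (1 - x)"
  by (auto simp: tent_def min_def)

lemma tent_reflect: "f (1 - x) = f x"
  by (auto simp: tent_eq_min min.commute)

lemma tent_left: "x \<le> 1/2 \<Longrightarrow> f x = \<beta> * x"
  by (simp add: tent_def)

lemma tent_right: "1/2 \<le> x \<Longrightarrow> f x = \<beta> * (1 - x)"
  using tent_left[of "1 - x"] tent_reflect[of x] by simp

lemma tent_0: "f 0 = 0" and tent_1: "f 1 = 0"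
  by (auto simp: tent_def)

lemma tent_in_unit: assumes "x \<in> {0..1}" shows "f x \<in> {0..1}"
proof -
  have "0 \<le> min x (1 - x)" "min x (1 - x) \<le> 1/2" using assms by (auto simp: min_def)
  then have "0 \<le> \<beta> * min x (1 - x)" "\<beta> * min x (1 - x) \<le> 2 * (1/2)"
    using beta_gt_1 beta_le_2 by (simp, intro mult_mono) auto
  then show ?thesis unfolding tent_eq_min by auto
qed

lemma tent_pow_in_unit: "x \<in> {0..1} \<Longrightarrow> (f ^^ n) x \<in> {0..1}"
  by (induction n) (use tent_in_unit in auto)

lemma tent_lipschitz: "\<bar>f x - f y\<bar> \<le> \<beta> * \<bar>x - y\<bar>"
proof -
  have "\<bar>min x (1 - x) - min y (1 - y)\<bar> \<le> \<bar>x - y\<bar>" by (auto simp: min_def)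
  then show ?thesis unfolding tent_eq_min
    using beta_gt_1 by (simp add: abs_mult flip: right_diff_distrib)
qed

lemma tent_pow_lipschitz: "\<bar>(f ^^ n) x - (f ^^ n) y\<bar> \<le> \<beta> ^ n * \<bar>x - y\<bar>"
proof (induction n)
  case (Suc n)
  have "\<bar>f ((f ^^ n) x) - f ((f ^^ n) y)\<bar> \<le> \<beta> * \<bar>(f ^^ n) x - (f ^^ n) y\<bar>"
    by (rule tent_lipschitz)
  also have "\<dots> \<le> \<beta> * (\<beta> ^ n * \<bar>x - y\<bar>)"
    using Suc beta_gt_1 by (intro mult_left_mono) auto
  finally show ?case by (simp add: mult.assoc)
qed auto

lemma tent_eq_iff: "f x = f y \<longleftrightarrow> x = y \<or> x = 1 - y"
  using beta_gt_1 by (auto simp: tent_eq_min min_def)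

lemma continuous_tent: "continuous_on S f"
proof -
  have "f = (\<lambda>x. \<beta> * min x (1 - x))" using tent_eq_min by auto
  then show ?thesis by (simp only:) (intro continuous_intros)
qed

lemma continuous_tent_pow: "continuous_on S (f ^^ n)"
proof (induction n)
  case (Suc n)
  then show ?case using continuous_on_compose[OF Suc continuous_tent] by (simp add: o_def)
qed (simp add: id_def)

lemma crit_orbit_I: "(f ^^ n) (1/2) \<in> crit_orbit \<beta>"
  by (auto simp: crit_orbit_def)

lemma half_in_crit_orbit: "1/2 \<in> crit_orbit \<beta>"
  using crit_orbit_I[of 0] by simp

lemma tent_crit_orbit: assumes "x \<in> crit_orbit \<beta>" shows "f x \<in> crit_orbit \<beta>"
proof -
  obtain n where "x = (f ^^ n) (1/2)" using assms by (auto simp: crit_orbit_def)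
  then have "f x = (f ^^ Suc n) (1/2)" by simp
  then show ?thesis using crit_orbit_I by metis
qed

lemma crit_orbit_unit: "crit_orbit \<beta> \<subseteq> {0..1}"
  using tent_pow_in_unit[of "1/2"] by (auto simp: crit_orbit_def)

lemma finite_Q: "finite Q" and Q_unit: "Q \<subseteq> {0..1}" and half_in_Q: "1/2 \<in> Q"
  and zero_in_Q: "0 \<in> Q" and one_in_Q: "1 \<in> Q"
  using finite_crit_orbit crit_orbit_unit half_in_crit_orbit by (auto simp: Q_def)

lemma tent_Q: "x \<in> Q \<Longrightarrow> f x \<in> Q"
  using tent_crit_orbit tent_0 tent_1 by (auto simp: Q_def)

lemma crit_cycle_subset: "P \<subseteq> crit_orbit \<beta>" and finite_crit_cycle: "finite P"
  using finite_crit_orbit by (auto simp: crit_cycle_def)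

lemma tent_pow_commute: "(f ^^ n) (f x) = f ((f ^^ n) x)"
  by (simp add: funpow_swap1)

lemma tent_crit_cycle: "x \<in> P \<Longrightarrow> f x \<in> P"
  using tent_crit_orbit by (auto simp: crit_cycle_def tent_pow_commute)

text \<open>Pigeonhole: two iterates of 1/2 coincide, and the earlier of them is periodic.\<close>

lemma half_reaches_crit_cycle: "\<exists>n. (f ^^ n) (1/2) \<in> P"
proof -
  have "\<not> inj (\<lambda>i::nat. (f ^^ i) (1/2))"
    using finite_crit_orbit finite_imageD unfolding crit_orbit_def by blast
  then obtain i j where "i < j" "(f ^^ i) (1/2) = (f ^^ j) (1/2)"
    unfolding inj_def by (metis linorder_neqE_nat)
  then have "(f ^^ (j - i)) ((f ^^ i) (1/2)) = (f ^^ i) (1/2)"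
    by (metis add.commute funpow_add comp_apply le_add_diff_inverse less_imp_le_nat)
  then show ?thesis using \<open>i < j\<close> crit_orbit_I unfolding crit_cycle_def
    by (metis (mono_tags, lifting) mem_Collect_eq zero_less_diff)
qed

lemma surgery_points_unit: "C \<subseteq> {0..1}"
  by (auto simp: surgery_points_def)

text \<open>Backwards, one more iterate is spent; forwards, \<open>P\<close> is itself invariant, so
  the same number of iterates still ends in \<open>P\<close>, even for n = 0.\<close>

lemma tent_surgery_iff: assumes "x \<in> {0..1}" shows "f x \<in> C \<longleftrightarrow> x \<in> C"
proof
  assume "f x \<in> C"
  then obtain n where "(f ^^ n) (f x) \<in> P" by (auto simp: surgery_points_def)
  then have "(f ^^ Suc n) x \<in> P" by (simp add: tent_pow_commute)
  then show "x \<in> C" using assms unfolding surgery_points_def by blast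
next
  assume "x \<in> C"
  then obtain n where "(f ^^ n) x \<in> P" by (auto simp: surgery_points_def)
  then have "(f ^^ n) (f x) \<in> P" by (simp add: tent_pow_commute tent_crit_cycle)
  then show "f x \<in> C" using tent_in_unit[OF assms] unfolding surgery_points_def by blast
qed

lemma tent_pow_surgery_iff: "x \<in> {0..1} \<Longrightarrow> (f ^^ n) x \<in> C \<longleftrightarrow> x \<in> C"
  by (induction n) (use tent_surgery_iff tent_pow_in_unit in auto)

lemma half_surgery: "1/2 \<in> C"
  using half_reaches_crit_cycle by (auto simp: surgery_points_def)

lemma reflect_surgery_iff: "1 - x \<in> C \<longleftrightarrow> x \<in> C"
proof (cases "x \<in> {0..1}")
  case True
  then have "1 - x \<in> {0..1}" by auto
  then show ?thesis using tent_surgery_iff True tent_reflect by metis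
qed (use surgery_points_unit in auto)

section \<open>The inserted lengths\<close>

text \<open>The set of points of level 0 is made symmetric about \<open>1/2\<close>, so that the lengths and the modified
  map are symmetric, too.\<close>

definition P' :: "real set" where
  "P' = P \<union> (\<lambda>x. 1 - x) ` P"

definition lev :: "real \<Rightarrow> nat" where
  "lev x = (LEAST n. (f ^^ n) x \<in> P')"

text \<open>The value 0 off \<open>C\<close> lets formulas such as \<open>r x = l x + len x\<close>
  hold without a case distinction.\<close>

definition len :: "real \<Rightarrow> real" where
  "len x = (if x \<in> C then 1 / (\<beta> ^ lev x * (real (lev x) + 1)\<^sup>2) else 0)"

lemma tent_P': "x \<in> P' \<Longrightarrow> f x \<in> P"
  using tent_crit_cycle by (auto simp: P'_def tent_reflect)

lemma reflect_P'_iff: "1 - x \<in> P' \<longleftrightarrow> x \<in> P'"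
  by (force simp: P'_def)

lemma lev_hits: "x \<in> C \<Longrightarrow> (f ^^ lev x) x \<in> P'"
  unfolding lev_def by (rule LeastI_ex) (auto simp: surgery_points_def P'_def)

lemma lev_le: "(f ^^ n) x \<in> P' \<Longrightarrow> lev x \<le> n"
  unfolding lev_def by (rule Least_le)

lemma tent_pow_reflect: "0 < n \<Longrightarrow> (f ^^ n) (1 - x) = (f ^^ n) x"
  by (cases n) (simp_all add: funpow_Suc_right tent_reflect del: funpow.simps)

lemma lev_reflect: "lev (1 - x) = lev x"
proof -
  have "(f ^^ n) (1 - x) \<in> P' \<longleftrightarrow> (f ^^ n) x \<in> P'" for n
    by (cases "n = 0") (auto simp: reflect_P'_iff tent_pow_reflect)
  then show ?thesis by (simp add: lev_def)
qed

text \<open>\<open>f\<close> maps \<open>P'\<close> into \<open>P\<close>, so level 0 is kept, which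
  truncated subtraction expresses; at higher levels one step of the first hitting time is used
  up.\<close>

lemma lev_tent: assumes "x \<in> C" shows "lev (f x) = lev x - 1"
proof (cases "lev x")
  case 0
  then have "x \<in> P'" using lev_hits[OF assms] by simp
  then have "(f ^^ 0) (f x) \<in> P'" using tent_P' by (auto simp: P'_def)
  then show ?thesis using lev_le[of 0] 0 by simp
next
  case (Suc n)
  have "f x \<in> C" using assms tent_surgery_iff surgery_points_unit by blast
  then have "(f ^^ Suc (lev (f x))) x \<in> P'"
    using lev_hits[of "f x"] by (simp add: funpow_Suc_right del: funpow.simps)
  then have "lev x \<le> Suc (lev (f x))" by (rule lev_le)
  moreover have "(f ^^ n) (f x) \<in> P'"
    using lev_hits[OF assms] Suc by (simp add: tent_pow_commute)
  then have "lev (f x) \<le> n" by (rule lev_le)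
  ultimately show ?thesis using Suc by simp
qed

lemma len_pos: "x \<in> C \<Longrightarrow> 0 < len x" and len_nonneg: "0 \<le> len x"
  and len_zero: "x \<notin> C \<Longrightarrow> len x = 0"
  using beta_gt_1 by (auto simp: len_def add_nonneg_eq_0_iff)

lemma len_reflect: "len (1 - x) = len x"
  by (simp add: len_def lev_reflect reflect_surgery_iff)

lemma len_tent_level_0: assumes "x \<in> C" "lev x = 0" shows "len (f x) = len x"
proof -
  have "f x \<in> C" using assms tent_surgery_iff surgery_points_unit by blast
  then show ?thesis using assms lev_tent[of x] by (simp add: len_def)
qed

lemma len_tent_level_Suc:
  assumes "x \<in> C" "lev x = Suc n"
  shows "len (f x) = len x * \<beta> * ((real n + 2) / (real n + 1))\<^sup>2"
proof -
  have "f x \<in> C" using assms tent_surgery_iff surgery_points_unit by blast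
  then have "len (f x) = 1 / (\<beta> ^ n * (real n + 1)\<^sup>2)" using assms lev_tent[of x] by (simp add: len_def)
  moreover have "len x = 1 / (\<beta> * \<beta> ^ n * (real n + 2)\<^sup>2)" using assms by (simp add: len_def add.commute)
  ultimately show ?thesis using beta_gt_1 by (simp add: power_divide)
qed

text \<open>The ratio is 1 at level 0 and exceeds 1 above. This limits how far a bump may lower the
  slope, and makes \<open>turn_excess\<close> nonnegative.\<close>

lemma len_tent_ge: assumes "x \<in> C" shows "len x \<le> len (f x)"
proof (cases "lev x")
  case (Suc n)
  have "1 * 1 \<le> \<beta> * ((real n + 2) / (real n + 1))\<^sup>2"
    using beta_gt_1 by (intro mult_mono one_le_power) auto
  then show ?thesis
    using mult_left_mono[of 1 _ "len x"] len_nonneg len_tent_level_Suc[OF assms Suc]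
    by (simp add: mult.assoc)
qed (use len_tent_level_0[OF assms] in auto)

text \<open>A bound that tends to 0 with the level makes the series for the slope converge
  uniformly. The 6 is 2 times 3, from \<open>\<beta> \<le> 2\<close> and
  \<open>2 * n + 3 \<le> 3 * (n + 1)\<close>.\<close>

lemma len_tent_deviation:
  assumes "x \<in> C" "lev x = Suc n"
  shows "\<bar>len (f x) / len x - \<beta>\<bar> \<le> 6 / (real n + 1)"
proof -
  have eq: "((real n + 2) / (real n + 1))\<^sup>2 - 1 = (2 * real n + 3) / (real n + 1)\<^sup>2"
  proof -
    have "((real n + 2)\<^sup>2 - (real n + 1)\<^sup>2) = 2 * real n + 3" by (simp add: power2_eq_square algebra_simps)
    then show ?thesis by (simp add: power_divide diff_divide_distrib flip: \<open>_ = 2 * real n + 3\<close>)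
  qed
  have "len (f x) / len x - \<beta> = \<beta> * (((real n + 2) / (real n + 1))\<^sup>2 - 1)"
    using len_pos[OF assms(1)] len_tent_level_Suc[OF assms] by (simp add: algebra_simps)
  then have "\<bar>len (f x) / len x - \<beta>\<bar> = \<beta> * ((2 * real n + 3) / (real n + 1)\<^sup>2)"
    unfolding eq using beta_gt_1 by simp
  also have "\<dots> \<le> 2 * (3 * (real n + 1) / (real n + 1)\<^sup>2)"
    using beta_le_2 by (intro mult_mono divide_right_mono) auto
  also have "\<dots> = 6 / (real n + 1)"
  proof -
    have "2 * (3 * m / m\<^sup>2) = 6 / m" for m :: real by (simp add: power2_eq_square)
    then show ?thesis .
  qed
  finally show ?thesis .
qed

text \<open>Two preimages of a postcritical point under \<open>f\<^sup>n\<close> are far apart, because at the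
  turning point between them \<open>f\<^sup>n\<close> takes another value of the finite critical orbit.\<close>

lemma preimages_separated:
  assumes \<delta>: "0 < \<delta>" "\<And>u v. u \<in> crit_orbit \<beta> \<Longrightarrow> v \<in> crit_orbit \<beta> \<Longrightarrow> u \<noteq> v \<Longrightarrow> \<delta> \<le> \<bar>u - v\<bar>"
    and "(f ^^ n) x \<in> crit_orbit \<beta>" "(f ^^ n) x = (f ^^ n) y" "x \<noteq> y"
  shows "\<delta> / \<beta> ^ n \<le> \<bar>x - y\<bar>"
  using assms(3-)
proof (induction n arbitrary: x y)
  case (Suc n)
  have IH: "\<delta> / \<beta> ^ Suc n \<le> \<bar>x - y\<bar>"
    if "(f ^^ Suc n) x \<in> crit_orbit \<beta>" "(f ^^ Suc n) x = (f ^^ Suc n) y" "f x \<noteq> f y" for x y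
  proof -
    have "\<delta> / \<beta> ^ n \<le> \<bar>f x - f y\<bar>" using Suc.IH[of "f x" "f y"] that by (simp add: tent_pow_commute)
    also have "\<dots> \<le> \<beta> * \<bar>x - y\<bar>" by (rule tent_lipschitz)
    finally show ?thesis using beta_gt_1 by (simp add: field_simps)
  qed
  show ?case
  proof (cases "f x = f y")
    case True
    then have y: "y = 1 - x" using Suc.prems(3) tent_eq_iff[of x y] by auto
    then have x: "x \<noteq> 1/2" using Suc.prems(3) by auto
    \<comment> \<open>Here \<open>x\<close> and \<open>y\<close> lie symmetrically about the turning
      point, so it is enough to separate \<open>x\<close> from 1/2: by the induction hypothesis if
      both have the same image under the iterate, otherwise by the Lipschitz bound and the gap
      between two postcritical values.\<close>
    have "\<delta> / \<beta> ^ Suc n \<le> \<bar>x - 1/2\<bar>"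
    proof (cases "(f ^^ Suc n) x = (f ^^ Suc n) (1/2)")
      case True
      moreover have "f x \<noteq> f (1/2)" using x tent_eq_iff[of x "1/2"] by auto
      ultimately show ?thesis using IH Suc.prems by blast
    next
      case False
      then have "\<delta> \<le> \<bar>(f ^^ Suc n) x - (f ^^ Suc n) (1/2)\<bar>" using \<delta>(2) Suc.prems(1) crit_orbit_I by blast
      also have "\<dots> \<le> \<beta> ^ Suc n * \<bar>x - 1/2\<bar>" by (rule tent_pow_lipschitz)
      finally show ?thesis using beta_gt_1 by (simp add: field_simps)
    qed
    also have "\<dots> \<le> \<bar>x - y\<bar>" unfolding y by (simp add: abs_if)
    finally show ?thesis .
  qed (use IH Suc.prems in blast)
qed auto

text \<open>A point of level n reaches \<open>P\<close> after n + 1 steps, the last one leading from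
  \<open>P'\<close> to the postcritical set \<open>P\<close>. Preimages of one point of
  \<open>P\<close> under \<open>f ^^ Suc n\<close> are at least
  \<open>\<delta> / \<beta> ^ Suc n\<close> apart, which bounds their number.\<close>

lemma card_level_bound:
  "\<exists>M>0. \<forall>n. finite {x\<in>C. lev x = n} \<and> real (card {x\<in>C. lev x = n}) \<le> M * \<beta> ^ n"
proof -
  have "\<exists>\<delta>>0. \<forall>u\<in>crit_orbit \<beta>. \<forall>v\<in>crit_orbit \<beta>. u \<noteq> v \<longrightarrow> \<delta> \<le> \<bar>u - v\<bar>"
    using finite_crit_orbit
  proof -
    \<comment> \<open>The element 1 keeps the set nonempty, so that \<open>Min\<close> is
      meaningful. The same device recurs below.\<close>
    let ?D = "insert 1 ((\<lambda>(u, v). \<bar>u - v\<bar>) ` {(u, v) \<in> crit_orbit \<beta> \<times> crit_orbit \<beta>. u \<noteq> v})"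
    have fin: "finite ?D" using finite_crit_orbit
      by (auto intro: finite_subset[of _ "crit_orbit \<beta> \<times> crit_orbit \<beta>"])
    have "0 < Min ?D" using fin by (subst Min_gr_iff) auto
    moreover have "\<forall>u\<in>crit_orbit \<beta>. \<forall>v\<in>crit_orbit \<beta>. u \<noteq> v \<longrightarrow> Min ?D \<le> \<bar>u - v\<bar>"
      using fin by (intro ballI impI Min_le) auto
    ultimately show ?thesis by blast
  qed
  then obtain \<delta> where \<delta>: "0 < \<delta>" "\<And>u v. u \<in> crit_orbit \<beta> \<Longrightarrow> v \<in> crit_orbit \<beta> \<Longrightarrow> u \<noteq> v \<Longrightarrow> \<delta> \<le> \<bar>u - v\<bar>"
    by blast
  let ?S = "\<lambda>n p. {x\<in>{0..1}. (f ^^ n) x = p}"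
  have S: "finite (?S n p)" "real (card (?S n p)) \<le> 1 / (\<delta> / \<beta> ^ n) + 1" if "p \<in> P" for n p
  proof -
    have "\<delta> / \<beta> ^ n \<le> \<bar>x - y\<bar>" if "x \<in> ?S n p" "y \<in> ?S n p" "x \<noteq> y" for x y
      using preimages_separated[OF \<delta>, of n x y] that crit_cycle_subset \<open>p \<in> P\<close> by auto
    moreover have "0 < \<delta> / \<beta> ^ n" using \<delta>(1) beta_gt_1 by simp
    ultimately show "finite (?S n p)" "real (card (?S n p)) \<le> 1 / (\<delta> / \<beta> ^ n) + 1"
      by (intro card_separated_le; auto)+
  qed
  define M where "M = (real (card P) + 1) * (\<beta> / \<delta> + \<beta>)"
  have "finite {x\<in>C. lev x = n} \<and> real (card {x\<in>C. lev x = n}) \<le> M * \<beta> ^ n" for n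
  proof -
    have sub: "{x\<in>C. lev x = n} \<subseteq> (\<Union>p\<in>P. ?S (Suc n) p)"
      using lev_hits tent_P' surgery_points_unit by fastforce
    have fin: "finite (\<Union>p\<in>P. ?S (Suc n) p)" using S(1) finite_crit_cycle by (intro finite_UN_I)
    have "real (card {x\<in>C. lev x = n}) \<le> real (card (\<Union>p\<in>P. ?S (Suc n) p))"
      by (intro of_nat_mono card_mono fin sub)
    also have "\<dots> \<le> (\<Sum>p\<in>P. real (card (?S (Suc n) p)))"
      unfolding of_nat_sum[symmetric] by (intro of_nat_mono card_UN_le finite_crit_cycle)
    also have "\<dots> \<le> (\<Sum>p\<in>P. 1 / (\<delta> / \<beta> ^ Suc n) + 1)"
      by (intro sum_mono S(2))
    also have "\<dots> = real (card P) * (\<beta> / \<delta> * \<beta> ^ n + 1)" by (simp only: sum_constant) simp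
    also have "\<dots> \<le> (real (card P) + 1) * (\<beta> / \<delta> * \<beta> ^ n + \<beta> * \<beta> ^ n)"
    proof -
      have "1 \<le> \<beta> * \<beta> ^ n" using beta_pow_ge_1[of "Suc n"] by simp
      then show ?thesis using \<delta>(1) beta_gt_1 by (intro mult_mono) auto
    qed
    also have "\<dots> = M * \<beta> ^ n" by (simp add: M_def algebra_simps add_divide_distrib)
    finally show ?thesis using finite_subset[OF sub fin] by (intro conjI)
  qed
  moreover have "0 < M" unfolding M_def using \<delta>(1) beta_gt_1 by (intro mult_pos_pos add_nonneg_pos) auto
  ultimately show ?thesis by (intro exI[of _ M] conjI allI) blast+
qed

lemma finite_level_le: "finite {x\<in>C. lev x \<le> n}"
proof -
  have eq: "{x\<in>C. lev x \<le> n} = (\<Union>k\<le>n. {x\<in>C. lev x = k})" by auto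
  have "finite {x\<in>C. lev x = k}" for k using card_level_bound by blast
  then show ?thesis unfolding eq by (intro finite_UN_I) auto
qed

text \<open>Grouped by level: at most \<open>M * \<beta> ^ n\<close> intervals of level n together
  have length at most \<open>M / (n + 1)\<^sup>2\<close>.\<close>

lemma len_summable: "len summable_on C"
proof -
  obtain M where M: "0 < M" "\<And>n. real (card {x\<in>C. lev x = n}) \<le> M * \<beta> ^ n" "\<And>n. finite {x\<in>C. lev x = n}"
    using card_level_bound by blast
  have sq: "summable (\<lambda>n. 1 / (real n + 1)\<^sup>2)"
  proof -
    have "summable (\<lambda>n. inverse (real (Suc n) ^ 2))"
      using inverse_power_summable[of 2, where 'a = real] by (subst summable_Suc_iff) auto
    then show ?thesis by (simp add: inverse_eq_divide add.commute)
  qed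
  show ?thesis
  proof (rule nonneg_bounded_partial_sums_imp_summable_on)
    show "\<forall>\<^sub>F F in finite_subsets_at_top C. sum len F \<le> M * (\<Sum>n. 1 / (real n + 1)\<^sup>2)"
    proof (rule eventually_finite_subsets_at_top_weakI)
      fix F assume F: "finite F" "F \<subseteq> C"
      have "sum len F = (\<Sum>n\<in>lev ` F. \<Sum>x\<in>{x\<in>F. lev x = n}. len x)"
        using F by (intro sum.image_gen)
      also have "\<dots> \<le> (\<Sum>n\<in>lev ` F. M * (1 / (real n + 1)\<^sup>2))"
      proof (rule sum_mono)
        fix n
        have "(\<Sum>x\<in>{x\<in>F. lev x = n}. len x) = (\<Sum>x\<in>{x\<in>F. lev x = n}. 1 / (\<beta> ^ n * (real n + 1)\<^sup>2))"
          using F by (intro sum.cong) (auto simp: len_def)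
        also have "\<dots> = real (card {x\<in>F. lev x = n}) * (1 / (\<beta> ^ n * (real n + 1)\<^sup>2))" by simp
        also have "\<dots> \<le> M * \<beta> ^ n * (1 / (\<beta> ^ n * (real n + 1)\<^sup>2))"
        proof (rule mult_right_mono)
          have "card {x\<in>F. lev x = n} \<le> card {x\<in>C. lev x = n}"
            using F M(3) by (intro card_mono) auto
          then show "real (card {x\<in>F. lev x = n}) \<le> M * \<beta> ^ n" using M(2)[of n] by linarith
        qed (use beta_gt_1 in auto)
        also have "\<dots> = M * (1 / (real n + 1)\<^sup>2)" using beta_gt_1 by simp
        finally show "(\<Sum>x\<in>{x\<in>F. lev x = n}. len x) \<le> M * (1 / (real n + 1)\<^sup>2)" .
      qed
      also have "\<dots> = M * (\<Sum>n\<in>lev ` F. 1 / (real n + 1)\<^sup>2)" by (rule sum_distrib_left[symmetric])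
      also have "\<dots> \<le> M * (\<Sum>n. 1 / (real n + 1)\<^sup>2)"
        using F M(1) by (intro mult_left_mono sum_le_suminf sq) auto
      finally show "sum len F \<le> M * (\<Sum>n. 1 / (real n + 1)\<^sup>2)" .
    qed
  qed (use len_nonneg in auto)
qed

lemma countable_surgery_points: "countable C"
proof -
  have "countable (\<Union>n. {x\<in>C. lev x \<le> n})"
    using finite_level_le by (intro countable_UN) (auto intro: countable_finite)
  also have "(\<Union>n. {x\<in>C. lev x \<le> n}) = C" by auto
  finally show ?thesis .
qed

text \<open>An interval whose iterates all avoid \<open>1/2\<close> would be stretched by the factor \<open>\<beta>\<close> forever.\<close>

lemma surgery_points_dense:
  assumes "0 \<le> a" "a < b" "b \<le> 1" shows "\<exists>x\<in>C. a < x \<and> x < b"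
proof (rule ccontr)
  assume no: "\<not> ?thesis"
  have affine: "\<exists>s. \<bar>s\<bar> = \<beta> ^ n \<and> (\<forall>x\<in>{a..b}. (f ^^ n) x = (f ^^ n) a + s * (x - a))" for n
  proof (induction n)
    case 0
    then show ?case by (intro exI[of _ 1]) auto
  next
    case (Suc n)
    then obtain s where s: "\<bar>s\<bar> = \<beta> ^ n" "\<And>x. x \<in> {a..b} \<Longrightarrow> (f ^^ n) x = (f ^^ n) a + s * (x - a)" by blast
    \<comment> \<open>Since 1/2 is in \<open>C\<close> and \<open>C\<close> is backward invariant,
      hitting 1/2 would put a point of \<open>C\<close> into the interval. By connectedness the
      image then stays on one side of 1/2, where \<open>f\<close> is affine.\<close>
    have nh: "(f ^^ n) x \<noteq> 1/2" if "x \<in> {a<..<b}" for x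
    proof
      assume "(f ^^ n) x = 1/2"
      then have "(f ^^ n) x \<in> C" using half_surgery by metis
      then have "x \<in> C" using tent_pow_surgery_iff[of x n] that assms by auto
      then show False using no that by auto
    qed
    have conn: "connected ((f ^^ n) ` {a<..<b})"
      using continuous_tent_pow by (intro connected_continuous_image) auto
    have side: "(\<forall>x\<in>{a<..<b}. (f ^^ n) x \<le> 1/2) \<or> (\<forall>x\<in>{a<..<b}. 1/2 \<le> (f ^^ n) x)"
    proof (rule ccontr)
      assume "\<not> ?thesis"
      then obtain x y where xy: "x \<in> {a<..<b}" "1/2 < (f ^^ n) x" "y \<in> {a<..<b}" "(f ^^ n) y < 1/2" by (auto simp: not_le)
      then have "1/2 \<in> (f ^^ n) ` {a<..<b}"
        using connectedD_interval[OF conn, of "(f ^^ n) y" "(f ^^ n) x" "1/2"] by auto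
      then show False using nh by auto
    qed
    have cl: "closure {a<..<b} = {a..b}" using assms by simp
    have side': "(\<forall>x\<in>{a..b}. (f ^^ n) x \<le> 1/2) \<or> (\<forall>x\<in>{a..b}. 1/2 \<le> (f ^^ n) x)"
      using side
    proof
      assume "\<forall>x\<in>{a<..<b}. (f ^^ n) x \<le> 1/2"
      then have "\<forall>x\<in>closure {a<..<b}. (f ^^ n) x \<le> 1/2"
        using continuous_le_on_closure[OF continuous_tent_pow] by blast
      then show ?thesis using cl by simp
    next
      assume "\<forall>x\<in>{a<..<b}. 1/2 \<le> (f ^^ n) x"
      then have "\<forall>x\<in>closure {a<..<b}. 1/2 \<le> (f ^^ n) x"
        using continuous_ge_on_closure[OF continuous_tent_pow] by blast
      then show ?thesis using cl by simp
    qed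
    then obtain t where t: "\<bar>t\<bar> = \<beta>" "\<And>x. x \<in> {a..b} \<Longrightarrow> f ((f ^^ n) x) - f ((f ^^ n) a) = t * ((f ^^ n) x - (f ^^ n) a)"
    proof
      assume "\<forall>x\<in>{a..b}. (f ^^ n) x \<le> 1/2"
      then show thesis using beta_gt_1 assms
        by (intro that[of \<beta>]) (auto simp: tent_left algebra_simps)
    next
      assume "\<forall>x\<in>{a..b}. 1/2 \<le> (f ^^ n) x"
      then show thesis using beta_gt_1 assms
        by (intro that[of "- \<beta>"]) (auto simp: tent_right algebra_simps)
    qed
    have "(f ^^ Suc n) x = (f ^^ Suc n) a + t * s * (x - a)" if "x \<in> {a..b}" for x
    proof -
      have "(f ^^ n) x - (f ^^ n) a = s * (x - a)" using s(2)[OF that] by simp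
      then have "f ((f ^^ n) x) - f ((f ^^ n) a) = t * (s * (x - a))" using t(2)[OF that] by simp
      then show ?thesis by simp
    qed
    moreover have "\<bar>t * s\<bar> = \<beta> ^ Suc n" using t(1) s(1) by (simp add: abs_mult)
    ultimately show ?case by blast
  qed
  have bound: "\<beta> ^ n * (b - a) \<le> 1" for n
  proof -
    obtain s where s: "\<bar>s\<bar> = \<beta> ^ n" "\<And>x. x \<in> {a..b} \<Longrightarrow> (f ^^ n) x = (f ^^ n) a + s * (x - a)"
      using affine by blast
    have "\<beta> ^ n * (b - a) = \<bar>(f ^^ n) b - (f ^^ n) a\<bar>" using s(1) s(2)[of b] assms by (simp add: abs_mult)
    also have "\<dots> \<le> 1" using tent_pow_in_unit[of a n] tent_pow_in_unit[of b n] assms by auto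
    finally show ?thesis .
  qed
  obtain n where "1 / (b - a) < \<beta> ^ n" using real_arch_pow[OF beta_gt_1] by blast
  then show False using bound[of n] assms by (simp add: field_simps)
qed


section \<open>The enlarged interval\<close>

abbreviation l where "l \<equiv> ins_left C len"
abbreviation r where "r \<equiv> ins_right C len"

definition L :: real where
  "L = r 1"

lemma summable_len_subset: "S \<subseteq> C \<Longrightarrow> len summable_on S"
  by (rule summable_on_subset_banach[OF len_summable])

lemma infsum_len_mono: "S \<subseteq> T \<Longrightarrow> T \<subseteq> C \<Longrightarrow> infsum len S \<le> infsum len T"
  by (intro infsum_mono_neutral summable_len_subset) (auto simp: len_nonneg)

lemma ins_right_eq: "r x = l x + len x"
proof (cases "x \<in> C")
  case True
  have eq: "{y\<in>C. y \<le> x} = insert x {y\<in>C. y < x}" using True by auto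
  have "infsum len (insert x {y\<in>C. y < x}) = len x + infsum len {y\<in>C. y < x}"
    by (intro infsum_insert summable_len_subset) auto
  then show ?thesis by (simp add: ins_left_def ins_right_def eq)
next
  case False
  then have "{y\<in>C. y \<le> x} = {y\<in>C. y < x}" by (auto simp: order_le_less)
  then show ?thesis using False by (simp add: ins_left_def ins_right_def len_zero)
qed

lemma ins_left_le_right: "l x \<le> r x"
  using len_nonneg by (simp add: ins_right_eq)

lemma ins_left_less_right: "x \<in> C \<Longrightarrow> l x < r x"
  using len_pos by (simp add: ins_right_eq)

lemma ins_left_eq_right: "x \<notin> C \<Longrightarrow> l x = r x"
  by (simp add: ins_right_eq len_zero)

text \<open>The summand \<open>y - x\<close> records that insertion never shrinks distances. It
  makes the way back to [0, 1] Lipschitz, on which the transfer of null sets and of limits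
  rests.\<close>

lemma ins_right_less_left: "x < y \<Longrightarrow> r x + (y - x) \<le> l y"
proof -
  assume "x < y"
  then have "infsum len {w\<in>C. w \<le> x} \<le> infsum len {w\<in>C. w < y}"
    by (intro infsum_len_mono) auto
  then show ?thesis by (simp add: ins_left_def ins_right_def)
qed

lemma ins_left_mono: "x \<le> y \<Longrightarrow> l x + (y - x) \<le> l y"
  using ins_right_less_left[of x y] ins_left_le_right[of x] by (cases "x = y") auto

lemma ins_right_mono: "x \<le> y \<Longrightarrow> r x + (y - x) \<le> r y"
  using ins_right_less_left[of x y] ins_left_le_right[of y] by (cases "x = y") auto

lemma ins_left_dist: "\<bar>x - y\<bar> \<le> \<bar>l x - l y\<bar>"
  using ins_left_mono[of x y] ins_left_mono[of y x] by linarith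

lemma ins_intervals_disjoint:
  "l x \<le> z \<Longrightarrow> z \<le> r x \<Longrightarrow> l y \<le> z \<Longrightarrow> z \<le> r y \<Longrightarrow> x = y"
  using ins_right_less_left[of x y] ins_right_less_left[of y x] by linarith

lemma ins_left_0: "l 0 = 0"
proof -
  have "{y\<in>C. y < 0} = {}" using surgery_points_unit by auto
  then show ?thesis by (simp add: ins_left_def del: Collect_empty_eq)
qed

lemma L_eq: "L = 1 + infsum len C"
proof -
  have "{y\<in>C. y \<le> 1} = C" using surgery_points_unit by auto
  then show ?thesis by (simp add: L_def ins_right_def)
qed

text \<open>Lengths are symmetric about 1/2, so what is inserted to the left of \<open>1 - x\<close>
  equals what is inserted to the right of \<open>x\<close>.\<close>

lemma ins_left_reflect: "l (1 - x) = L - r x"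
proof -
  have "infsum len {y\<in>C. y < 1 - x} = infsum len ((\<lambda>y. 1 - y) ` {y\<in>C. x < y})"
    using reflect_surgery_iff by (intro arg_cong[of _ _ "infsum len"]) (force simp: image_iff)
  also have "\<dots> = infsum (len \<circ> (\<lambda>y. 1 - y)) {y\<in>C. x < y}"
    by (intro infsum_reindex) (auto simp: inj_on_def)
  also have "\<dots> = infsum len {y\<in>C. x < y}" by (intro infsum_cong) (simp add: len_reflect)
  finally have 1: "infsum len {y\<in>C. y < 1 - x} = infsum len {y\<in>C. x < y}" .
  have "C = {y\<in>C. y \<le> x} \<union> {y\<in>C. x < y}" by auto
  then have "infsum len C = infsum len ({y\<in>C. y \<le> x} \<union> {y\<in>C. x < y})" by simp
  also have "\<dots> = infsum len {y\<in>C. y \<le> x} + infsum len {y\<in>C. x < y}"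
    by (intro infsum_Un_disjoint summable_len_subset) auto
  finally show ?thesis using 1 by (simp add: ins_left_def ins_right_def L_eq)
qed

lemma ins_right_reflect: "r (1 - x) = L - l x"
  using ins_left_reflect[of "1 - x"] by simp

lemma L_half: "L / 2 = l (1/2) + len (1/2) / 2"
  using ins_left_reflect[of "1/2"] ins_right_eq[of "1/2"] by simp

lemma L_ge_1: "1 \<le> L"
  using ins_right_mono[of 0 1] ins_left_le_right[of 0] ins_left_0 by (simp add: L_def)

lemma ins_in_range: "x \<in> {0..1} \<Longrightarrow> l x \<in> {0..L}" "x \<in> {0..1} \<Longrightarrow> r x \<in> {0..L}"
  using ins_left_mono[of 0 x] ins_right_mono[of x 1] ins_left_le_right[of x] ins_left_0
  by (auto simp: L_def)

text \<open>A finite set \<open>F\<close> carries all but e/2 of the length inserted to the left of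
  \<open>x\<close>. Any \<open>y\<close> to the right of \<open>F\<close> and within e/2 of
  \<open>x\<close> keeps this part.\<close>

lemma ins_left_left_continuous:
  assumes "0 < e" shows "\<exists>d>0. \<forall>y. x - d < y \<longrightarrow> y \<le> x \<longrightarrow> l x - e < l y"
proof -
  let ?S = "{y\<in>C. y < x}"
  have "(len has_sum infsum len ?S) ?S" by (intro has_sum_infsum summable_len_subset) auto
  then obtain F where F: "finite F" "F \<subseteq> ?S" "dist (sum len F) (infsum len ?S) \<le> e/2"
    using has_sum_finite_approximation[of len ?S _ "e/2"] assms by auto
  define d where "d = Min (insert (e/2) ((\<lambda>y. x - y) ` F))"
  have "0 < d" unfolding d_def using F assms by (subst Min_gr_iff) auto
  moreover have "l x - e < l y" if "x - d < y" "y \<le> x" for y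
  proof -
    have d: "d \<le> e/2" "\<And>v. v \<in> F \<Longrightarrow> d \<le> x - v"
      unfolding d_def using F(1) by (intro Min_le; simp)+
    then have "F \<subseteq> {v\<in>C. v < y}" using F that by force
    then have "infsum len F \<le> infsum len {v\<in>C. v < y}" by (intro infsum_len_mono) auto
    moreover have sumF: "infsum len F = sum len F" using F(1) by simp
    ultimately have "sum len F \<le> infsum len {v\<in>C. v < y}" by simp
    then have "infsum len ?S - e/2 \<le> infsum len {v\<in>C. v < y}" using F(3) sumF unfolding dist_real_def by linarith
    then show ?thesis using d(1) that by (simp add: ins_left_def)
  qed
  ultimately show ?thesis by blast
qed

lemma ins_right_right_continuous:
  assumes "0 < e" shows "\<exists>d>0. \<forall>y. x \<le> y \<longrightarrow> y < x + d \<longrightarrow> r y < r x + e"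
proof -
  obtain d where "0 < d" "\<And>y. 1 - x - d < y \<Longrightarrow> y \<le> 1 - x \<Longrightarrow> l (1 - x) - e < l y"
    using ins_left_left_continuous[OF assms] by metis
  then have "r y < r x + e" if "x \<le> y" "y < x + d" for y
    using that ins_left_reflect[of x] ins_left_reflect[of y]
      \<open>\<And>y. 1 - x - d < y \<Longrightarrow> y \<le> 1 - x \<Longrightarrow> l (1 - x) - e < l y\<close>[of "1 - y"] by simp
  then show ?thesis using \<open>0 < d\<close> by blast
qed

text \<open>Take the supremum of the points whose left end is at most \<open>z\<close>: left
  continuity of \<open>l\<close> gives the lower bound on \<open>z\<close>, right continuity of
  \<open>r\<close> the upper one.\<close>

lemma ins_intervals_cover:
  assumes "z \<in> {0..L}" shows "\<exists>x\<in>{0..1}. l x \<le> z \<and> z \<le> r x"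
proof -
  define A where "A = {x\<in>{0..1}. l x \<le> z}"
  define x where "x = Sup A"
  have "0 \<in> A" using assms ins_left_0 by (simp add: A_def)
  have bdd: "bdd_above A" by (rule bdd_aboveI[of _ 1]) (simp add: A_def)
  have ub: "y \<le> x" if "y \<in> A" for y unfolding x_def by (rule cSup_upper[OF that bdd])
  have approx: "\<exists>v\<in>A. y < v" if "y < x" for y
    using less_cSup_iff[OF _ bdd] that \<open>0 \<in> A\<close> unfolding x_def by blast
  have "x \<le> 1" unfolding x_def using \<open>0 \<in> A\<close> by (intro cSup_least) (blast, simp add: A_def)
  moreover have "0 \<le> x" using ub \<open>0 \<in> A\<close> by blast
  moreover have "l x \<le> z"
  proof (rule ccontr)
    assume "\<not> l x \<le> z"
    then obtain d where "0 < d" and d: "\<And>y. x - d < y \<Longrightarrow> y \<le> x \<Longrightarrow> l x - (l x - z) < l y"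
      using ins_left_left_continuous[of "l x - z" x] by auto
    then obtain v where "v \<in> A" "x - d < v" using approx[of "x - d"] by auto
    then show False using d[of v] ub[of v] by (auto simp: A_def)
  qed
  moreover have "z \<le> r x"
  proof (rule ccontr)
    assume "\<not> z \<le> r x"
    then have "x < 1" using \<open>x \<le> 1\<close> assms by (cases "x = 1") (auto simp: L_def)
    obtain d where "0 < d" and d: "\<And>y. x \<le> y \<Longrightarrow> y < x + d \<Longrightarrow> r y < r x + (z - r x)"
      using ins_right_right_continuous[of "z - r x" x] \<open>\<not> z \<le> r x\<close> by auto
    define y where "y = min 1 (x + d/2)"
    have y: "x < y" "y < x + d" "y \<le> 1" using \<open>x < 1\<close> \<open>0 < d\<close> by (auto simp: y_def)
    then have "l y \<le> z" using d[of y] ins_left_le_right[of y] by simp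
    then have "y \<in> A" using y \<open>0 \<le> x\<close> by (simp add: A_def)
    then show False using ub y by fastforce
  qed
  ultimately show ?thesis by auto
qed

text \<open>Off \<open>C\<close> the two ends coincide, so left continuity of \<open>l\<close> and
  right continuity of \<open>r\<close> fit together.\<close>

lemma isCont_ins_left: assumes "x \<notin> C" shows "isCont l x"
  unfolding continuous_at_eps_delta
proof (intro allI impI)
  fix e :: real assume "0 < e"
  obtain d1 where d1: "0 < d1" "\<And>y. x - d1 < y \<Longrightarrow> y \<le> x \<Longrightarrow> l x - e < l y"
    using ins_left_left_continuous[OF \<open>0 < e\<close>] by metis
  obtain d2 where d2: "0 < d2" "\<And>y. x \<le> y \<Longrightarrow> y < x + d2 \<Longrightarrow> r y < r x + e"
    using ins_right_right_continuous[OF \<open>0 < e\<close>] by metis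
  have "dist (l y) (l x) < e" if "dist y x < min d1 d2" for y
  proof (cases "y \<le> x")
    case True
    then show ?thesis using that d1(2)[of y] ins_left_mono[of y x] by (auto simp: dist_real_def)
  next
    case False
    then show ?thesis
      using that d2(2)[of y] ins_left_mono[of x y] ins_left_le_right[of y] ins_left_eq_right[OF assms]
      by (auto simp: dist_real_def)
  qed
  then show "\<exists>d>0. \<forall>y. dist y x < d \<longrightarrow> dist (l y) (l x) < e" using d1 d2 by (metis min_less_iff_conj)
qed

end

section \<open>The modified map\<close>

definition pos_part :: "real \<Rightarrow> real" where
  "pos_part u = max 0 u"

lemma pos_part_power_deriv:
  "((\<lambda>u. (pos_part u) ^ Suc (Suc n)) has_real_derivative (real (Suc (Suc n)) * (pos_part u) ^ Suc n)) (at u)"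
proof -
  consider "u < 0" | "u = 0" | "0 < u" by linarith
  then show ?thesis
  proof cases
    case 1
    then have "((\<lambda>u. 0) has_real_derivative (real (Suc (Suc n)) * (pos_part u) ^ Suc n)) (at u)"
      by (simp add: pos_part_def)
    then show ?thesis
      by (rule has_field_derivative_transform_within_open[of _ _ _ "{..<0}"]) (use 1 in \<open>auto simp: pos_part_def\<close>)
  next
    case 2
    have "(\<lambda>h. (pos_part h) ^ Suc (Suc n) / h) \<midarrow>0\<rightarrow> 0"
    proof (rule Lim_null_comparison)
      have "norm ((pos_part h) ^ Suc (Suc n) / h) \<le> \<bar>h\<bar> ^ Suc n" for h
      proof (cases "0 < h")
        case False
        then have "pos_part h = 0" by (simp add: pos_part_def)
        then show ?thesis by (simp del: power_Suc)
      qed (simp add: pos_part_def)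
      then show "\<forall>\<^sub>F h in at 0. norm ((pos_part h) ^ Suc (Suc n) / h) \<le> \<bar>h\<bar> ^ Suc n" by simp
      show "((\<lambda>h::real. \<bar>h\<bar> ^ Suc n) \<longlongrightarrow> 0) (at 0)"
        by (rule tendsto_eq_intros | simp)+
    qed
    then show ?thesis using 2 by (simp add: DERIV_def pos_part_def)
  next
    case 3
    have "((\<lambda>u. u ^ Suc (Suc n)) has_real_derivative (real (Suc (Suc n)) * u ^ Suc n)) (at u)"
      using DERIV_pow[of "Suc (Suc n)" u] by simp
    then have "((\<lambda>u. (pos_part u) ^ Suc (Suc n)) has_real_derivative (real (Suc (Suc n)) * u ^ Suc n)) (at u)"
      by (rule has_field_derivative_transform_within_open[of _ _ _ "{0<..}"])
        (use 3 in \<open>auto simp: pos_part_def\<close>)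
    then show ?thesis using 3 by (simp add: pos_part_def)
  qed
qed

lemma pos_part_square_deriv:
  "((\<lambda>u. (pos_part u)\<^sup>2) has_real_derivative (2 * pos_part u)) (at u)"
  using pos_part_power_deriv[of 0] by (simp add: numeral_2_eq_2)

lemma pos_part_cube_deriv:
  "((\<lambda>u. (pos_part u) ^ 3) has_real_derivative (3 * (pos_part u)\<^sup>2)) (at u)"
  using pos_part_power_deriv[of 1] by (simp add: numeral_3_eq_3 numeral_2_eq_2)

lemma continuous_pos_part: "continuous_on S pos_part"
  unfolding pos_part_def[abs_def] by (intro continuous_intros)

text \<open>The cubic \<open>3u\<^sup>2 - 2u\<^sup>3\<close> on \<open>[0, 1]\<close>, continued by the constants 0 and 1; the form below
  makes it visible that the function is \<open>C\<^sup>1\<close>.\<close>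

definition smoothstep :: "real \<Rightarrow> real" where
  "smoothstep u = 3 * (pos_part u)\<^sup>2 - 2 * (pos_part u) ^ 3
     + 3 * (pos_part (u - 1))\<^sup>2 + 2 * (pos_part (u - 1)) ^ 3"

definition smoothstep' :: "real \<Rightarrow> real" where
  "smoothstep' u = 6 * pos_part u - 6 * (pos_part u)\<^sup>2
     + 6 * pos_part (u - 1) + 6 * (pos_part (u - 1))\<^sup>2"

lemma smoothstep_deriv: "(smoothstep has_real_derivative smoothstep' u) (at u)"
proof -
  note d = pos_part_square_deriv pos_part_cube_deriv
  have shift: "((\<lambda>u. u - 1) has_real_derivative 1) (at u)" by (auto intro!: derivative_eq_intros)
  show ?thesis unfolding smoothstep_def[abs_def] smoothstep'_def
    by (rule derivative_eq_intros d DERIV_chain2[OF d(1) shift] DERIV_chain2[OF d(2) shift] refl | simp)+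
qed

lemma smoothstep_le_0: "u \<le> 0 \<Longrightarrow> smoothstep u = 0" "u \<le> 0 \<Longrightarrow> smoothstep' u = 0"
  by (auto simp: smoothstep_def smoothstep'_def pos_part_def)

lemma smoothstep_ge_1: assumes "1 \<le> u" shows "smoothstep u = 1" "smoothstep' u = 0"
  using assms
  by (auto simp: smoothstep_def smoothstep'_def pos_part_def max_def power2_eq_square power3_eq_cube algebra_simps)

lemma smoothstep'_unit: assumes "0 \<le> u" "u \<le> 1" shows "smoothstep' u = 6 * u * (1 - u)"
  using assms by (simp add: smoothstep'_def pos_part_def power2_eq_square algebra_simps)

lemma smoothstep'_nonneg: "0 \<le> smoothstep' u"
proof -
  consider "u \<le> 0" | "1 \<le> u" | "0 \<le> u" "u \<le> 1" by linarith
  then show ?thesis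
    by cases (simp_all add: smoothstep_le_0 smoothstep_ge_1 smoothstep'_unit)
qed

text \<open>The maximum of \<open>6 * u * (1 - u)\<close>, at u = 1/2. What matters is that it is
  below \<open>\<beta> / (\<beta> - 1)\<close>, which is at least 2.\<close>

lemma smoothstep'_le: "smoothstep' u \<le> 3/2"
proof -
  have "6 * u * (1 - u) = 3/2 - 6 * (u - 1/2)\<^sup>2" by (simp add: power2_eq_square algebra_simps)
  moreover have "0 \<le> 6 * (u - 1/2)\<^sup>2" by simp
  ultimately have le: "6 * u * (1 - u) \<le> 3/2" by linarith
  consider "u \<le> 0" | "1 \<le> u" | "0 \<le> u" "u \<le> 1" by linarith
  then show ?thesis
  proof cases
    case 3
    then show ?thesis by (simp only: smoothstep'_unit le)
  qed (simp_all add: smoothstep_le_0 smoothstep_ge_1)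
qed

lemma smoothstep_bounds: "0 \<le> smoothstep u" "smoothstep u \<le> 1"
proof -
  have mono: "mono smoothstep"
  proof (rule monoI)
    fix a b :: real assume "a \<le> b"
    then show "smoothstep a \<le> smoothstep b"
      by (rule DERIV_nonneg_imp_nondecreasing) (meson smoothstep_deriv smoothstep'_nonneg)
  qed
  show "0 \<le> smoothstep u" using monoD[OF mono, of "min 0 u" u] smoothstep_le_0[of "min 0 u"] by simp
  show "smoothstep u \<le> 1" using monoD[OF mono, of u "max 1 u"] smoothstep_ge_1[of "max 1 u"] by simp
qed

lemma continuous_smoothstep': "continuous_on S smoothstep'"
  unfolding smoothstep'_def[abs_def]
  by (intro continuous_intros continuous_on_compose2[OF continuous_pos_part[of UNIV]]) auto

section \<open>The left branch as a series of bumps\<close>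

context pcf_tent
begin

text \<open>Only the left half of the map is built by hand; the right half will be its mirror
  image.\<close>

definition CL :: "real set" where
  "CL = {x\<in>C. x < 1/2}"

definition excess :: "real \<Rightarrow> real" where
  "excess x = len (f x) - \<beta> * len x"

text \<open>Affine coordinate on the left half of the interval inserted at 1/2: 0 at its left end, 1
  at its midpoint \<open>L / 2\<close>.\<close>

definition turn_pos :: "real \<Rightarrow> real" where
  "turn_pos z = (z - l (1/2)) / (len (1/2) / 2)"

text \<open>A slope that falls linearly from \<open>\<beta>\<close> to 0 over the length
  \<open>len (1/2) / 2\<close> covers \<open>\<beta> * len (1/2) / 4\<close>; the bump has to cover
  the rest of the image.\<close>

definition turn_excess :: real where
  "turn_excess = len (f (1/2)) - \<beta> * len (1/2) / 4"

text \<open>On the interval inserted at \<open>x < 1/2\<close> the map has slope \<open>\<beta>\<close> plus a bump, which vanishes at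
  the endpoints and makes up for the difference of \<open>len (f x)\<close> and \<open>\<beta> * len x\<close>. On the left half of
  the interval inserted at \<open>1/2\<close> the slope \<open>\<beta>\<close> decreases linearly to 0, again up to a bump.\<close>

definition H :: "real \<Rightarrow> real" where
  "H z = \<beta> * z + (\<Sum>\<^sub>\<infinity>x\<in>CL. excess x * smoothstep ((z - l x) / len x))
     + turn_excess * smoothstep (turn_pos z) - \<beta> * len (1/2) / 4 * (pos_part (turn_pos z))\<^sup>2"

definition H' :: "real \<Rightarrow> real" where
  "H' z = \<beta> + (\<Sum>\<^sub>\<infinity>x\<in>CL. excess x / len x * smoothstep' ((z - l x) / len x))
     + turn_excess * smoothstep' (turn_pos z) / (len (1/2) / 2) - \<beta> * pos_part (turn_pos z)"

text \<open>The series is cut off by level because the level controls the height of the bumps in the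
  slope.\<close>

definition CLn :: "nat \<Rightarrow> real set" where
  "CLn n = {x\<in>CL. lev x \<le> n}"

definition Hn :: "nat \<Rightarrow> real \<Rightarrow> real" where
  "Hn n z = \<beta> * z + (\<Sum>x\<in>CLn n. excess x * smoothstep ((z - l x) / len x))
     + turn_excess * smoothstep (turn_pos z) - \<beta> * len (1/2) / 4 * (pos_part (turn_pos z))\<^sup>2"

definition Hn' :: "nat \<Rightarrow> real \<Rightarrow> real" where
  "Hn' n z = \<beta> + (\<Sum>x\<in>CLn n. excess x / len x * smoothstep' ((z - l x) / len x))
     + turn_excess * smoothstep' (turn_pos z) / (len (1/2) / 2) - \<beta> * pos_part (turn_pos z)"

lemma CL_subset: "CL \<subseteq> C" and CLn_subset: "CLn n \<subseteq> CL" and finite_CLn: "finite (CLn n)"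
proof -
  show "CL \<subseteq> C" "CLn n \<subseteq> CL" by (auto simp: CL_def CLn_def)
  have "CLn n \<subseteq> {x\<in>C. lev x \<le> n}" by (auto simp: CL_def CLn_def)
  then show "finite (CLn n)" using finite_level_le finite_subset by blast
qed

lemma half_len_pos: "0 < len (1/2) / 2"
  using len_pos[OF half_surgery] by simp

lemma turn_excess_nonneg: "0 \<le> turn_excess"
proof -
  have "\<beta> * len (1/2) \<le> 2 * len (1/2)"
    using beta_le_2 len_nonneg by (intro mult_right_mono) auto
  then show ?thesis
    using len_tent_ge[OF half_surgery] len_nonneg[of "1/2"] by (simp add: turn_excess_def)
qed

lemma inj_on_tent_left: "inj_on f {..1/2}"
  using beta_gt_1 by (auto simp: inj_on_def tent_left)

text \<open>\<open>f\<close> is injective on the left half, so the image lengths are a subfamily of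
  all lengths.\<close>

lemma len_tent_summable: assumes "S \<subseteq> CL" shows "(\<lambda>x. len (f x)) summable_on S"
proof -
  have "S \<subseteq> {..1/2}" using assms by (auto simp: CL_def)
  then have "inj_on f S" by (rule inj_on_subset[OF inj_on_tent_left])
  moreover have "f ` S \<subseteq> C"
  proof (rule image_subsetI)
    fix x assume "x \<in> S"
    then have "x \<in> C" using assms by (auto simp: CL_def)
    then show "f x \<in> C" using tent_surgery_iff surgery_points_unit by blast
  qed
  ultimately show ?thesis
    using summable_on_reindex[of f S len] summable_len_subset by (simp add: o_def)
qed

lemma excess_summable: assumes "S \<subseteq> CL" shows "excess summable_on S"
proof -
  have "(\<lambda>x. len (f x) + (- \<beta>) * len x) summable_on S"
    using assms CL_subset len_tent_summable summable_len_subset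
    by (intro summable_on_add summable_on_cmult_right) auto
  then show ?thesis by (simp add: excess_def[abs_def])
qed

text \<open>\<open>f\<close> maps the part of \<open>C\<close> below \<open>x\<close> bijectively
  onto the part below \<open>f x\<close>, so the total excess is what \<open>l\<close> gains at
  \<open>f x\<close> over the linear map. This is why \<open>H\<close> sends \<open>l x\<close> to
  \<open>l (f x)\<close>.\<close>

lemma infsum_excess:
  assumes "x \<le> 1/2"
  shows "infsum excess {y\<in>CL. y < x} = l (f x) - \<beta> * l x"
proof -
  let ?S = "{y\<in>CL. y < x}"
  have S: "?S = {y\<in>C. y < x}" using assms by (auto simp: CL_def)
  have sub: "?S \<subseteq> CL" by auto
  have img: "f ` ?S = {y\<in>C. y < f x}"
  proof (intro subset_antisym subsetI)
    fix y assume "y \<in> f ` ?S"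
    then obtain v where v: "v \<in> CL" "v < x" "y = f v" by auto
    then have "v \<in> C" by (simp add: CL_def)
    then have "y \<in> C" using tent_surgery_iff surgery_points_unit v by blast
    then show "y \<in> {y\<in>C. y < f x}" using v assms beta_gt_1 by (auto simp: tent_left)
  next
    fix y assume y: "y \<in> {y\<in>C. y < f x}"
    have v: "0 \<le> y / \<beta>" "y / \<beta> < x" using y surgery_points_unit assms beta_gt_1 by (auto simp: tent_left field_simps)
    then have "y / \<beta> \<le> 1/2" using assms by linarith
    then have "f (y / \<beta>) = y" using beta_gt_1 by (subst tent_left) auto
    moreover have "y / \<beta> \<in> C" using tent_surgery_iff[of "y / \<beta>"] calculation y v assms by auto
    ultimately show "y \<in> f ` ?S" using v S by (metis (mono_tags, lifting) image_eqI mem_Collect_eq)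
  qed
  have inj: "inj_on f ?S" by (rule inj_on_subset[OF inj_on_tent_left]) (auto simp: CL_def)
  have "infsum excess ?S = (\<Sum>\<^sub>\<infinity>y\<in>?S. len (f y) + (- \<beta>) * len y)"
    by (simp add: excess_def[abs_def])
  also have "\<dots> = (\<Sum>\<^sub>\<infinity>y\<in>?S. len (f y)) + (\<Sum>\<^sub>\<infinity>y\<in>?S. (- \<beta>) * len y)"
    using sub CL_subset
    by (intro infsum_add summable_on_cmult_right len_tent_summable summable_len_subset) auto
  also have "(\<Sum>\<^sub>\<infinity>y\<in>?S. len (f y)) = infsum len {y\<in>C. y < f x}"
    using infsum_reindex[OF inj, of len] img by (simp add: o_def)
  also have "(\<Sum>\<^sub>\<infinity>y\<in>?S. (- \<beta>) * len y) = (- \<beta>) * infsum len {y\<in>C. y < x}"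
    unfolding S by (rule infsum_cmult_right')
  finally show ?thesis using assms by (simp add: ins_left_def tent_left algebra_simps)
qed

lemma excess_ratio: "x \<in> C \<Longrightarrow> excess x / len x = len (f x) / len x - \<beta>"
  using len_pos[of x] by (simp add: excess_def diff_divide_distrib)

lemma bump_support:
  assumes "x \<in> C" "smoothstep' ((z - l x) / len x) \<noteq> 0" shows "l x \<le> z" "z \<le> r x"
proof -
  have "\<not> (z - l x) / len x \<le> 0" "\<not> 1 \<le> (z - l x) / len x"
    using assms smoothstep_le_0 smoothstep_ge_1 by metis+
  then show "l x \<le> z" "z \<le> r x" using len_pos[OF assms(1)] by (auto simp: ins_right_eq field_simps not_le)
qed

text \<open>As the bumps have disjoint supports, at most one term of the sum is nonzero.\<close>

lemma bump_sum_cases: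
  assumes "\<And>y. y \<in> CL \<Longrightarrow> l y \<le> z \<Longrightarrow> z \<le> r y \<Longrightarrow> y = x" "S \<subseteq> CL"
  shows "(\<Sum>\<^sub>\<infinity>y\<in>S. excess y / len y * smoothstep' ((z - l y) / len y)) =
    (if x \<in> S then excess x / len x * smoothstep' ((z - l x) / len x) else 0)"
proof -
  let ?e = "\<lambda>y. excess y / len y * smoothstep' ((z - l y) / len y)"
  have "?e y = 0" if "y \<in> S" "y \<noteq> x" for y
  proof (rule ccontr)
    assume "?e y \<noteq> 0"
    then have "smoothstep' ((z - l y) / len y) \<noteq> 0" by auto
    then show False using assms that bump_support[of y z] CL_subset by blast
  qed
  then have "infsum ?e S = infsum ?e (S \<inter> {x})"
    by (intro infsum_cong_neutral) auto
  then show ?thesis by (cases "x \<in> S") auto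
qed

text \<open>In this form a point \<open>z\<close> in no interval is included vacuously, which saves
  later case distinctions.\<close>

lemma ins_interval_unique: "\<exists>x. \<forall>y. l y \<le> z \<longrightarrow> z \<le> r y \<longrightarrow> y = x"
  using ins_intervals_disjoint[of _ z] by (cases "\<exists>x. l x \<le> z \<and> z \<le> r x") blast+

text \<open>At most one bump is active at \<open>z\<close>, and it is missing from the partial sum
  only if its level exceeds n. Its height is then at most 6 / (n + 1), the deviation of the ratio,
  times the maximum 3/2 of \<open>smoothstep'\<close>.\<close>

lemma bump_sum_deviation:
  "\<bar>H' z - Hn' n z\<bar> \<le> 9 / (real n + 1)"
proof -
  let ?e = "\<lambda>y. excess y / len y * smoothstep' ((z - l y) / len y)"
  obtain x where x: "\<And>y. l y \<le> z \<Longrightarrow> z \<le> r y \<Longrightarrow> y = x"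
    using ins_interval_unique[of z] by blast
  have inf: "infsum ?e S = (if x \<in> S then ?e x else 0)" if "S \<subseteq> CL" for S
    by (rule bump_sum_cases[OF x that])
  have "H' z - Hn' n z = infsum ?e CL - infsum ?e (CLn n)"
    unfolding H'_def Hn'_def infsum_finite[OF finite_CLn] by simp
  also have "\<dots> = (if x \<in> CL \<and> x \<notin> CLn n then ?e x else 0)"
    unfolding inf[OF order_refl] inf[OF CLn_subset] using CLn_subset[of n] by (simp add: subset_iff)
  finally have eq: "H' z - Hn' n z = (if x \<in> CL \<and> x \<notin> CLn n then ?e x else 0)" .
  show ?thesis
  proof (cases "x \<in> CL \<and> x \<notin> CLn n")
    case True
    then have "x \<in> C" "n < lev x" using CL_subset by (auto simp: CLn_def)
    then obtain m where m: "lev x = Suc m" "n \<le> m" by (metis Suc_le_D Suc_le_eq Suc_le_mono)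
    have "\<bar>?e x\<bar> \<le> 6 / (real m + 1) * (3/2)"
      unfolding abs_mult excess_ratio[OF \<open>x \<in> C\<close>]
      using smoothstep'_nonneg smoothstep'_le len_tent_deviation[OF \<open>x \<in> C\<close> m(1)]
      by (intro mult_mono) auto
    also have "\<dots> = 9 / (real m + 1)" by (simp add: field_simps)
    also have "\<dots> \<le> 9 / (real n + 1)" using m(2) by (simp add: frac_le)
    finally show ?thesis using eq True by simp
  next
    case False
    then show ?thesis unfolding eq by auto
  qed
qed

lemma turn_pos_deriv: "(turn_pos has_real_derivative 1 / (len (1/2) / 2)) (at z)"
  unfolding turn_pos_def[abs_def] using half_len_pos
  by (auto intro!: derivative_eq_intros)

lemma Hn_deriv: "(Hn n has_real_derivative Hn' n z) (at z)"
proof -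
  have d: "((\<lambda>z. smoothstep ((z - l x) / len x)) has_real_derivative
      smoothstep' ((z - l x) / len x) * (1 / len x)) (at z)" if "x \<in> CLn n" for x
  proof (rule DERIV_chain2[OF smoothstep_deriv])
    have "len x \<noteq> 0" using that CLn_subset[of n] CL_subset len_pos by force
    then show "((\<lambda>z. (z - l x) / len x) has_real_derivative 1 / len x) (at z)"
      by (auto intro!: derivative_eq_intros)
  qed
  have "((\<lambda>z. \<Sum>x\<in>CLn n. excess x * smoothstep ((z - l x) / len x)) has_real_derivative
      (\<Sum>x\<in>CLn n. excess x * (smoothstep' ((z - l x) / len x) * (1 / len x)))) (at z)"
    using d by (intro DERIV_sum DERIV_cmult)
  then have "(Hn n has_real_derivative (\<beta> * 1 + (\<Sum>x\<in>CLn n. excess x * (smoothstep' ((z - l x) / len x) * (1 / len x)))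
     + turn_excess * (smoothstep' (turn_pos z) * (1 / (len (1/2) / 2)))
     - \<beta> * len (1/2) / 4 * (2 * pos_part (turn_pos z) * (1 / (len (1/2) / 2))))) (at z)"
    unfolding Hn_def[abs_def]
    by (intro DERIV_add DERIV_diff DERIV_cmult DERIV_ident
        DERIV_chain2[OF smoothstep_deriv turn_pos_deriv] DERIV_chain2[OF pos_part_square_deriv turn_pos_deriv])
  moreover have "(\<beta> * 1 + (\<Sum>x\<in>CLn n. excess x * (smoothstep' ((z - l x) / len x) * (1 / len x)))
     + turn_excess * (smoothstep' (turn_pos z) * (1 / (len (1/2) / 2)))
     - \<beta> * len (1/2) / 4 * (2 * pos_part (turn_pos z) * (1 / (len (1/2) / 2)))) = Hn' n z"
    unfolding Hn'_def using half_len_pos by simp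
  ultimately show ?thesis by simp
qed

lemma continuous_turn_pos: "continuous_on S turn_pos"
  using turn_pos_deriv by (meson DERIV_continuous continuous_at_imp_continuous_on)

lemma continuous_Hn': "continuous_on S (Hn' n)"
proof -
  have "continuous_on S (\<lambda>z. (z - l x) / len x)" for x
    unfolding divide_inverse by (intro continuous_intros)
  then have "continuous_on S (\<lambda>z. smoothstep' ((z - l x) / len x))" for x
    by (intro continuous_on_compose2[OF continuous_smoothstep'[of UNIV]]) auto
  moreover have "continuous_on S (\<lambda>z. smoothstep' (turn_pos z))" "continuous_on S (\<lambda>z. pos_part (turn_pos z))"
    by (intro continuous_on_compose2[OF continuous_smoothstep'[of UNIV]]
        continuous_on_compose2[OF continuous_pos_part[of UNIV]] continuous_turn_pos; simp)+
  ultimately show ?thesis unfolding Hn'_def[abs_def] using half_len_pos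
    by (intro continuous_intros) auto
qed

lemma deviation_bound_tendsto_0: "(\<lambda>n. 9 / (real n + 1)) \<longlonglongrightarrow> 0"
  using tendsto_mult_right_zero[OF LIMSEQ_inverse_real_of_nat, of 9]
  by (simp add: divide_inverse add.commute)

lemma continuous_H': "continuous_on S H'"
proof (rule uniform_limit_theorem)
  show "\<forall>\<^sub>F n in sequentially. continuous_on S (Hn' n)" by (simp add: continuous_Hn')
  show "uniform_limit S Hn' H' sequentially"
    unfolding uniform_limit_iff
  proof (intro allI impI)
    fix e :: real assume "0 < e"
    then have "\<forall>\<^sub>F n in sequentially. 9 / (real n + 1) < e"
      using deviation_bound_tendsto_0 by (simp add: order_tendsto_iff)
    then show "\<forall>\<^sub>F n in sequentially. \<forall>z\<in>S. dist (Hn' n z) (H' z) < e"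
    proof (rule eventually_mono, intro ballI)
      fix n z assume "9 / (real n + 1) < e"
      then show "dist (Hn' n z) (H' z) < e"
        using bump_sum_deviation[of z n] by (simp add: dist_real_def abs_minus_commute)
    qed
  qed
qed simp

lemma CLn_exhaust: "filterlim CLn (finite_subsets_at_top CL) sequentially"
  unfolding filterlim_finite_subsets_at_top
proof (intro allI impI)
  fix X assume X: "finite X \<and> X \<subseteq> CL"
  show "\<forall>\<^sub>F n in sequentially. finite (CLn n) \<and> X \<subseteq> CLn n \<and> CLn n \<subseteq> CL"
  proof (rule eventually_sequentiallyI)
    fix n assume "Max (insert 0 (lev ` X)) \<le> n"
    then show "finite (CLn n) \<and> X \<subseteq> CLn n \<and> CLn n \<subseteq> CL"
      using X finite_CLn CLn_subset by (auto simp: CLn_def)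
  qed
qed

lemma H_terms_summable: "(\<lambda>x. excess x * smoothstep ((z - l x) / len x)) summable_on CL"
proof -
  have "(\<lambda>x. norm (excess x)) summable_on CL"
    using excess_summable[OF order_refl] summable_on_iff_abs_summable_on_real by blast
  then have "(\<lambda>x. norm (excess x * smoothstep ((z - l x) / len x))) summable_on CL"
  proof (rule Infinite_Sum.abs_summable_on_comparison_test')
    show "norm (excess x * smoothstep ((z - l x) / len x)) \<le> norm (excess x)" for x
      using smoothstep_bounds by (simp add: abs_mult mult_left_le)
  qed
  then show ?thesis by (rule abs_summable_summable)
qed

lemma Hn_tendsto: "(\<lambda>n. Hn n z) \<longlonglongrightarrow> H z"
proof -
  have "((\<lambda>x. excess x * smoothstep ((z - l x) / len x)) has_sum
      (\<Sum>\<^sub>\<infinity>x\<in>CL. excess x * smoothstep ((z - l x) / len x))) CL"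
    by (intro has_sum_infsum H_terms_summable)
  then have "(\<lambda>n. \<Sum>x\<in>CLn n. excess x * smoothstep ((z - l x) / len x)) \<longlonglongrightarrow>
      (\<Sum>\<^sub>\<infinity>x\<in>CL. excess x * smoothstep ((z - l x) / len x))"
    unfolding has_sum_def by (rule filterlim_compose[OF _ CLn_exhaust])
  then show ?thesis unfolding Hn_def H_def by (intro tendsto_intros)
qed

text \<open>Termwise differentiation: the slopes converge uniformly, so the partial sums converge to
  some function with derivative \<open>H'\<close>, and their pointwise limit is
  \<open>H\<close>.\<close>

lemma H_deriv: "(H has_real_derivative H' z) (at z)"
proof -
  have "\<exists>g. \<forall>z\<in>UNIV. (\<lambda>n. Hn n z) \<longlonglongrightarrow> g z \<and> (g has_derivative (\<lambda>h. H' z * h)) (at z within UNIV)"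
  proof (rule has_derivative_sequence)
    show "(Hn n has_derivative (\<lambda>h. Hn' n z * h)) (at z within UNIV)" for n z
      using Hn_deriv[of n z] by (simp add: has_field_derivative_def)
    show "\<forall>\<^sub>F n in sequentially. \<forall>z\<in>UNIV. \<forall>h. norm (Hn' n z * h - H' z * h) \<le> e * norm h"
      if "0 < e" for e
    proof -
      have "\<forall>\<^sub>F n in sequentially. 9 / (real n + 1) < e"
        using deviation_bound_tendsto_0 that by (simp add: order_tendsto_iff)
      then show ?thesis
      proof (rule eventually_mono, intro ballI allI)
        fix n z h assume n: "9 / (real n + 1) < e"
        have "norm (Hn' n z * h - H' z * h) = \<bar>H' z - Hn' n z\<bar> * norm h"
          by (simp add: abs_mult abs_minus_commute flip: left_diff_distrib)
        also have "\<dots> \<le> e * norm h"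
          using bump_sum_deviation[of z n] n by (intro mult_right_mono) auto
        finally show "norm (Hn' n z * h - H' z * h) \<le> e * norm h" .
      qed
    qed
    show "(\<lambda>n. Hn n 0) \<longlonglongrightarrow> H 0" by (rule Hn_tendsto)
  qed auto
  then obtain g where g: "\<And>z. (\<lambda>n. Hn n z) \<longlonglongrightarrow> g z" "\<And>z. (g has_real_derivative H' z) (at z)"
    by (auto simp: has_field_derivative_def)
  have "g = H"
  proof
    show "g z = H z" for z by (rule LIMSEQ_unique[OF g(1) Hn_tendsto])
  qed
  then show ?thesis using g(2) by blast
qed

section \<open>Values and slopes on the inserted intervals\<close>

lemma turn_pos_nonpos_iff: "turn_pos z \<le> 0 \<longleftrightarrow> z \<le> l (1/2)"
  and turn_pos_ge_1_iff: "1 \<le> turn_pos z \<longleftrightarrow> L / 2 \<le> z"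
  using half_len_pos by (auto simp: turn_pos_def L_half field_simps)

text \<open>Bumps to the left of \<open>x\<close> are complete and contribute their whole excess,
  those to the right contribute nothing; \<open>infsum_excess\<close> evaluates the completed
  part.\<close>

lemma H_ins_interval:
  assumes "0 \<le> x" "x < 1/2" "0 \<le> u" "u \<le> 1"
  shows "H (l x + len x * u) = l (f x) + \<beta> * len x * u + excess x * smoothstep u"
proof -
  let ?z = "l x + len x * u"
  have z: "l x \<le> ?z" "?z \<le> r x"
    using assms len_nonneg[of x] by (auto simp: ins_right_eq mult_left_le)
  have "?z \<le> l (1/2)" using ins_right_less_left[of x "1/2"] z assms by simp
  then have t: "turn_pos ?z \<le> 0" by (simp add: turn_pos_nonpos_iff)
  let ?h = "\<lambda>y. excess y * smoothstep ((?z - l y) / len y)"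
  have "infsum ?h CL = infsum ?h ({y\<in>CL. y < x} \<union> {y\<in>CL. y = x})"
  proof (rule infsum_cong_neutral)
    fix y assume "y \<in> CL - ({y\<in>CL. y < x} \<union> {y\<in>CL. y = x})"
    then have "y \<in> C" "\<not> y < x" "y \<noteq> x" using CL_subset by auto
    then have "y \<in> C" "x < y" by auto
    then have "(?z - l y) / len y \<le> 0"
      using ins_right_less_left[of x y] z len_pos[of y] by (simp add: divide_nonpos_pos)
    then show "?h y = 0" by (simp add: smoothstep_le_0)
  qed auto
  also have "\<dots> = infsum ?h {y\<in>CL. y < x} + infsum ?h {y\<in>CL. y = x}"
    by (intro infsum_Un_disjoint summable_on_subset_banach[OF H_terms_summable]) auto
  also have "infsum ?h {y\<in>CL. y < x} = infsum excess {y\<in>CL. y < x}"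
  proof (rule infsum_cong)
    fix y assume "y \<in> {y\<in>CL. y < x}"
    then have "y \<in> C" "y < x" using CL_subset by auto
    then have "1 \<le> (?z - l y) / len y"
      using ins_right_less_left[of y x] z len_pos[of y] by (simp add: ins_right_eq field_simps)
    then show "?h y = excess y" by (simp add: smoothstep_ge_1)
  qed
  also have "infsum ?h {y\<in>CL. y = x} = excess x * smoothstep u"
  proof (cases "x \<in> C")
    case True
    then have "{y\<in>CL. y = x} = {x}" using assms by (auto simp: CL_def)
    then show ?thesis using len_pos[OF True] by simp
  next
    case False
    then have "{y\<in>CL. y = x} = {}" by (auto simp: CL_def)
    moreover have "excess x = 0"
      using False tent_surgery_iff[of x] assms by (simp add: excess_def len_zero)
    ultimately show ?thesis by simp
  qed
  finally have "infsum ?h CL = l (f x) - \<beta> * l x + excess x * smoothstep u"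
    using infsum_excess[of x] assms by simp
  then show ?thesis
    using t by (simp add: H_def smoothstep_le_0 pos_part_def algebra_simps)
qed

lemma H_ins_left: "0 \<le> x \<Longrightarrow> x < 1/2 \<Longrightarrow> H (l x) = l (f x)"
  using H_ins_interval[of x 0] by (simp add: smoothstep_le_0)

lemma H_ins_right: "0 \<le> x \<Longrightarrow> x < 1/2 \<Longrightarrow> H (r x) = r (f x)"
  using H_ins_interval[of x 1] by (simp add: smoothstep_ge_1 ins_right_eq excess_def)

lemma H_turn_interval:
  assumes "0 \<le> w"
  shows "H (l (1/2) + len (1/2) / 2 * w) = l (f (1/2)) + \<beta> * len (1/2) / 2 * w
    + turn_excess * smoothstep w - \<beta> * len (1/2) / 4 * w\<^sup>2"
proof -
  let ?z = "l (1/2) + len (1/2) / 2 * w"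
  have z: "l (1/2) \<le> ?z" using assms half_len_pos by simp
  let ?h = "\<lambda>y. excess y * smoothstep ((?z - l y) / len y)"
  have "infsum ?h CL = infsum excess CL"
  proof (rule infsum_cong)
    fix y assume "y \<in> CL"
    then have "y \<in> C" "y < 1/2" by (auto simp: CL_def)
    then have "1 \<le> (?z - l y) / len y"
      using ins_right_less_left[of y "1/2"] z len_pos[of y] by (simp add: ins_right_eq field_simps)
    then show "?h y = excess y" by (simp add: smoothstep_ge_1)
  qed
  moreover have "{y\<in>CL. y < 1/2} = CL" by (auto simp: CL_def)
  ultimately have "infsum ?h CL = l (f (1/2)) - \<beta> * l (1/2)" using infsum_excess[of "1/2"] by simp
  moreover have "turn_pos ?z = w" using half_len_pos by (simp add: turn_pos_def)
  ultimately show ?thesis using assms by (simp add: H_def pos_part_def algebra_simps)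
qed

lemma H_turn_left: "H (l (1/2)) = l (f (1/2))"
  using H_turn_interval[of 0] by (simp add: smoothstep_le_0)

text \<open>\<open>turn_excess\<close> is chosen for this: the linear part, the bump and the
  quadratic part add up to \<open>len (f (1/2))\<close> at the midpoint.\<close>

lemma H_turn: "H (L / 2) = r (f (1/2))"
proof -
  have "H (L / 2) = H (l (1/2) + len (1/2) / 2 * 1)" by (simp only: L_half mult_1_right)
  also have "\<dots> = r (f (1/2))"
    by (subst H_turn_interval) (simp_all add: smoothstep_ge_1 turn_excess_def ins_right_eq)
  finally show ?thesis .
qed

lemma H'_left:
  assumes "\<And>y. y \<in> CL \<Longrightarrow> l y \<le> z \<Longrightarrow> z \<le> r y \<Longrightarrow> y = x" "z \<le> l (1/2)"
  shows "H' z = \<beta> + (if x \<in> CL then excess x / len x * smoothstep' ((z - l x) / len x) else 0)"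
proof -
  have s: "(\<Sum>\<^sub>\<infinity>y\<in>CL. excess y / len y * smoothstep' ((z - l y) / len y)) =
    (if x \<in> CL then excess x / len x * smoothstep' ((z - l x) / len x) else 0)"
    by (rule bump_sum_cases) (use assms in auto)
  have "turn_pos z \<le> 0" using assms(2) by (simp add: turn_pos_nonpos_iff)
  then show ?thesis unfolding H'_def s by (simp add: smoothstep_le_0 pos_part_def)
qed

lemma H'_ins_left: assumes "x \<le> 1/2" shows "H' (l x) = \<beta>"
proof -
  have "\<And>y. y \<in> CL \<Longrightarrow> l y \<le> l x \<Longrightarrow> l x \<le> r y \<Longrightarrow> y = x"
    using ins_intervals_disjoint ins_left_le_right by blast
  then show ?thesis using ins_left_mono[of x "1/2"] assms
    by (subst H'_left[of _ x]) (auto simp: smoothstep_le_0)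
qed

lemma H'_ins_right: assumes "x < 1/2" shows "H' (r x) = \<beta>"
proof -
  have "\<And>y. y \<in> CL \<Longrightarrow> l y \<le> r x \<Longrightarrow> r x \<le> r y \<Longrightarrow> y = x"
    using ins_intervals_disjoint ins_left_le_right by blast
  moreover have "smoothstep' ((r x - l x) / len x) = 0"
    by (cases "x \<in> C") (auto simp: ins_right_eq len_zero smoothstep_le_0 smoothstep_ge_1 dest: len_pos)
  ultimately show ?thesis using ins_right_less_left[of x "1/2"] assms
    by (subst H'_left[of _ x]) auto
qed

lemma H'_right_half:
  assumes "l (1/2) < z"
  shows "H' z = \<beta> * (1 - turn_pos z) + turn_excess * smoothstep' (turn_pos z) / (len (1/2) / 2)"
proof -
  have "y = 1/2" if "y \<in> CL" "z \<le> r y" for y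
  proof -
    have "y < 1/2" using that by (simp add: CL_def)
    then have "r y < l (1/2)" using ins_right_less_left[of y "1/2"] by simp
    then show ?thesis using that assms by simp
  qed
  then have "(\<Sum>\<^sub>\<infinity>y\<in>CL. excess y / len y * smoothstep' ((z - l y) / len y)) = 0"
    by (subst bump_sum_cases[of z "1/2"]) (auto simp: CL_def)
  moreover have "0 < turn_pos z" using assms turn_pos_nonpos_iff[of z] by simp
  ultimately show ?thesis by (simp add: H'_def pos_part_def algebra_simps)
qed

lemma H'_turn: "H' (L / 2) = 0"
proof -
  have "turn_pos (L / 2) = 1" using half_len_pos by (simp add: turn_pos_def L_half)
  moreover have "l (1/2) < L / 2" using half_len_pos by (simp add: L_half)
  ultimately show ?thesis using H'_right_half[of "L / 2"] smoothstep_ge_1(2)[of 1] by simp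
qed

text \<open>The worst case is level 0, where \<open>excess x / len x\<close> is
  \<open>1 - \<beta>\<close>: with the bump at most 3/2 the slope is still at least (3 -
  \<open>\<beta>\<close>)/2. Beyond \<open>l (1/2)\<close> the linear slope is positive and the bump
  only adds to it.\<close>

lemma H'_pos: assumes "z < L / 2" shows "0 < H' z"
proof (cases "z \<le> l (1/2)")
  case True
  obtain x where x: "\<And>y. l y \<le> z \<Longrightarrow> z \<le> r y \<Longrightarrow> y = x"
    using ins_interval_unique[of z] by blast
  show ?thesis
  proof (cases "x \<in> CL")
    case False
    then show ?thesis using H'_left[OF x True] beta_gt_1 by simp
  next
    case True
    then have "x \<in> C" using CL_subset by blast
    define s where "s = smoothstep' ((z - l x) / len x)"
    have "1 - \<beta> \<le> excess x / len x"
      using len_tent_ge[OF \<open>x \<in> C\<close>] len_pos[OF \<open>x \<in> C\<close>] by (simp add: excess_ratio[OF \<open>x \<in> C\<close>])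
    then have "(1 - \<beta>) * s \<le> excess x / len x * s"
      using smoothstep'_nonneg by (intro mult_right_mono) (auto simp: s_def)
    moreover have "(1 - \<beta>) * (3/2) \<le> (1 - \<beta>) * s"
      using beta_gt_1 smoothstep'_le by (intro mult_left_mono_neg) (auto simp: s_def)
    ultimately have "\<beta> + (1 - \<beta>) * (3/2) \<le> \<beta> + excess x / len x * s" by linarith
    moreover have "0 < \<beta> + (1 - \<beta>) * (3/2)" using beta_le_2 by (simp add: field_simps)
    moreover have "H' z = \<beta> + excess x / len x * s"
      unfolding s_def using H'_left[of z x] x True \<open>z \<le> l (1/2)\<close> by simp
    ultimately show ?thesis by linarith
  qed
next
  case False
  then have "turn_pos z < 1" using assms turn_pos_ge_1_iff[of z] by simp
  moreover have "0 \<le> turn_excess * smoothstep' (turn_pos z) / (len (1/2) / 2)"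
    using turn_excess_nonneg smoothstep'_nonneg half_len_pos by simp
  ultimately show ?thesis using False beta_gt_1 by (simp add: H'_right_half add_pos_nonneg)
qed

lemma H_strict_mono: assumes "a < b" "b \<le> L / 2" shows "H a < H b"
proof (rule DERIV_pos_imp_increasing_open[OF assms(1)])
  show "\<And>x. a < x \<Longrightarrow> x < b \<Longrightarrow> \<exists>y. (H has_real_derivative y) (at x) \<and> 0 < y"
  proof -
    fix x assume "x < b"
    then have "0 < H' x" using assms by (intro H'_pos) simp
    then show "\<exists>y. (H has_real_derivative y) (at x) \<and> 0 < y" using H_deriv by blast
  qed
  show "continuous_on {a..b} H"
    using H_deriv by (meson DERIV_continuous continuous_at_imp_continuous_on)
qed

end

text \<open>Uniqueness of the turning point: between two of them the map would be both increasing
  and decreasing.\<close>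

lemma unimodal_onI:
  assumes "a < t" "t < b" "strict_mono_on {a..t} h" "strict_antimono_on {t..b} h" "continuous_on {a..b} h"
  shows "unimodal_on a b h"
proof -
  have unique: "s = t" if s: "s \<in> {a<..<b}" "strict_mono_on {a..s} h" "strict_antimono_on {s..b} h" for s
  proof (rule ccontr)
    assume "s \<noteq> t"
    then consider "s < t" | "t < s" by linarith
    then show False
    proof cases
      case 1
      then have "h s < h t" "h t < h s"
        using strict_mono_onD[OF assms(3), of s t] monotone_onD[OF s(3), of s t] s(1) assms(2) by auto
      then show False by simp
    next
      case 2
      then have "h t < h s" "h s < h t"
        using strict_mono_onD[OF s(2), of t s] monotone_onD[OF assms(4), of t s] s(1) assms(1) by auto
      then show False by simp
    qed
  qed
  have "t \<in> {a<..<b}" using assms by simp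
  then show ?thesis unfolding unimodal_on_def
  proof (intro conjI ex1I[of _ t] assms)
    fix s assume "s \<in> {a<..<b} \<and> strict_mono_on {a..s} h \<and> strict_antimono_on {s..b} h"
    then show "s = t" by (elim conjE) (rule unique)
  qed
qed

text \<open>Derivatives are relative to the set, so that the ends of closed intervals are covered.
  The difference quotient of the inverse is the reciprocal of that of \<open>h\<close> along the
  inverse, which is continuous by compactness.\<close>

lemma C1_on_inv_into:
  fixes h :: "real \<Rightarrow> real"
  assumes "compact S" "inj_on h S" "continuous_on S h'"
    and deriv: "\<And>x. x \<in> S \<Longrightarrow> (h has_real_derivative h' x) (at x within S)"
    and nz: "\<And>x. x \<in> S \<Longrightarrow> h' x \<noteq> 0"
  shows "C1_on (h ` S) (inv_into S h)"
proof -
  let ?g = "inv_into S h"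
  have cont: "continuous_on S h" using deriv by (meson DERIV_continuous continuous_on_eq_continuous_within)
  have contg: "continuous_on (h ` S) ?g"
    by (rule continuous_on_inv[OF cont assms(1)]) (simp add: assms(2))
  have "(?g has_real_derivative inverse (h' (?g y))) (at y within h ` S)" if y: "y \<in> h ` S" for y
  proof -
    have x: "?g y \<in> S" "h (?g y) = y" using y by (auto simp: inv_into_into f_inv_into_f)
    have "((\<lambda>x. (h x - h (?g y)) / (x - ?g y)) \<longlongrightarrow> h' (?g y)) (at (?g y) within S)"
      using deriv[OF x(1)] by (simp add: has_field_derivative_iff)
    moreover have "filterlim ?g (at (?g y) within S) (at y within h ` S)"
      unfolding filterlim_at
    proof (rule conjI[rotated])
      show "(?g \<longlongrightarrow> ?g y) (at y within h ` S)"
        using contg y unfolding continuous_on_def by blast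
      have "?g v \<in> S \<and> ?g v \<noteq> ?g y" if "v \<in> h ` S" "v \<noteq> y" for v
        using that inv_into_into[OF that(1)] f_inv_into_f[OF that(1)] x(2) by auto
      then show "\<forall>\<^sub>F v in at y within h ` S. ?g v \<in> S \<and> ?g v \<noteq> ?g y"
        by (simp add: eventually_at_filter)
    qed
    ultimately have "((\<lambda>v. (h (?g v) - h (?g y)) / (?g v - ?g y)) \<longlongrightarrow> h' (?g y)) (at y within h ` S)"
      by (rule filterlim_compose)
    then have "((\<lambda>v. inverse ((h (?g v) - h (?g y)) / (?g v - ?g y))) \<longlongrightarrow> inverse (h' (?g y))) (at y within h ` S)"
      using nz[OF x(1)] by (rule tendsto_inverse)
    then have "((\<lambda>v. (?g v - ?g y) / (v - y)) \<longlongrightarrow> inverse (h' (?g y))) (at y within h ` S)"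
    proof (rule Lim_transform_eventually)
      show "\<forall>\<^sub>F v in at y within h ` S. inverse ((h (?g v) - h (?g y)) / (?g v - ?g y)) = (?g v - ?g y) / (v - y)"
        unfolding eventually_at_filter
        by (rule always_eventually) (auto simp: x(2) f_inv_into_f assms(2))
    qed
    then show ?thesis by (simp add: has_field_derivative_iff)
  qed
  moreover have "continuous_on (h ` S) (\<lambda>y. inverse (h' (?g y)))"
    using nz by (intro continuous_on_inverse continuous_on_compose2[OF assms(3) contg])
      (auto simp: assms(2))
  ultimately show ?thesis unfolding C1_on_def
    by (intro exI[of _ "\<lambda>y. inverse (h' (?g y))"] conjI ballI)
qed

section \<open>Folding and rescaling: the maps \<open>G\<close> and \<open>g\<close>\<close>

context pcf_tent
begin

definition G :: "real \<Rightarrow> real" where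
  "G z = H (min z (L - z))"

text \<open>As \<open>H'\<close> vanishes at \<open>L / 2\<close>, on each side one of the two
  clamped terms is 0. In this form continuity is immediate.\<close>

definition G' :: "real \<Rightarrow> real" where
  "G' z = H' (min z (L / 2)) - H' (min (L - z) (L / 2))"

lemma G_left: "z \<le> L / 2 \<Longrightarrow> G z = H z" and G_right: "L / 2 \<le> z \<Longrightarrow> G z = H (L - z)"
  by (simp_all add: G_def min_absorb1 min_absorb2)

lemma G_reflect: "G (L - z) = G z"
  by (simp add: G_def min.commute)

lemma G'_left: "z \<le> L / 2 \<Longrightarrow> G' z = H' z" and G'_right: "L / 2 \<le> z \<Longrightarrow> G' z = - H' (L - z)"
  by (simp_all add: G'_def min_absorb1 min_absorb2 H'_turn)

lemma G_deriv: "(G has_real_derivative G' z) (at z)"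
proof -
  consider "z < L / 2" | "L / 2 < z" | "z = L / 2" by linarith
  then show ?thesis
  proof cases
    case 1
    have "(G has_real_derivative H' z) (at z)"
      by (rule has_field_derivative_transform_within_open[of H _ _ "{..<L / 2}"])
        (use 1 H_deriv in \<open>auto simp: G_left\<close>)
    then show ?thesis using 1 by (simp add: G'_left)
  next
    case 2
    have "((\<lambda>z. H (L - z)) has_real_derivative H' (L - z) * (- 1)) (at z)"
      by (rule DERIV_chain2[OF H_deriv]) (auto intro!: derivative_eq_intros)
    then have "(G has_real_derivative H' (L - z) * (- 1)) (at z)"
      by (rule has_field_derivative_transform_within_open[of _ _ _ "{L / 2<..}"])
        (use 2 in \<open>auto simp: G_right\<close>)
    then show ?thesis using 2 by (simp add: G'_right)
  next
    case 3
    \<comment> \<open>At the fold, \<open>G (L / 2 + h)\<close> equals \<open>H\<close> at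
      \<open>L / 2 - \<bar>h\<bar>\<close>, so the quotient agrees up to sign with one of
      \<open>H\<close>, whose limit is 0.\<close>
    have "(\<lambda>h. (H (L / 2 + h) - H (L / 2)) / h) \<midarrow>0\<rightarrow> 0"
      using H_deriv[of "L / 2"] by (simp add: DERIV_def H'_turn)
    moreover have "filterlim (\<lambda>h::real. - \<bar>h\<bar>) (at 0) (at 0)"
      unfolding filterlim_at by (auto intro!: tendsto_eq_intros simp: eventually_at_filter)
    ultimately have "(\<lambda>h. (H (L / 2 + - \<bar>h\<bar>) - H (L / 2)) / (- \<bar>h\<bar>)) \<midarrow>0\<rightarrow> 0"
      by (rule filterlim_compose)
    then have "(\<lambda>h. (G (L / 2 + h) - G (L / 2)) / h) \<midarrow>0\<rightarrow> 0"
    proof (rule Lim_transform_bound[rotated])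
      have "G (L / 2 + h) = H (L / 2 + - \<bar>h\<bar>)" for h
        by (cases "h \<le> 0") (simp_all add: G_left G_right)
      then show "\<forall>\<^sub>F h in at 0. norm ((G (L / 2 + h) - G (L / 2)) / h)
          \<le> norm ((H (L / 2 + - \<bar>h\<bar>) - H (L / 2)) / (- \<bar>h\<bar>))"
        by (simp add: G_left)
    qed
    moreover have "G' (L / 2) = 0" by (simp add: G'_left H'_turn)
    ultimately show ?thesis unfolding 3 DERIV_def by simp
  qed
qed

lemma continuous_G': "continuous_on S G'"
  unfolding G'_def[abs_def]
  by (intro continuous_intros continuous_on_compose2[OF continuous_H'[of UNIV]]) auto

lemma C1_on_G: "C1_on S G"
  unfolding C1_on_def using G_deriv continuous_G' by (meson has_field_derivative_at_within)

lemma continuous_G: "continuous_on S G"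
  using G_deriv by (meson DERIV_continuous continuous_at_imp_continuous_on)

lemma strict_mono_G: "strict_mono_on {..L / 2} G"
  by (auto intro!: strict_mono_onI simp: G_left H_strict_mono)

lemma strict_antimono_G: "strict_antimono_on {L / 2..} G"
  by (auto intro!: monotone_onI simp: G_right H_strict_mono)

lemma unimodal_G: assumes "a < L / 2" "L / 2 < b" shows "unimodal_on a b G"
proof (rule unimodal_onI[OF assms])
  show "strict_mono_on {a..L / 2} G" by (rule monotone_on_subset[OF strict_mono_G]) auto
  show "strict_antimono_on {L / 2..b} G" by (rule monotone_on_subset[OF strict_antimono_G]) auto
qed (rule continuous_G)

lemma half_between: "l (1/2) < L / 2" "L / 2 < r (1/2)"
  using L_half ins_left_reflect[of "1/2"] half_len_pos by auto

lemma ins_le_half: "x < 1/2 \<Longrightarrow> r x < L / 2" "x \<le> 1/2 \<Longrightarrow> l x < L / 2"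
  using ins_right_less_left[of x "1/2"] ins_left_mono[of x "1/2"] half_between by auto

lemma ins_ge_half: "1/2 < x \<Longrightarrow> L / 2 < l x" "1/2 \<le> x \<Longrightarrow> L / 2 < r x"
  using ins_right_less_left[of "1/2" x] ins_right_mono[of "1/2" x] half_between by auto

lemma G_ins_left_half: "0 \<le> x \<Longrightarrow> x \<le> 1/2 \<Longrightarrow> G (l x) = l (f x)"
proof (cases "x < 1/2")
  case False
  assume "x \<le> 1/2"
  with False have x: "x = 1/2" by simp
  show ?thesis unfolding x using H_turn_left ins_le_half(2)[of "1/2"] by (simp add: G_left)
qed (use ins_le_half(2)[of x] H_ins_left[of x] in \<open>auto simp: G_left\<close>)

lemma G_ins_right_half: "0 \<le> x \<Longrightarrow> x < 1/2 \<Longrightarrow> G (r x) = r (f x)"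
  using ins_le_half(1)[of x] H_ins_right[of x] by (auto simp: G_left)

lemma G_ins_right_reflect: "1/2 \<le> x \<Longrightarrow> x \<le> 1 \<Longrightarrow> G (r x) = l (f x)"
  using G_ins_left_half[of "1 - x"] ins_left_reflect[of x] G_reflect[of "r x"] tent_reflect[of x] by simp

lemma G_ins_left_reflect: "1/2 < x \<Longrightarrow> x \<le> 1 \<Longrightarrow> G (l x) = r (f x)"
  using G_ins_right_half[of "1 - x"] ins_right_reflect[of x] G_reflect[of "l x"] tent_reflect[of x] by simp

lemma G_turn: "G (L / 2) = r (f (1/2))"
  by (simp add: G_left H_turn)

text \<open>On the right half \<open>G\<close> reverses orientation and sends left ends to right
  ends; off \<open>C\<close> these coincide.\<close>

lemma G_ins_left_non_surgery: assumes "x \<in> {0..1} - C" shows "G (l x) = l (f x)"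
proof (cases "x \<le> 1/2")
  case False
  moreover have "f x \<notin> C" using assms tent_surgery_iff by auto
  ultimately show ?thesis using G_ins_left_reflect[of x] assms ins_left_eq_right[of "f x"] by auto
qed (use assms G_ins_left_half in auto)

lemma H_mono: "a \<le> b \<Longrightarrow> b \<le> L / 2 \<Longrightarrow> H a \<le> H b"
  using H_strict_mono[of a b] by (cases "a = b") auto

lemma G_image_ins: assumes "x \<in> {0..1}" shows "G ` {l x..r x} = {l (f x)..r (f x)}"
proof -
  have half: "G ` {l x..r x} = {l (f x)..r (f x)}" if x: "0 \<le> x" "x < 1/2" for x
  proof (intro subset_antisym subsetI)
    fix y assume "y \<in> G ` {l x..r x}"
    then obtain z where z: "l x \<le> z" "z \<le> r x" "y = G z" by auto
    then have "H (l x) \<le> H z" "H z \<le> H (r x)"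
      using H_mono[of "l x" z] H_mono[of z "r x"] ins_le_half(1)[of x] x by auto
    then show "y \<in> {l (f x)..r (f x)}"
      using x z H_ins_left H_ins_right ins_le_half(1)[of x] by (simp add: G_left)
  next
    fix y assume "y \<in> {l (f x)..r (f x)}"
    then have "\<exists>z. l x \<le> z \<and> z \<le> r x \<and> G z = y"
      using x G_ins_left_half G_ins_right_half ins_left_le_right
      by (intro IVT') (auto intro: continuous_G)
    then show "y \<in> G ` {l x..r x}" by auto
  qed
  consider "x < 1/2" | "1/2 < x" | "x = 1/2" by linarith
  then show ?thesis
  proof cases
    case 2
    have "{l (1 - x)..r (1 - x)} = (\<lambda>z. L - z) ` {l x..r x}"
      by (simp add: ins_left_reflect ins_right_reflect)
    then have "G ` {l (1 - x)..r (1 - x)} = G ` {l x..r x}"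
      by (simp add: image_image G_reflect del: image_diff_atLeastAtMost)
    then show ?thesis using half[of "1 - x"] 2 assms by (simp add: tent_reflect)
  next
    case 3
    show ?thesis unfolding 3
    proof (intro subset_antisym subsetI)
      fix y assume "y \<in> G ` {l (1/2)..r (1/2)}"
      then obtain z where z: "l (1/2) \<le> z" "z \<le> r (1/2)" "y = G z" by auto
      \<comment> \<open>Folding at the midpoint moves the point into the left half, where
        \<open>H\<close> is monotone.\<close>
      define w where "w = min z (L - z)"
      have w: "l (1/2) \<le> w" "w \<le> L / 2" using z ins_left_reflect[of "1/2"] by (auto simp: w_def min_def)
      then have "H (l (1/2)) \<le> H w" "H w \<le> H (L / 2)"
        using H_mono[of "l (1/2)" w] H_mono[of w "L / 2"] by auto
      then show "y \<in> {l (f (1/2))..r (f (1/2))}"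
        using z(3) H_turn_left H_turn by (simp add: G_def w_def)
    next
      fix y assume "y \<in> {l (f (1/2))..r (f (1/2))}"
      then have "\<exists>z. l (1/2) \<le> z \<and> z \<le> L / 2 \<and> G z = y"
        using G_ins_left_half[of "1/2"] G_turn half_between
        by (intro IVT') (auto intro: continuous_G)
      then obtain z where "l (1/2) \<le> z" "z \<le> L / 2" "G z = y" by blast
      then show "y \<in> G ` {l (1/2)..r (1/2)}" using half_between by (intro image_eqI[of _ _ z]) auto
    qed
  qed (use half assms in auto)
qed

lemma G_range: "G ` {0..L} \<subseteq> {0..L}"
proof (rule image_subsetI)
  fix z assume "z \<in> {0..L}"
  then obtain x where x: "x \<in> {0..1}" "z \<in> {l x..r x}" using ins_intervals_cover by force
  then have "G z \<in> {l (f x)..r (f x)}" using G_image_ins by blast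
  then show "G z \<in> {0..L}" using ins_in_range[OF tent_in_unit[OF x(1)]] by auto
qed

text \<open>The closed interval inserted at a point other than 1/2 misses \<open>L / 2\<close>, so
  \<open>G\<close> is injective there and its slope does not vanish.\<close>

lemma G_ins_diffeo:
  assumes "x \<in> C - {1/2}"
  shows "C1_diffeo (ins_interval C len x) (ins_interval C len (f x)) G"
proof -
  have x: "x \<in> {0..1}" "x < 1/2 \<or> 1/2 < x" using assms surgery_points_unit by auto
  let ?I = "{l x..r x}"
  have side: "?I \<subseteq> {..<L / 2} \<or> ?I \<subseteq> {L / 2<..}"
    using x(2) ins_le_half(1)[of x] ins_ge_half(1)[of x] by auto
  have inj: "inj_on G ?I"
    using side
  proof
    assume "?I \<subseteq> {..<L / 2}"
    then have "?I \<subseteq> {..L / 2}" by auto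
    then show ?thesis
      using strict_mono_on_imp_inj_on[OF strict_mono_G] inj_on_subset by blast
  next
    assume "?I \<subseteq> {L / 2<..}"
    then have "?I \<subseteq> {L / 2..}" by auto
    then have "strict_antimono_on ?I G" by (rule monotone_on_subset[OF strict_antimono_G])
    then show ?thesis
      unfolding monotone_on_def by (intro inj_onI) (metis (no_types) less_irrefl linorder_neqE_linordered_idom)
  qed
  have nz: "G' z \<noteq> 0" if "z \<in> ?I" for z
    using side that H'_pos[of z] H'_pos[of "L - z"] G'_left[of z] G'_right[of z] by fastforce
  have "bij_betw G ?I {l (f x)..r (f x)}"
    using inj G_image_ins[OF x(1)] by (simp add: bij_betw_def)
  moreover have "C1_on (G ` ?I) (inv_into ?I G)"
    using nz by (intro C1_on_inv_into[OF _ inj continuous_G'] has_field_derivative_at_within[OF G_deriv]) auto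
  ultimately show ?thesis
    using G_image_ins[OF x(1)] C1_on_G by (simp add: C1_diffeo_def ins_interval_def)
qed

definition g :: "real \<Rightarrow> real" where
  "g t = G (L * t) / L"

text \<open>The factor \<open>L\<close> from the inner scaling cancels the outer division, so affine
  conjugation leaves slopes unchanged.\<close>

definition g' :: "real \<Rightarrow> real" where
  "g' t = G' (L * t)"

lemma g_surgery: "denjoy_like_surgery \<beta> g"
  unfolding denjoy_like_surgery_def Let_def
proof (rule exI[of _ len], rule exI[of _ G], intro conjI ballI)
  show "unimodal_on (l (1/2)) (r (1/2)) G" using unimodal_G half_between by blast
  show "G ` ins_interval C len (1/2) = ins_interval C len (f (1/2))"
    using G_image_ins[of "1/2"] by (simp add: ins_interval_def)
  show "g t = G (r 1 * t) / r 1" if "t \<in> {0..1}" for t by (simp add: g_def L_def)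
qed (use len_pos len_summable G_ins_diffeo G_ins_left_non_surgery in auto)

lemma L_pos: "0 < L"
  using L_ge_1 by simp

lemma g_deriv: "(g has_real_derivative g' t) (at t within S)"
proof -
  have "((\<lambda>t. G (L * t)) has_real_derivative G' (L * t) * L) (at t)"
    by (rule DERIV_chain2[OF G_deriv]) (auto intro!: derivative_eq_intros)
  then have "((\<lambda>t. G (L * t) / L) has_real_derivative G' (L * t) * L / L) (at t)"
    by (rule DERIV_cdivide)
  then show ?thesis unfolding g_def[abs_def] g'_def using L_pos by (simp add: has_field_derivative_at_within)
qed

lemma continuous_g': "continuous_on S g'"
  unfolding g'_def[abs_def] by (intro continuous_intros continuous_on_compose2[OF continuous_G'[of UNIV]]) auto

lemma C1_on_g: "C1_on S g"
  unfolding C1_on_def using g_deriv continuous_g' by blast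

lemma continuous_g: "continuous_on S g"
  unfolding g_def[abs_def] using L_pos
  by (intro continuous_intros continuous_on_compose2[OF continuous_G[of UNIV]]) auto

lemma g_range: "g ` {0..1} \<subseteq> {0..1}"
proof (rule image_subsetI)
  fix t :: real assume "t \<in> {0..1}"
  then have "L * t \<in> {0..L}" using L_pos by (auto simp: mult_left_le)
  then have "G (L * t) \<in> {0..L}" using G_range by blast
  then show "g t \<in> {0..1}" using L_pos by (auto simp: g_def)
qed

lemma strict_mono_g: "strict_mono_on {..1/2} g"
  using strict_mono_onD[OF strict_mono_G] L_pos
  by (intro strict_mono_onI) (auto simp: g_def divide_strict_right_mono)

lemma strict_antimono_g: "strict_antimono_on {1/2..} g"
  using monotone_onD[OF strict_antimono_G] L_pos
  by (intro monotone_onI) (auto simp: g_def divide_strict_right_mono)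

lemma unimodal_g: "unimodal_on 0 1 g"
proof (rule unimodal_onI[of _ "1/2"])
  show "strict_mono_on {0..1/2} g" by (rule monotone_on_subset[OF strict_mono_g]) auto
  show "strict_antimono_on {1/2..1} g" by (rule monotone_on_subset[OF strict_antimono_g]) auto
  show "continuous_on {0..1} g" by (rule continuous_g)
qed simp_all


section \<open>Sets of positive measure under the tent map\<close>

text \<open>Maximality is not demanded; what counts is that \<open>f ^^ n\<close> carries a lap
  affinely onto one of the finitely many intervals with ends in \<open>Q\<close>.\<close>

definition lap :: "nat \<Rightarrow> real \<Rightarrow> real \<Rightarrow> bool" where
  "lap n a b \<longleftrightarrow> a < b \<and> {a..b} \<subseteq> {0..1} \<and> (f ^^ n) a \<in> Q \<and> (f ^^ n) b \<in> Q \<and>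
     (\<exists>s. \<bar>s\<bar> = \<beta> ^ n \<and> (\<forall>y\<in>{a..b}. (f ^^ n) y = (f ^^ n) a + s * (y - a)))"

lemma lap_step:
  assumes "lap n a b"
    and side: "(f ^^ n) a \<le> 1/2 \<and> (f ^^ n) b \<le> 1/2 \<or> 1/2 \<le> (f ^^ n) a \<and> 1/2 \<le> (f ^^ n) b"
  shows "lap (Suc n) a b"
proof -
  obtain s where ab: "a < b" "{a..b} \<subseteq> {0..1}" "(f ^^ n) a \<in> Q" "(f ^^ n) b \<in> Q" and s: "\<bar>s\<bar> = \<beta> ^ n"
    "\<And>y. y \<in> {a..b} \<Longrightarrow> (f ^^ n) y = (f ^^ n) a + s * (y - a)"
    using assms(1) unfolding lap_def by blast
  have between: "min ((f ^^ n) a) ((f ^^ n) b) \<le> (f ^^ n) y \<and> (f ^^ n) y \<le> max ((f ^^ n) a) ((f ^^ n) b)"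
    if "y \<in> {a..b}" for y
  proof -
    have y: "(f ^^ n) y = (f ^^ n) a + s * (y - a)" "(f ^^ n) b = (f ^^ n) a + s * (b - a)"
      using s(2)[OF that] s(2)[of b] ab(1) by auto
    show ?thesis
    proof (cases "0 \<le> s")
      case True
      then have "0 \<le> s * (y - a)" "s * (y - a) \<le> s * (b - a)" using that by (auto intro: mult_left_mono)
      then show ?thesis unfolding y by auto
    next
      case False
      then have "s * (y - a) \<le> 0" "s * (b - a) \<le> s * (y - a)"
        using that by (auto intro: mult_nonpos_nonneg mult_left_mono_neg)
      then show ?thesis unfolding y by auto
    qed
  qed
  have "\<exists>t. \<bar>t\<bar> = \<beta> \<and> (\<forall>y\<in>{a..b}. f ((f ^^ n) y) - f ((f ^^ n) a) = t * ((f ^^ n) y - (f ^^ n) a))"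
    using side
  proof
    assume "(f ^^ n) a \<le> 1/2 \<and> (f ^^ n) b \<le> 1/2"
    then have "\<forall>y\<in>{a..b}. (f ^^ n) y \<le> 1/2" "(f ^^ n) a \<le> 1/2" using between by fastforce+
    then show ?thesis using beta_gt_1 by (intro exI[of _ \<beta>]) (simp add: tent_left right_diff_distrib)
  next
    assume "1/2 \<le> (f ^^ n) a \<and> 1/2 \<le> (f ^^ n) b"
    then have "\<forall>y\<in>{a..b}. 1/2 \<le> (f ^^ n) y" "1/2 \<le> (f ^^ n) a" using between by fastforce+
    then show ?thesis using beta_gt_1 by (intro exI[of _ "- \<beta>"]) (simp add: tent_right algebra_simps)
  qed
  then obtain t where t: "\<bar>t\<bar> = \<beta>"
    "\<And>y. y \<in> {a..b} \<Longrightarrow> f ((f ^^ n) y) - f ((f ^^ n) a) = t * ((f ^^ n) y - (f ^^ n) a)" by blast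
  have "(f ^^ Suc n) y = (f ^^ Suc n) a + (t * s) * (y - a)" if "y \<in> {a..b}" for y
  proof -
    have "(f ^^ n) y - (f ^^ n) a = s * (y - a)" using s(2)[OF that] by simp
    then have "f ((f ^^ n) y) - f ((f ^^ n) a) = t * (s * (y - a))" using t(2)[OF that] by simp
    then show ?thesis by simp
  qed
  moreover have "\<bar>t * s\<bar> = \<beta> ^ Suc n" using s(1) t(1) by (simp add: abs_mult)
  moreover have "(f ^^ Suc n) a \<in> Q" "(f ^^ Suc n) b \<in> Q" using tent_Q ab(3,4) by simp_all
  ultimately show ?thesis unfolding lap_def using ab(1,2)
    by (intro conjI exI[of _ "t * s"] ballI)
qed

lemma lap_subinterval:
  assumes "lap n a b" "a \<le> a'" "a' < b'" "b' \<le> b" "(f ^^ n) a' \<in> Q" "(f ^^ n) b' \<in> Q"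
  shows "lap n a' b'"
proof -
  obtain s where ab: "a < b" "{a..b} \<subseteq> {0..1}" and s: "\<bar>s\<bar> = \<beta> ^ n"
    "\<And>y. y \<in> {a..b} \<Longrightarrow> (f ^^ n) y = (f ^^ n) a + s * (y - a)"
    using assms(1) unfolding lap_def by blast
  have affine: "(f ^^ n) y = (f ^^ n) a' + s * (y - a')" if "y \<in> {a'..b'}" for y
    using s(2)[of y] s(2)[of a'] that assms by (simp add: algebra_simps)
  have "{a'..b'} \<subseteq> {0..1}" using assms(2,4) ab by auto
  then show ?thesis unfolding lap_def
    by (intro conjI exI[of _ s] ballI assms s(1) affine)
qed

text \<open>A lap whose image straddles 1/2 is cut at the preimage of 1/2. The new ends are allowed
  since 1/2 is in \<open>Q\<close>, and both pieces can be continued by one step.\<close>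

lemma lap_exists: assumes "x \<in> {0..1}" shows "\<exists>a b. lap n a b \<and> x \<in> {a..b}"
proof (induction n)
  case 0
  have "lap 0 0 1" unfolding lap_def using zero_in_Q one_in_Q by (auto intro!: exI[of _ 1])
  then show ?case using assms by blast
next
  case (Suc n)
  then obtain a b where ab: "lap n a b" "x \<in> {a..b}" by blast
  then obtain s where s: "a < b" "(f ^^ n) a \<in> Q" "(f ^^ n) b \<in> Q" "\<bar>s\<bar> = \<beta> ^ n"
    "\<And>y. y \<in> {a..b} \<Longrightarrow> (f ^^ n) y = (f ^^ n) a + s * (y - a)"
    unfolding lap_def by blast
  show ?case
  proof (cases "(f ^^ n) a \<le> 1/2 \<and> (f ^^ n) b \<le> 1/2 \<or> 1/2 \<le> (f ^^ n) a \<and> 1/2 \<le> (f ^^ n) b")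
    case True
    then show ?thesis using lap_step[OF ab(1)] ab(2) by blast
  next
    case False
    then have ends: "(f ^^ n) a < 1/2 \<and> 1/2 < (f ^^ n) b \<or> (f ^^ n) b < 1/2 \<and> 1/2 < (f ^^ n) a" by linarith
    have "\<exists>m>a. m < b \<and> (f ^^ n) m = 1/2"
    proof -
      have "\<exists>m. a \<le> m \<and> m \<le> b \<and> (f ^^ n) m = 1/2"
        using ends
      proof
        assume "(f ^^ n) a < 1/2 \<and> 1/2 < (f ^^ n) b"
        then show ?thesis using s(1) by (intro IVT' continuous_tent_pow) auto
      next
        assume "(f ^^ n) b < 1/2 \<and> 1/2 < (f ^^ n) a"
        then show ?thesis using s(1) by (intro IVT2' continuous_tent_pow) auto
      qed
      then show ?thesis using ends by (metis less_irrefl order_le_less)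
    qed
    then obtain m where m: "a < m" "m < b" "(f ^^ n) m = 1/2" by blast
    have "lap n a m" "lap n m b"
      using lap_subinterval[OF ab(1), of a m] lap_subinterval[OF ab(1), of m b] m s(2,3) half_in_Q by auto
    then have "lap (Suc n) a m" "lap (Suc n) m b" using m ends by (auto intro!: lap_step)
    moreover have "x \<in> {a..m} \<or> x \<in> {m..b}" using ab(2) by auto
    ultimately show ?thesis by blast
  qed
qed

lemma lap_length: assumes "lap n a b" shows "b - a \<le> 1 / \<beta> ^ n"
proof -
  obtain s where s: "a < b" "{a..b} \<subseteq> {0..1}" "\<bar>s\<bar> = \<beta> ^ n"
    "\<And>y. y \<in> {a..b} \<Longrightarrow> (f ^^ n) y = (f ^^ n) a + s * (y - a)"
    using assms unfolding lap_def by blast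
  have "a \<in> {0..1}" "b \<in> {0..1}" using s by auto
  then have "\<bar>(f ^^ n) b - (f ^^ n) a\<bar> \<le> 1" using tent_pow_in_unit[of a n] tent_pow_in_unit[of b n] by auto
  then have "\<beta> ^ n * (b - a) \<le> 1" using s(3) s(4)[of b] s(1) by (simp add: abs_mult)
  then show ?thesis using beta_pow_pos[of n] by (simp add: pos_le_divide_eq mult.commute)
qed

definition Qpairs :: "(real \<times> real) set" where
  "Qpairs = {(q, q'). q \<in> Q \<and> q' \<in> Q \<and> q < q'}"

lemma finite_Qpairs: "finite Qpairs"
  by (rule finite_subset[of _ "Q \<times> Q"]) (auto simp: Qpairs_def finite_Q)

text \<open>The part of the image interval missed by \<open>B\<close> is pulled back through the
  affine branch to a hole of measure at least \<open>v / \<beta> ^ n\<close>; the lap itself has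
  length at most \<open>1 / \<beta> ^ n\<close>.\<close>

lemma measure_lap_le:
  assumes B: "closed B" "f ` B \<subseteq> B" and v: "\<And>q q'. (q, q') \<in> Qpairs \<Longrightarrow> v \<le> measure lebesgue ({q..q'} - B)"
    and "lap n a b"
  shows "measure lebesgue ({a..b} \<inter> B) \<le> (1 - v) * (b - a)"
proof -
  obtain s where ab: "a < b" "(f ^^ n) a \<in> Q" "(f ^^ n) b \<in> Q" and s: "\<bar>s\<bar> = \<beta> ^ n"
    "\<And>y. y \<in> {a..b} \<Longrightarrow> (f ^^ n) y = (f ^^ n) a + s * (y - a)"
    using assms(4) unfolding lap_def by blast
  define q where "q = min ((f ^^ n) a) ((f ^^ n) b)"
  define q' where "q' = max ((f ^^ n) a) ((f ^^ n) b)"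
  have fb: "(f ^^ n) b = (f ^^ n) a + s * (b - a)" using s(2)[of b] ab(1) by simp
  have s0: "s \<noteq> 0" using s(1) beta_pow_pos[of n] by auto
  have "(f ^^ n) a \<noteq> (f ^^ n) b" using fb s0 ab(1) by simp
  then have qq: "(q, q') \<in> Qpairs" using ab by (auto simp: Qpairs_def q_def q'_def min_def max_def)
  have Bn: "(f ^^ n) y \<in> B" if "y \<in> B" for y
    using that B(2) by (induction n) auto
  \<comment> \<open>The hole under the inverse branch. It misses \<open>B\<close>, because iterates
    of points of \<open>B\<close> stay in \<open>B\<close>.\<close>
  let ?T = "(\<lambda>w. (1 / s) *\<^sub>R w + (a - (f ^^ n) a / s)) ` ({q..q'} - B)"
  have meas: "{q..q'} - B \<in> lmeasurable" using B(1) by (intro fmeasurable_Diff) auto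
  have T: "?T \<subseteq> {a..b} - B"
  proof (rule image_subsetI)
    fix w assume w: "w \<in> {q..q'} - B"
    define y where "y = (1 / s) *\<^sub>R w + (a - (f ^^ n) a / s)"
    have y: "s * (y - a) = w - (f ^^ n) a" using s0 by (simp add: y_def field_simps)
    have "a \<le> y \<and> y \<le> b"
    proof (cases "0 < s")
      case True
      then have "q = (f ^^ n) a" "q' = (f ^^ n) b" using fb ab(1) by (auto simp: q_def q'_def)
      then have "0 \<le> s * (y - a)" "s * (y - a) \<le> s * (b - a)" using w y fb by auto
      then show ?thesis using True by (auto simp: zero_le_mult_iff)
    next
      case False
      then have "s < 0" using s0 by simp
      then have "s * (b - a) < 0" using ab(1) by (simp add: mult_neg_pos)
      then have "q = (f ^^ n) b" "q' = (f ^^ n) a" using fb by (auto simp: q_def q'_def)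
      then have "s * (y - a) \<le> 0" "s * (b - a) \<le> s * (y - a)" using w y fb by auto
      then show ?thesis using \<open>s < 0\<close> by (auto simp: mult_le_0_iff)
    qed
    moreover from this have "(f ^^ n) y = w" using s(2)[of y] y by simp
    ultimately show "y \<in> {a..b} - B" using Bn w by auto
  qed
  have "measure lebesgue ?T = measure lebesgue ({q..q'} - B) / \<beta> ^ n"
    using s(1) by (subst measure_lebesgue_affine) simp
  moreover have "measure lebesgue ?T \<le> measure lebesgue ({a..b} - B)"
  proof (rule measure_mono_fmeasurable[OF T])
    have "?T = (\<lambda>y. s * (y - a) + (f ^^ n) a) -` ({q..q'} - B)"
    proof (intro subset_antisym subsetI)
      fix y assume y: "y \<in> (\<lambda>y. s * (y - a) + (f ^^ n) a) -` ({q..q'} - B)"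
      have "y = (1 / s) *\<^sub>R (s * (y - a) + (f ^^ n) a) + (a - (f ^^ n) a / s)"
        using s0 by (simp add: field_simps)
      then show "y \<in> ?T" using y by blast
    next
      fix y assume "y \<in> ?T"
      then obtain w where w: "w \<in> {q..q'} - B" "y = (1 / s) *\<^sub>R w + (a - (f ^^ n) a / s)" by blast
      then have "s * (y - a) + (f ^^ n) a = w" using s0 by (simp add: right_diff_distrib distrib_left)
      then show "y \<in> (\<lambda>y. s * (y - a) + (f ^^ n) a) -` ({q..q'} - B)" using w by simp
    qed
    moreover have "(\<lambda>y. s * (y - a) + (f ^^ n) a) -` ({q..q'} - B) \<in> sets borel"
      using B(1) by (intro measurable_sets_borel[of _ borel]) auto
    ultimately show "?T \<in> sets lebesgue" by simp
    show "{a..b} - B \<in> lmeasurable" using B(1) by (intro fmeasurable_Diff) auto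
  qed
  ultimately have 1: "v / \<beta> ^ n \<le> measure lebesgue ({a..b} - B)"
    using divide_right_mono[OF v[OF qq], of "\<beta> ^ n"] beta_pow_pos[of n] by linarith
  have Bs: "B \<in> sets lebesgue" using borel_closed[OF B(1)] by (simp add: sets_completionI_sets)
  have I: "{a..b} \<in> lmeasurable" using lmeasurable_cbox[of a b] by simp
  have "measure lebesgue ({a..b} - ({a..b} - B)) = measure lebesgue {a..b} - measure lebesgue ({a..b} - B)"
    using I Bs by (intro measurable_measure_Diff) auto
  moreover have "{a..b} - ({a..b} - B) = {a..b} \<inter> B" by auto
  ultimately have "measure lebesgue {a..b} = measure lebesgue ({a..b} - B) + measure lebesgue ({a..b} \<inter> B)"
    by simp
  then have 2: "measure lebesgue ({a..b} \<inter> B) \<le> (b - a) - v / \<beta> ^ n" using 1 ab(1) by simp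
  show ?thesis
  proof (cases "0 \<le> v")
    case True
    then have "v * (b - a) \<le> v * (1 / \<beta> ^ n)"
      by (intro mult_left_mono lap_length[OF assms(4)])
    then show ?thesis using 2 by (simp add: algebra_simps)
  next
    case False
    have "measure lebesgue ({a..b} \<inter> B) \<le> measure lebesgue {a..b}"
      using I Bs by (intro measure_mono_fmeasurable) auto
    also have "\<dots> = 1 * (b - a)" using ab(1) by simp
    also have "\<dots> \<le> (1 - v) * (b - a)" using False ab(1) by (intro mult_right_mono) auto
    finally show ?thesis .
  qed
qed


end

lemma negligible_if_countable: "countable (S :: real set) \<Longrightarrow> negligible S"
  unfolding negligible_iff_null_sets null_sets_completion_iff2 using countable_imp_null_set_lborel by blast

lemma negligible_Lipschitz_image:
  fixes h :: "real \<Rightarrow> real"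
  assumes "negligible S" "\<And>x y. x \<in> S \<Longrightarrow> y \<in> S \<Longrightarrow> \<bar>h y - h x\<bar> \<le> B * \<bar>y - x\<bar>"
  shows "negligible (h ` S)"
  using assms by (intro negligible_locally_Lipschitz_image exI[of _ UNIV] exI[of _ B]) auto

context pcf_tent
begin

lemma lap_less: "lap n a b \<Longrightarrow> a < b"
  by (simp add: lap_def)

text \<open>A closed invariant set of positive measure contains the image of a lap: otherwise it would miss
  a fixed proportion of every lap, and a Vitali covering by laps contradicts outer regularity.\<close>

lemma invariant_closed_contains_interval:
  assumes B: "closed B" "f ` B \<subseteq> B" "B \<subseteq> {0..1}" "\<not> negligible B"
  shows "\<exists>q q'. (q, q') \<in> Qpairs \<and> {q..q'} \<subseteq> B"
proof (rule ccontr)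
  assume no: "\<not> ?thesis"
  have lm: "B \<in> lmeasurable"
    using B(1,3) bounded_subset[OF bounded_closed_interval, of B 0 1] by (intro lmeasurable_compact) (simp add: compact_eq_bounded_closed)
  then have Bs: "B \<in> sets lebesgue" by blast
  define \<mu> where "\<mu> = measure lebesgue B"
  have "0 < \<mu>" unfolding \<mu>_def using B(4) negligible_iff_measure[of B] lm by (simp add: zero_less_measure_iff)
  \<comment> \<open>\<open>B\<close> is closed and does not contain the interval, so it misses a
    nonempty open part of it.\<close>
  have hole: "0 < measure lebesgue ({q..q'} - B)" if qq: "(q, q') \<in> Qpairs" for q q'
  proof -
    have "q < q'" using qq by (simp add: Qpairs_def)
    have "\<not> {q<..<q'} \<subseteq> B"
    proof
      assume "{q<..<q'} \<subseteq> B"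
      then have "closure {q<..<q'} \<subseteq> B" using B(1) by (rule closure_minimal)
      then show False using no qq \<open>q < q'\<close> by auto
    qed
    then have "{q<..<q'} - B \<noteq> {}" by blast
    moreover have "open ({q<..<q'} - B)" using B(1) by auto
    ultimately have "\<not> negligible ({q<..<q'} - B)" using open_not_negligible by blast
    then have "\<not> negligible ({q..q'} - B)"
      by (rule contrapos_nn) (rule negligible_subset, auto)
    moreover have "{q..q'} - B \<in> lmeasurable"
      using lmeasurable_cbox[of q q'] Bs by (intro fmeasurable_Diff) auto
    ultimately show ?thesis using negligible_iff_measure[of "{q..q'} - B"] by (simp add: zero_less_measure_iff)
  qed
  \<comment> \<open>Positive because only finitely many image intervals occur. The inserted 1 also
    ensures that \<open>1 - v\<close> is nonnegative.\<close>
  define v where "v = Min (insert 1 ((\<lambda>(q, q'). measure lebesgue ({q..q'} - B)) ` Qpairs))"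
  have v: "0 < v" "v \<le> 1" "\<And>q q'. (q, q') \<in> Qpairs \<Longrightarrow> v \<le> measure lebesgue ({q..q'} - B)"
  proof -
    show "0 < v" unfolding v_def using finite_Qpairs hole by (subst Min_gr_iff) auto
    show "v \<le> 1" unfolding v_def using finite_Qpairs by (intro Min_le) auto
    show "v \<le> measure lebesgue ({q..q'} - B)" if "(q, q') \<in> Qpairs" for q q'
      unfolding v_def using finite_Qpairs that by (intro Min_le) (auto intro!: image_eqI[of _ _ "(q, q')"])
  qed
  \<comment> \<open>The tolerance is tuned to the end: the laps give
    \<open>\<mu> \<le> (1 - v) * measure lebesgue U\<close>, and a measure of \<open>U\<close> below
    \<open>(1 + v) * \<mu>\<close> makes the right side at most
    \<open>(1 - v\<^sup>2) * \<mu>\<close>.\<close>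
  obtain U where U: "open U" "B \<subseteq> U" "U - B \<in> lmeasurable" "emeasure lebesgue (U - B) < ennreal (v * \<mu>)"
    using sets_lebesgue_outer_open[OF Bs, of "v * \<mu>"] \<open>0 < \<mu>\<close> v(1) by auto
  have Ulm: "U \<in> lmeasurable"
  proof -
    have "B \<union> (U - B) \<in> lmeasurable" using lm U(3) by blast
    moreover have "B \<union> (U - B) = U" using U(2) by auto
    ultimately show ?thesis by simp
  qed
  have "measure lebesgue (U - B) < v * \<mu>"
    using U(3,4) \<open>0 < \<mu>\<close> v(1) by (simp add: emeasure_eq_measure2 ennreal_less_iff)
  moreover have "measure lebesgue (U - B) = measure lebesgue U - \<mu>"
    unfolding \<mu>_def using Ulm Bs U(2) by (rule measurable_measure_Diff)
  ultimately have Um: "measure lebesgue U < \<mu> + v * \<mu>" by simp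
  let ?K = "{(a, b). (\<exists>n. lap n a b) \<and> {a..b} \<subseteq> U}"
  let ?c = "\<lambda>(a::real, b). (a + b) / 2" and ?r = "\<lambda>(a::real, b). (b - a) / 2"
  have cb: "cball (?c i) (?r i) = {fst i..snd i}" if "i \<in> ?K" for i
  proof -
    have "(fst i + snd i) / 2 - (snd i - fst i) / 2 = fst i" "(fst i + snd i) / 2 + (snd i - fst i) / 2 = snd i"
      by (auto simp: field_simps)
    then show ?thesis by (simp add: case_prod_beta cball_eq_atLeastAtMost)
  qed
  \<comment> \<open>Laps of high order are short, so the one around \<open>x\<close> fits into
    \<open>U\<close> and below any given size.\<close>
  have vit: "\<exists>i. i \<in> ?K \<and> x \<in> cball (?c i) (?r i) \<and> ?r i < d" if "x \<in> B" "0 < d" for x d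
  proof -
    have "x \<in> U" "x \<in> {0..1}" using U(2) B(3) that(1) by auto
    obtain e where e: "0 < e" "ball x e \<subseteq> U" using openE[OF U(1) \<open>x \<in> U\<close>] .
    have "0 < min d e" using e(1) that(2) by simp
    obtain n where "1 / min d e < \<beta> ^ n" using real_arch_pow[OF beta_gt_1] by blast
    then have "1 < min d e * \<beta> ^ n"
      by (simp only: pos_divide_less_eq[OF \<open>0 < min d e\<close>] mult.commute)
    then have n: "1 / \<beta> ^ n < min d e" by (simp only: pos_divide_less_eq[OF beta_pow_pos])
    obtain a b where ab: "lap n a b" "x \<in> {a..b}" using lap_exists[OF \<open>x \<in> {0..1}\<close>] by blast
    have len: "b - a < min d e" using lap_length[OF ab(1)] n by linarith
    have "{a..b} \<subseteq> ball x e" using len ab(2) by (auto simp: dist_real_def)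
    then have "{a..b} \<subseteq> U" using e(2) by (rule subset_trans)
    then have K: "(a, b) \<in> ?K" using ab(1) by blast
    have "x \<in> cball (?c (a, b)) (?r (a, b))" unfolding cb[OF K] using ab(2) by simp
    moreover have "?r (a, b) < d" using len ab(2) by auto
    ultimately show ?thesis using K by (intro exI[of _ "(a, b)"] conjI)
  qed
  have pos: "0 < ?r i" if "i \<in> ?K" for i using that lap_less by force
  obtain F where F: "countable F" "F \<subseteq> ?K"
    "pairwise (\<lambda>i j. disjnt (cball (?c i) (?r i)) (cball (?c j) (?r j))) F"
    "negligible (B - (\<Union>i\<in>F. cball (?c i) (?r i)))"
    by (rule Vitali_covering_theorem_cballs[of ?K ?r B ?c, OF pos vit])
  let ?J = "\<lambda>i. {fst i..snd i}"
  have J: "cball (?c i) (?r i) = ?J i" if "i \<in> F" for i using F(2) that by (intro cb) (rule subsetD)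
  have UJ: "(\<Union>i\<in>F. cball (?c i) (?r i)) = (\<Union>i\<in>F. ?J i)" using J by auto
  have neg: "negligible (B - (\<Union>i\<in>F. ?J i))" using F(4) by (simp only: UJ)
  have disj: "disjoint_family_on ?J F"
    unfolding disjoint_family_on_def
  proof (intro ballI impI)
    fix i j assume ij: "i \<in> F" "j \<in> F" "i \<noteq> j"
    have "disjnt (cball (?c i) (?r i)) (cball (?c j) (?r j))" by (rule pairwiseD[OF F(3) ij(1) ij(2) ij(3)])
    then show "?J i \<inter> ?J j = {}" by (simp only: J[OF ij(1)] J[OF ij(2)] disjnt_def)
  qed
  have Js: "?J i \<in> sets lebesgue" for i :: "real \<times> real" by simp
  have "emeasure lebesgue B = emeasure lebesgue (\<Union>i\<in>F. ?J i \<inter> B)"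
  proof (rule emeasure_eq_AE)
    show "AE x in lebesgue. x \<in> B \<longleftrightarrow> x \<in> (\<Union>i\<in>F. ?J i \<inter> B)"
      using neg unfolding negligible_iff_null_sets by (rule AE_not_in[THEN AE_mp]) (auto intro!: AE_I2)
    show "B \<in> sets lebesgue" by fact
    show "(\<Union>i\<in>F. ?J i \<inter> B) \<in> sets lebesgue" using F(1) Bs Js by (intro sets.countable_UN') auto
  qed
  also have "\<dots> = (\<integral>\<^sup>+i. emeasure lebesgue (?J i \<inter> B) \<partial>count_space F)"
  proof (rule emeasure_UN_countable)
    show "disjoint_family_on (\<lambda>i. ?J i \<inter> B) F"
      using disj unfolding disjoint_family_on_def by blast
  qed (use F(1) Bs Js in auto)
  also have "\<dots> \<le> (\<integral>\<^sup>+i. ennreal (1 - v) * emeasure lebesgue (?J i) \<partial>count_space F)"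
  proof (rule nn_integral_mono)
    fix i assume "i \<in> space (count_space F)"
    then obtain n where lap: "lap n (fst i) (snd i)" using F(2) by auto
    have "?J i \<inter> B \<in> lmeasurable" using lm by (intro fmeasurable_Int_fmeasurable) auto
    then have "emeasure lebesgue (?J i \<inter> B) = ennreal (measure lebesgue (?J i \<inter> B))"
      by (rule emeasure_eq_measure2)
    also have "\<dots> \<le> ennreal ((1 - v) * (snd i - fst i))"
      using measure_lap_le[OF B(1,2) v(3) lap] by (rule ennreal_leI)
    also have "\<dots> = ennreal (1 - v) * emeasure lebesgue (?J i)"
      using v(2) lap_less[OF lap] by (simp add: ennreal_mult)
    finally show "emeasure lebesgue (?J i \<inter> B) \<le> ennreal (1 - v) * emeasure lebesgue (?J i)" .
  qed
  also have "\<dots> = ennreal (1 - v) * (\<integral>\<^sup>+i. emeasure lebesgue (?J i) \<partial>count_space F)"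
    by (rule nn_integral_cmult) simp
  also have "(\<integral>\<^sup>+i. emeasure lebesgue (?J i) \<partial>count_space F) = emeasure lebesgue (\<Union>i\<in>F. ?J i)"
    using F(1) Js disj by (intro emeasure_UN_countable[symmetric])
  also have "\<dots> \<le> emeasure lebesgue U"
  proof (rule emeasure_mono[OF UN_least])
    show "?J i \<subseteq> U" if "i \<in> F" for i
    proof -
      have "i \<in> ?K" using that F(2) by blast
      then show ?thesis by (simp add: case_prod_beta)
    qed
  qed (use Ulm in blast)
  finally have "emeasure lebesgue B \<le> ennreal (1 - v) * emeasure lebesgue U"
    by (simp add: mult_left_mono)
  then have "\<mu> \<le> (1 - v) * measure lebesgue U"
    using lm Ulm v(2) by (simp add: emeasure_eq_measure2 \<mu>_def ennreal_mult[symmetric] ennreal_le_iff)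
  also have "\<dots> \<le> (1 - v) * (\<mu> + v * \<mu>)" using Um v(2) by (intro mult_left_mono) auto
  also have "\<dots> = \<mu> - v * v * \<mu>" by (simp add: algebra_simps)
  finally show False using \<open>0 < \<mu>\<close> v(1) by (simp add: mult_le_0_iff)
qed

text \<open>By continuity the closure is invariant as well, so the closed case applies to it.
  Density in an interval is enough to rule out sets that avoid an open set.\<close>

lemma invariant_closure_contains_interval:
  assumes "f ` B \<subseteq> B" "B \<subseteq> {0..1}" "\<not> negligible B"
  shows "\<exists>q q'. (q, q') \<in> Qpairs \<and> {q..q'} \<subseteq> closure B"
proof (rule invariant_closed_contains_interval)
  show "f ` closure B \<subseteq> closure B"
    by (rule image_closure_subset[OF continuous_tent closed_closure])
      (rule subset_trans[OF assms(1) closure_subset])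
  show "closure B \<subseteq> {0..1}" using assms(2) by (intro closure_minimal) auto
  show "\<not> negligible (closure B)" using assms(3) negligible_subset[OF _ closure_subset[of B]] by blast
qed simp

section \<open>A minimal invariant union of intervals\<close>

definition orbit_hull :: "real \<Rightarrow> real \<Rightarrow> real set" where
  "orbit_hull q q' = (\<Union>n. (f ^^ n) ` {q..q'})"

text \<open>\<open>Q\<close> is forward invariant, and the image of an interval around 1/2 has
  \<open>f (1/2)\<close> as its upper end, which is also in \<open>Q\<close>.\<close>

lemma tent_image_Qpair:
  assumes "(q, q') \<in> Qpairs" shows "\<exists>a b. (a, b) \<in> Qpairs \<and> f ` {q..q'} = {a..b}"
proof -
  have q: "q \<in> Q" "q' \<in> Q" "q < q'" using assms by (auto simp: Qpairs_def)
  have left: "f ` {a..b} = {f a..f b}" if "a \<le> b" "b \<le> 1/2" for a b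
  proof -
    have "f ` {a..b} = (\<lambda>x. \<beta> * x) ` {a..b}" using that by (intro image_cong) (auto simp: tent_left)
    then show ?thesis using that beta_gt_1 by (simp add: image_mult_atLeastAtMost tent_left)
  qed
  have right: "f ` {a..b} = {f b..f a}" if "a \<le> b" "1/2 \<le> a" for a b
  proof -
    have "f ` {a..b} = f ` ((\<lambda>x. 1 - x) ` {a..b})" by (simp only: image_image tent_reflect)
    also have "\<dots> = f ` {1 - b..1 - a}" using that by simp
    also have "\<dots> = {f (1 - b)..f (1 - a)}" using that by (intro left) auto
    finally show ?thesis by (simp add: tent_reflect)
  qed
  consider "q' \<le> 1/2" | "1/2 \<le> q" | "q < 1/2" "1/2 < q'" by linarith
  then show ?thesis
  proof cases
    case 1
    then have "f q < f q'" using q(3) beta_gt_1 by (simp add: tent_left)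
    then show ?thesis using left[of q q'] 1 q tent_Q[OF q(1)] tent_Q[OF q(2)] by (auto simp: Qpairs_def)
  next
    case 2
    then have "f q' < f q" using q(3) beta_gt_1 by (simp add: tent_right)
    then show ?thesis using right[of q q'] 2 q tent_Q[OF q(1)] tent_Q[OF q(2)] by (auto simp: Qpairs_def)
  next
    case 3
    have "{q..q'} = {q..1/2} \<union> {1/2..q'}" using 3 by auto
    then have "f ` {q..q'} = {f q..f (1/2)} \<union> {f q'..f (1/2)}"
      using left[of q "1/2"] right[of "1/2" q'] 3 by (simp only: image_Un)
    also have "\<dots> = {min (f q) (f q')..f (1/2)}" by auto
    finally have "f ` {q..q'} = {min (f q) (f q')..f (1/2)}" .
    moreover have "f q < f (1/2)" using 3 beta_gt_1 by (simp add: tent_left)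
    moreover have "min (f q) (f q') \<in> Q" using tent_Q[OF q(1)] tent_Q[OF q(2)] by (simp add: min_def)
    ultimately show ?thesis using tent_Q[OF half_in_Q]
      by (intro exI[of _ "min (f q) (f q')"] exI[of _ "f (1/2)"]) (simp add: Qpairs_def)
  qed
qed

lemma tent_pow_image_Qpair:
  assumes "(q, q') \<in> Qpairs" shows "\<exists>a b. (a, b) \<in> Qpairs \<and> (f ^^ n) ` {q..q'} = {a..b}"
proof (induction n)
  case 0
  then show ?case using assms by (auto simp: image_def)
next
  case (Suc n)
  then obtain a b where "(a, b) \<in> Qpairs" "(f ^^ n) ` {q..q'} = {a..b}" by blast
  moreover have "(f ^^ Suc n) ` {q..q'} = f ` ((f ^^ n) ` {q..q'})" by (simp add: image_comp)
  ultimately show ?case using tent_image_Qpair[of a b] by simp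
qed

text \<open>Only finitely many different images occur in the infinite union; this makes hulls closed
  and gives a finite family from which to choose a minimal one.\<close>

lemma orbit_hull_finite_union:
  assumes "(q, q') \<in> Qpairs"
  obtains T where "T \<subseteq> Qpairs" "orbit_hull q q' = (\<Union>(a, b)\<in>T. {a..b})"
proof (rule that)
  let ?T = "{(a, b) \<in> Qpairs. \<exists>n. (f ^^ n) ` {q..q'} = {a..b}}"
  show "?T \<subseteq> Qpairs" by auto
  show "orbit_hull q q' = (\<Union>(a, b)\<in>?T. {a..b})"
    unfolding orbit_hull_def using tent_pow_image_Qpair[OF assms] by fastforce
qed

lemma closed_orbit_hull: "(q, q') \<in> Qpairs \<Longrightarrow> closed (orbit_hull q q')"
  by (rule orbit_hull_finite_union) (auto intro!: closed_UN dest: finite_subset[OF _ finite_Qpairs])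

lemma interval_subset_orbit_hull: "{q..q'} \<subseteq> orbit_hull q q'"
  unfolding orbit_hull_def by (rule UN_upper[of 0, THEN subset_trans[rotated]]) auto

lemma orbit_hull_minimal: assumes "{q..q'} \<subseteq> W" "f ` W \<subseteq> W" shows "orbit_hull q q' \<subseteq> W"
proof -
  have "(f ^^ n) ` {q..q'} \<subseteq> W" for n
    by (induction n) (use assms in \<open>auto simp: image_subset_iff\<close>)
  then show ?thesis by (auto simp: orbit_hull_def)
qed

lemma tent_orbit_hull: "f ` orbit_hull q q' \<subseteq> orbit_hull q q'"
proof -
  have "f ` ((f ^^ n) ` {q..q'}) = (f ^^ Suc n) ` {q..q'}" for n by (simp add: image_comp)
  then show ?thesis unfolding orbit_hull_def image_UN by blast
qed

text \<open>Minimal under inclusion among all hulls. It plays the role of a transitive component: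
  the hull of any interval inside it with ends in \<open>Q\<close> is all of
  \<open>W\<close>.\<close>

definition W :: "real set" where
  "W = (SOME W. W \<in> (\<lambda>(q, q'). orbit_hull q q') ` Qpairs \<and>
     (\<forall>V\<in>(\<lambda>(q, q'). orbit_hull q q') ` Qpairs. V \<subseteq> W \<longrightarrow> W = V))"

lemma W_props: "W \<in> (\<lambda>(q, q'). orbit_hull q q') ` Qpairs"
  and W_minimal: "(q, q') \<in> Qpairs \<Longrightarrow> orbit_hull q q' \<subseteq> W \<Longrightarrow> orbit_hull q q' = W"
proof -
  have "(0, 1) \<in> Qpairs" using zero_in_Q one_in_Q by (simp add: Qpairs_def)
  then have "\<exists>W\<in>(\<lambda>(q, q'). orbit_hull q q') ` Qpairs. \<forall>V\<in>(\<lambda>(q, q'). orbit_hull q q') ` Qpairs. V \<subseteq> W \<longrightarrow> W = V"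
    using finite_has_minimal[of "(\<lambda>(q, q'). orbit_hull q q') ` Qpairs"] finite_Qpairs by blast
  then have *: "W \<in> (\<lambda>(q, q'). orbit_hull q q') ` Qpairs \<and>
     (\<forall>V\<in>(\<lambda>(q, q'). orbit_hull q q') ` Qpairs. V \<subseteq> W \<longrightarrow> W = V)"
    unfolding W_def Bex_def by (rule someI_ex)
  show "W \<in> (\<lambda>(q, q'). orbit_hull q q') ` Qpairs" using * by blast
  show "orbit_hull q q' = W" if "(q, q') \<in> Qpairs" "orbit_hull q q' \<subseteq> W"
    using * that by force
qed

lemma W_orbit_hull: obtains q q' where "(q, q') \<in> Qpairs" "W = orbit_hull q q'"
  using W_props by auto

lemma closed_W: "closed W"
  by (rule W_orbit_hull) (simp add: closed_orbit_hull)

lemma tent_W: "f ` W \<subseteq> W"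
  by (rule W_orbit_hull) (simp add: tent_orbit_hull)

lemma tent_pow_W: "x \<in> W \<Longrightarrow> (f ^^ n) x \<in> W"
  by (induction n) (use tent_W in auto)

lemma W_finite_union: obtains T where "T \<subseteq> Qpairs" "W = (\<Union>(a, b)\<in>T. {a..b})"
proof -
  obtain q q' where q: "(q, q') \<in> Qpairs" "W = orbit_hull q q'" by (rule W_orbit_hull)
  show thesis by (rule orbit_hull_finite_union[OF q(1)]) (rule that, use q(2) in simp_all)
qed

lemma W_unit: "W \<subseteq> {0..1}"
proof -
  obtain q q' where q: "(q, q') \<in> Qpairs" "W = orbit_hull q q'" by (rule W_orbit_hull)
  have "q \<in> {0..1}" "q' \<in> {0..1}" using q(1) Q_unit by (auto simp: Qpairs_def)
  then have "{q..q'} \<subseteq> {0..1}" by auto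
  then show ?thesis unfolding q(2) using tent_in_unit by (intro orbit_hull_minimal image_subsetI)
qed

lemma W_not_negligible: "\<not> negligible W"
proof -
  obtain q q' where q: "(q, q') \<in> Qpairs" "W = orbit_hull q q'" by (rule W_orbit_hull)
  then have "{q<..<q'} \<noteq> {}" by (simp add: Qpairs_def)
  then have "\<not> negligible {q<..<q'}" by (intro open_not_negligible) auto
  moreover have "{q<..<q'} \<subseteq> {q..q'}" by auto
  then have "{q<..<q'} \<subseteq> W" using q(2) interval_subset_orbit_hull[of q q'] by blast
  ultimately show ?thesis using negligible_subset[of W "{q<..<q'}"] by blast
qed

text \<open>The avoiding set is invariant. If it had positive measure, it would be dense in an
  interval whose hull is \<open>W\<close>, so an iterate of a point of this interval would lie in
  \<open>V\<close>; by openness the same holds for a point of the avoiding set.\<close>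

lemma negligible_avoiding:
  assumes "open V" "V \<inter> W \<noteq> {}"
  shows "negligible {x\<in>W. \<forall>n. (f ^^ n) x \<notin> V}" (is "negligible ?X")
proof (rule ccontr)
  assume neg: "\<not> negligible ?X"
  have inv: "f ` ?X \<subseteq> ?X"
  proof (rule image_subsetI)
    fix x assume x: "x \<in> ?X"
    have "(f ^^ n) (f x) \<notin> V" for n
    proof -
      have "(f ^^ Suc n) x \<notin> V" using x by blast
      then show ?thesis by (simp add: funpow_Suc_right del: funpow.simps)
    qed
    then show "f x \<in> ?X" using x tent_W by blast
  qed
  have "?X \<subseteq> {0..1}" using W_unit by blast
  then obtain q q' where q: "(q, q') \<in> Qpairs" "{q..q'} \<subseteq> closure ?X"
    using invariant_closure_contains_interval[OF inv _ neg] by blast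
  have "closure ?X \<subseteq> W" using closed_W by (intro closure_minimal) auto
  then have "orbit_hull q q' = W" using q orbit_hull_minimal[of q q' W] tent_W W_minimal by blast
  moreover obtain w where w: "w \<in> V" "w \<in> W" using assms(2) by blast
  ultimately have "w \<in> orbit_hull q q'" by simp
  then obtain n y where "y \<in> {q..q'}" "w = (f ^^ n) y" by (auto simp: orbit_hull_def)
  with w have y: "y \<in> {q..q'}" "(f ^^ n) y \<in> V" by auto
  have "open ((f ^^ n) -` V)" using assms(1) continuous_tent_pow by (rule open_vimage)
  moreover have "y \<in> closure ?X \<inter> (f ^^ n) -` V" using y q by auto
  ultimately have "?X \<inter> (f ^^ n) -` V \<noteq> {}" using open_Int_closure_eq_empty[of "(f ^^ n) -` V" ?X] by blast
  then show False by blast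
qed

lemma Q_separation: "\<exists>\<delta>>0. \<forall>(q, q')\<in>Qpairs. \<delta> \<le> q' - q"
proof -
  let ?D = "insert 1 ((\<lambda>(q, q'). q' - q) ` Qpairs)"
  have "0 < Min ?D" using finite_Qpairs by (subst Min_gr_iff) (auto simp: Qpairs_def)
  moreover have "\<forall>(q, q')\<in>Qpairs. Min ?D \<le> q' - q"
    using finite_Qpairs by (auto intro!: Min_le)
  ultimately show ?thesis by blast
qed

text \<open>Orbits that could approach \<open>W\<close> without ever entering it.\<close>

definition trapped :: "real \<Rightarrow> real set" where
  "trapped e = {x\<in>{0..1}. \<forall>n. (f ^^ n) x \<notin> W \<and> infdist ((f ^^ n) x) W < e}"

text \<open>Otherwise trapped points are dense in an interval of length at least
  \<open>\<delta>\<close> with ends in \<open>Q\<close>. If \<open>W\<close> meets its interior,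
  then \<open>W\<close>, a union of nondegenerate intervals, contains an open part of it and so a
  trapped point. If not, the midpoint is at least \<open>\<delta> / 2\<close> from \<open>W\<close>,
  and a trapped point within \<open>\<delta> / 4\<close> of it is too far away.\<close>

lemma negligible_trapped: "\<exists>e>0. negligible (trapped e)"
proof -
  obtain \<delta> where \<delta>: "0 < \<delta>" "\<And>q q'. (q, q') \<in> Qpairs \<Longrightarrow> \<delta> \<le> q' - q" using Q_separation by blast
  let ?X = "trapped (\<delta> / 4)"
  have "negligible ?X"
  proof (rule ccontr)
    assume neg: "\<not> negligible ?X"
    have inv: "f ` ?X \<subseteq> ?X"
    proof (rule image_subsetI)
      fix x assume x: "x \<in> ?X"
      have "(f ^^ n) (f x) \<notin> W \<and> infdist ((f ^^ n) (f x)) W < \<delta> / 4" for n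
      proof -
        have "(f ^^ Suc n) x \<notin> W \<and> infdist ((f ^^ Suc n) x) W < \<delta> / 4" using x unfolding trapped_def by blast
        then show ?thesis by (simp add: funpow_Suc_right del: funpow.simps)
      qed
      then show "f x \<in> ?X" using x tent_in_unit unfolding trapped_def by blast
    qed
    have "?X \<subseteq> {0..1}" by (auto simp: trapped_def)
    then obtain q q' where q: "(q, q') \<in> Qpairs" "{q..q'} \<subseteq> closure ?X"
      using invariant_closure_contains_interval[OF inv _ neg] by blast
    have X: "x \<notin> W" "infdist x W < \<delta> / 4" if "x \<in> ?X" for x
      using that unfolding trapped_def by (auto dest: spec[of _ 0])
    have meet: "\<exists>x\<in>?X. x \<in> U" if "open U" "U \<inter> {q..q'} \<noteq> {}" for U
    proof -
      have "U \<inter> closure ?X \<noteq> {}" using that q(2) by blast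
      then show ?thesis using open_Int_closure_eq_empty[OF that(1), of ?X] by blast
    qed
    show False
    proof (cases "\<exists>w\<in>W. q < w \<and> w < q'")
      case True
      then obtain w where w: "w \<in> W" "q < w" "w < q'" by blast
      obtain T where T: "T \<subseteq> Qpairs" "W = (\<Union>(a, b)\<in>T. {a..b})" by (rule W_finite_union)
      then obtain a b where ab: "(a, b) \<in> T" "w \<in> {a..b}" using w by blast
      then have "a < b" using T(1) by (auto simp: Qpairs_def)
      define p where "p = (max a q + min b q') / 2"
      have "max a q < min b q'" using ab(2) w \<open>a < b\<close> by auto
      then have "p \<in> {max a q<..<min b q'} \<inter> {q..q'}" by (auto simp: p_def)
      then have "{max a q<..<min b q'} \<inter> {q..q'} \<noteq> {}" by blast
      then obtain x where "x \<in> ?X" "x \<in> {max a q<..<min b q'}"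
        using meet[OF open_greaterThanLessThan] by blast
      moreover from this have "x \<in> W" using ab(1) T(2) by force
      ultimately show False using X(1) by blast
    next
      case False
      define m where "m = (q + q') / 2"
      have "\<delta> \<le> q' - q" using \<delta>(2) q(1) by blast
      then have m: "q + \<delta> / 2 \<le> m" "m + \<delta> / 2 \<le> q'" by (auto simp: m_def field_simps)
      then have "ball m (\<delta> / 4) \<inter> {q..q'} \<noteq> {}" using \<delta>(1) by (intro ex_in_conv[THEN iffD1] exI[of _ m]) auto
      then obtain x where x: "x \<in> ?X" "dist m x < \<delta> / 4" using meet[of "ball m (\<delta> / 4)"] by auto
      have "W \<noteq> {}" using W_not_negligible by auto
      then obtain w where "w \<in> W" "dist x w < \<delta> / 4"
        using X(2)[OF x(1)] infdist_attains_inf[OF closed_W, of x] by metis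
      then have "q < w \<and> w < q'" using m x(2) unfolding dist_real_def by linarith
      then show False using False \<open>w \<in> W\<close> by blast
    qed
  qed
  then show ?thesis using \<delta>(1) by (intro exI[of _ "\<delta> / 4"]) simp
qed

lemma negligible_tent_preimage: assumes "negligible N" shows "negligible {x. f x \<in> N}"
proof (rule negligible_subset)
  have "\<bar>y / \<beta> - x / \<beta>\<bar> \<le> (1 / \<beta>) * \<bar>y - x\<bar>" "\<bar>(1 - y / \<beta>) - (1 - x / \<beta>)\<bar> \<le> (1 / \<beta>) * \<bar>y - x\<bar>" for x y
    using beta_gt_1 by (simp_all add: abs_minus_commute flip: diff_divide_distrib)
  then show "negligible ((\<lambda>y. y / \<beta>) ` N \<union> (\<lambda>y. 1 - y / \<beta>) ` N)"
    using assms by (intro negligible_Un negligible_Lipschitz_image[of N _ "1 / \<beta>"]) blast+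
  show "{x. f x \<in> N} \<subseteq> (\<lambda>y. y / \<beta>) ` N \<union> (\<lambda>y. 1 - y / \<beta>) ` N"
  proof
    fix x assume x: "x \<in> {x. f x \<in> N}"
    show "x \<in> (\<lambda>y. y / \<beta>) ` N \<union> (\<lambda>y. 1 - y / \<beta>) ` N"
    proof (cases "x \<le> 1/2")
      case True
      then have "x = f x / \<beta>" using beta_gt_1 by (simp add: tent_left)
      then show ?thesis using x by blast
    next
      case False
      then have "x = 1 - f x / \<beta>" using beta_gt_1 by (simp add: tent_right)
      then show ?thesis using x by blast
    qed
  qed
qed

lemma negligible_tent_pow_preimage: assumes "negligible N" shows "negligible {x. (f ^^ n) x \<in> N}"
proof (induction n)
  case (Suc n)
  have "{x. (f ^^ Suc n) x \<in> N} = {x. f x \<in> {x. (f ^^ n) x \<in> N}}"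
    by (simp add: funpow_Suc_right del: funpow.simps)
  then show ?case using negligible_tent_preimage[OF Suc] by simp
qed (use assms in simp)

text \<open>The exceptional set collects all preimages of \<open>trapped e\<close> and of the sets
  avoiding one member of a countable base. Outside it an orbit approaching \<open>W\<close> must
  enter \<open>W\<close>, and it then visits each base set that meets \<open>W\<close>.\<close>

lemma tent_typical_orbit:
  obtains N where "negligible N"
    "\<And>x V m. x \<in> {0..1} - N \<Longrightarrow> (\<lambda>n. infdist ((f ^^ n) x) W) \<longlonglongrightarrow> 0 \<Longrightarrow> open V \<Longrightarrow> V \<inter> W \<noteq> {} \<Longrightarrow>
       \<exists>n\<ge>m. (f ^^ n) x \<in> V"
proof -
  obtain e where e: "0 < e" "negligible (trapped e)" using negligible_trapped by blast
  obtain \<B> :: "real set set" where \<B>: "countable \<B>" "topological_basis \<B>"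
    using ex_countable_basis by blast
  let ?A = "\<lambda>V. {x\<in>W. \<forall>n. (f ^^ n) x \<notin> V}"
  define N where "N = (\<Union>m. {x. (f ^^ m) x \<in> trapped e}) \<union>
    (\<Union>V\<in>{V\<in>\<B>. V \<inter> W \<noteq> {}}. \<Union>m. {x. (f ^^ m) x \<in> ?A V})"
  have "negligible N"
    unfolding N_def
  proof (rule negligible_Un)
    show "negligible (\<Union>m. {x. (f ^^ m) x \<in> trapped e})"
      using e(2) by (intro negligible_countable_Union) (auto intro: negligible_tent_pow_preimage)
    have "negligible (\<Union>m. {x. (f ^^ m) x \<in> ?A V})" if "V \<in> {V\<in>\<B>. V \<inter> W \<noteq> {}}" for V
    proof -
      have "open V" using that \<B>(2) topological_basis_open by blast
      then have "negligible (?A V)" using that by (intro negligible_avoiding) auto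
      then have "negligible {x. (f ^^ m) x \<in> ?A V}" for m by (rule negligible_tent_pow_preimage)
      then show ?thesis by (intro negligible_countable_Union) auto
    qed
    moreover have "countable {V\<in>\<B>. V \<inter> W \<noteq> {}}" using \<B>(1) by (rule countable_subset[rotated]) auto
    ultimately show "negligible (\<Union>V\<in>{V\<in>\<B>. V \<inter> W \<noteq> {}}. \<Union>m. {x. (f ^^ m) x \<in> ?A V})"
      by (intro negligible_countable_Union countable_image) auto
  qed
  moreover have "\<exists>n\<ge>m. (f ^^ n) x \<in> V"
    if x: "x \<in> {0..1} - N" and lim: "(\<lambda>n. infdist ((f ^^ n) x) W) \<longlonglongrightarrow> 0" and V: "open V" "V \<inter> W \<noteq> {}"
    for x V m
  proof -
    have add: "(f ^^ n) ((f ^^ k) x) = (f ^^ (k + n)) x" for n k by (simp add: funpow_add add.commute[of k])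
    have "\<forall>\<^sub>F n in sequentially. infdist ((f ^^ n) x) W < e" using lim e(1) by (simp add: order_tendsto_iff)
    then obtain k where k: "\<And>n. k \<le> n \<Longrightarrow> infdist ((f ^^ n) x) W < e" by (auto simp: eventually_sequentially)
    have "(f ^^ k) x \<notin> trapped e" using x unfolding N_def by blast
    then obtain n where n: "(f ^^ n) ((f ^^ k) x) \<in> W"
      unfolding trapped_def using k[of "k + n" for n] tent_pow_in_unit[of x k] x add by auto
    \<comment> \<open>A time not before \<open>m\<close> at which the orbit is in the invariant set
      \<open>W\<close>; restarting there gives visits arbitrarily late.\<close>
    define j where "j = max m (k + n)"
    have "(f ^^ j) x = (f ^^ (j - (k + n))) ((f ^^ (k + n)) x)"
      unfolding add by (simp add: j_def)
    moreover have "(f ^^ (k + n)) x \<in> W" using n by (simp only: add)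
    ultimately have j: "(f ^^ j) x \<in> W" "m \<le> j" using tent_pow_W by (simp_all add: j_def)
    obtain w where w: "w \<in> V" "w \<in> W" using V(2) by blast
    obtain V' where V': "V' \<in> \<B>" "w \<in> V'" "V' \<subseteq> V" using topological_basisE[OF \<B>(2) V(1) w(1)] by blast
    then have "V' \<inter> W \<noteq> {}" using w by blast
    then have "(f ^^ j) x \<notin> ?A V'" using x V'(1) unfolding N_def by blast
    then obtain i where "(f ^^ i) ((f ^^ j) x) \<in> V'" using j(1) by blast
    then show ?thesis using V'(3) j(2) unfolding add by (intro exI[of _ "j + i"]) auto
  qed
  ultimately show thesis using that by blast
qed


section \<open>Transfer of null sets\<close>

lemma emeasure_gaps:
  assumes "S \<subseteq> C"
  shows "emeasure lborel (\<Union>x\<in>S. {l x..r x}) = ennreal (infsum len S)"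
proof -
  have abs: "(\<lambda>x. norm (len x)) summable_on S" using summable_len_subset[OF assms] len_nonneg by simp
  have "countable S" by (rule countable_subset[OF assms countable_surgery_points])
  have "emeasure lborel (\<Union>x\<in>S. {l x..r x}) = (\<integral>\<^sup>+x. emeasure lborel {l x..r x} \<partial>count_space S)"
  proof (rule emeasure_UN_countable[OF _ \<open>countable S\<close>])
    show "disjoint_family_on (\<lambda>x. {l x..r x}) S"
      unfolding disjoint_family_on_def
    proof (intro ballI impI)
      fix x y :: real assume "x \<noteq> y"
      then show "{l x..r x} \<inter> {l y..r y} = {}"
        using ins_intervals_disjoint[of x _ y] by (intro equals0I) auto
    qed
  qed simp
  also have "\<dots> = (\<integral>\<^sup>+x. ennreal (len x) \<partial>count_space S)"
    by (intro nn_integral_cong) (simp add: ins_left_le_right, simp add: ins_right_eq)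
  also have "\<dots> = ennreal (infsetsum len S)"
    by (rule nn_integral_conv_infsetsum[OF abs_summable_equivalent[THEN iffD1, OF abs] len_nonneg])
  also have "infsetsum len S = infsum len S"
    by (rule infsetsum_infsum[OF abs_summable_equivalent[THEN iffD1, OF abs]])
  finally show ?thesis .
qed

lemma ins_left_image_tail:
  assumes "x \<in> {0..1}"
  shows "l ` ({x<..1} - C) = {r x<..L} - (\<Union>y\<in>{y\<in>C. x < y}. {l y..r y})"
proof (intro subset_antisym subsetI)
  fix z assume "z \<in> l ` ({x<..1} - C)"
  then obtain y where y: "x < y" "y \<le> 1" "y \<notin> C" "z = l y" by auto
  have "r x < z" using ins_right_less_left[OF y(1)] y(1,4) by simp
  moreover have "z \<le> L" using ins_in_range(1)[of y] y assms by auto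
  moreover have "z \<notin> {l v..r v}" if "v \<in> C" for v
    using ins_intervals_disjoint[of v z y] ins_left_le_right[of y] y(3,4) that by auto
  ultimately show "z \<in> {r x<..L} - (\<Union>y\<in>{y\<in>C. x < y}. {l y..r y})" by auto
next
  fix z assume z: "z \<in> {r x<..L} - (\<Union>y\<in>{y\<in>C. x < y}. {l y..r y})"
  have "0 \<le> r x" using ins_in_range(2)[OF assms] by simp
  then have "z \<in> {0..L}" using z by auto
  then obtain y where y: "y \<in> {0..1}" "l y \<le> z" "z \<le> r y" using ins_intervals_cover by blast
  have "x < y"
  proof (rule ccontr)
    assume "\<not> x < y"
    then have "r y \<le> r x" using ins_right_mono[of y x] by simp
    then show False using y z by auto
  qed
  then have "y \<notin> C" using y z by auto
  then have "z = l y" using y ins_left_eq_right[of y] by simp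
  then show "z \<in> l ` ({x<..1} - C)" using \<open>x < y\<close> \<open>y \<notin> C\<close> y(1) by auto
qed

lemma ins_left_image_tail_borel:
  assumes "x \<in> {0..1}" shows "l ` ({x<..1} - C) \<in> sets borel"
proof -
  have "countable {y\<in>C. x < y}" using countable_surgery_points by (rule countable_subset[rotated]) auto
  then have "(\<Union>y\<in>{y\<in>C. x < y}. {l y..r y}) \<in> sets borel" by (intro sets.countable_UN') auto
  then show ?thesis unfolding ins_left_image_tail[OF assms] by (intro sets.Diff) auto
qed

text \<open>Removing the inserted intervals from the tail of the enlarged interval takes away
  exactly the inserted length.\<close>

lemma emeasure_ins_left_image_tail:
  assumes "x \<in> {0..1}"
  shows "emeasure lborel (l ` ({x<..1} - C)) = ennreal (1 - x)"
proof -
  let ?S = "{y\<in>C. x < y}" and ?U = "\<Union>y\<in>{y\<in>C. x < y}. {l y..r y}"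
  have sub: "?U \<subseteq> {r x<..L}"
  proof
    fix z assume "z \<in> ?U"
    then obtain y where y: "y \<in> C" "x < y" "l y \<le> z" "z \<le> r y" by auto
    have "r x < z" using ins_right_less_left[OF y(2)] y by simp
    moreover have "z \<le> L" using ins_in_range(2)[of y] y surgery_points_unit by force
    ultimately show "z \<in> {r x<..L}" by simp
  qed
  have "countable ?S" using countable_surgery_points by (rule countable_subset[rotated]) auto
  then have "?U \<in> sets lborel" by (intro sets.countable_UN') auto
  then have "emeasure lborel ({r x<..L} - ?U) = emeasure lborel {r x<..L} - emeasure lborel ?U"
    using sub emeasure_gaps[of ?S] by (intro emeasure_Diff) auto
  also have "emeasure lborel ?U = ennreal (infsum len ?S)" by (rule emeasure_gaps) auto
  also have "emeasure lborel {r x<..L} = ennreal (L - r x)"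
    using ins_in_range(2)[OF assms] by simp
  also have "ennreal (L - r x) - ennreal (infsum len ?S) = ennreal (L - r x - infsum len ?S)"
    by (intro ennreal_minus infsum_nonneg len_nonneg)
  also have "L - r x - infsum len ?S = 1 - x"
  proof -
    have "C = {y\<in>C. y \<le> x} \<union> ?S" by auto
    then have "infsum len C = infsum len ({y\<in>C. y \<le> x} \<union> ?S)" by simp
    also have "\<dots> = infsum len {y\<in>C. y \<le> x} + infsum len ?S"
      by (intro infsum_Un_disjoint summable_len_subset) auto
    finally show ?thesis by (simp add: L_eq ins_right_def)
  qed
  finally show ?thesis by (simp only: ins_left_image_tail[OF assms])
qed

definition proj :: "real \<Rightarrow> real" where
  "proj z = (SOME x. l x \<le> z \<and> z \<le> r x)"

lemma proj_ins_left: "proj (l x) = x"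
  unfolding proj_def
proof (rule some_equality)
  show "l x \<le> l x \<and> l x \<le> r x" using ins_left_le_right by simp
qed (use ins_intervals_disjoint ins_left_le_right in blast)

text \<open>The projection maps Lebesgue measure outside the inserted intervals to Lebesgue measure.\<close>

lemma negligible_ins_left_image:
  assumes "negligible N" "N \<subseteq> {0..1} - C"
  shows "negligible (l ` N)"
proof -
  define Z where "Z = l ` ({0<..1} - C)"
  have Z: "Z \<in> sets borel" unfolding Z_def by (rule ins_left_image_tail_borel) simp
  \<comment> \<open>\<open>M\<close> is the image of Lebesgue measure on \<open>Z\<close>,
    \<open>M0\<close> is Lebesgue measure on (0, 1]. They are equal because they are finite and
    agree on all half-lines.\<close>
  define M where "M = distr (restrict_space lborel Z) borel proj"
  define M0 where "M0 = distr (restrict_space lborel {0<..1}) borel (\<lambda>x::real. x)"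
  have "mono_on Z proj"
  proof (rule mono_onI)
    fix u v assume "u \<in> Z" "v \<in> Z" "u \<le> v"
    then obtain x y where "u = l x" "v = l y" by (auto simp: Z_def)
    then show "proj u \<le> proj v"
      using \<open>u \<le> v\<close> ins_left_mono[of y x] by (cases "y \<le> x") (simp_all add: proj_ins_left)
  qed
  then have meas: "proj \<in> measurable (restrict_space lborel Z) borel"
    using borel_measurable_mono_on_fnc[of Z proj] measurable_cong_sets[OF sets_restrict_space_cong[OF sets_lborel] refl]
    by blast
  have id_meas: "(\<lambda>x::real. x) \<in> measurable (restrict_space lborel {0<..1}) borel"
    by (intro measurable_restrict_space1) simp
  have M: "emeasure M B = emeasure lborel (proj -` B \<inter> Z)" if "B \<in> sets borel" for B
  proof -
    have "emeasure M B = emeasure (restrict_space lborel Z) (proj -` B \<inter> space (restrict_space lborel Z))"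
      unfolding M_def by (rule emeasure_distr[OF meas that])
    also have "\<dots> = emeasure lborel (proj -` B \<inter> Z)"
      using Z by (subst emeasure_restrict_space) (auto simp: space_restrict_space)
    finally show ?thesis .
  qed
  have M0: "emeasure M0 B = emeasure lborel (B \<inter> {0<..1})" if "B \<in> sets borel" for B
  proof -
    have "emeasure M0 B = emeasure (restrict_space lborel {0<..1}) ((\<lambda>x. x) -` B \<inter> space (restrict_space lborel {0<..1}))"
      unfolding M0_def by (rule emeasure_distr[OF id_meas that])
    also have "\<dots> = emeasure lborel (B \<inter> {0<..1})"
      by (subst emeasure_restrict_space) (auto simp: space_restrict_space)
    finally show ?thesis .
  qed
  have Mx: "emeasure M {x<..} = ennreal (1 - min 1 (max 0 x))" for x
  proof -
    let ?x = "min 1 (max 0 x)"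
    have "proj -` {x<..} \<inter> Z = l ` ({?x<..1} - C)"
    proof (intro subset_antisym subsetI)
      fix z assume "z \<in> proj -` {x<..} \<inter> Z"
      then obtain y where "y \<in> {0<..1} - C" "z = l y" "x < y" by (auto simp: Z_def proj_ins_left)
      then show "z \<in> l ` ({?x<..1} - C)" by (intro image_eqI[of _ _ y]) auto
    next
      fix z assume "z \<in> l ` ({?x<..1} - C)"
      then obtain y where "y \<in> {?x<..1} - C" "z = l y" by (rule imageE)
      then have y: "?x < y" "y \<le> 1" "y \<notin> C" "z = l y" by simp_all
      then have "0 < y" "x < y" by (auto simp: min_def max_def split: if_splits)
      then show "z \<in> proj -` {x<..} \<inter> Z" using y by (auto simp: Z_def proj_ins_left)
    qed
    then show ?thesis using M[of "{x<..}"] emeasure_ins_left_image_tail[of ?x] by simp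
  qed
  have M0x: "emeasure M0 {x<..} = ennreal (1 - min 1 (max 0 x))" for x
  proof -
    have "{x<..} \<inter> {0<..1} = {min 1 (max 0 x)<..1}" by auto
    then show ?thesis using M0[of "{x<..}"] by simp
  qed
  have "M = M0"
  proof (rule measure_eqI_lessThan)
    show "sets M = sets borel" "sets M0 = sets borel" by (simp_all add: M_def M0_def)
    show "emeasure M {x<..} < \<infinity>" for x by (simp add: Mx)
    show "emeasure M {x<..} = emeasure M0 {x<..}" for x by (simp only: Mx M0x)
  qed
  \<comment> \<open>The equality concerns Borel sets only, so the null set is first enlarged to a
    Borel one.\<close>
  obtain N' where N': "N' \<in> null_sets lborel" "N \<subseteq> N'"
    using assms(1) unfolding negligible_iff_null_sets null_sets_completion_iff2 by blast
  have Nb: "N' \<in> sets borel" using N'(1) by auto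
  have "emeasure lborel (proj -` N' \<inter> Z) = emeasure lborel (N' \<inter> {0<..1})"
    using M[OF Nb] M0[OF Nb] \<open>M = M0\<close> by simp
  also have "\<dots> \<le> emeasure lborel N'" by (rule emeasure_mono) (use Nb in auto)
  also have "\<dots> = 0" using N'(1) by (simp add: null_sets_def)
  finally have "emeasure lborel (proj -` N' \<inter> Z) = 0" by simp
  moreover have "proj -` N' \<inter> Z \<in> sets lborel"
  proof -
    have "proj -` N' \<inter> space (restrict_space lborel Z) \<in> sets (restrict_space lborel Z)"
      using meas Nb by (rule measurable_sets)
    then show ?thesis using Z by (simp add: space_restrict_space sets_restrict_space_iff)
  qed
  ultimately have "proj -` N' \<inter> Z \<in> null_sets lborel" by (simp add: null_sets_def)
  then have "negligible (proj -` N' \<inter> Z)"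
    unfolding negligible_iff_null_sets null_sets_completion_iff2 by blast
  \<comment> \<open>\<open>Z\<close> comes from the half-open interval (0, 1], so the point over 0
    is added back.\<close>
  then have "negligible (insert (l 0) (proj -` N' \<inter> Z))" by simp
  moreover have "l ` N \<subseteq> insert (l 0) (proj -` N' \<inter> Z)"
  proof (rule image_subsetI)
    fix x assume "x \<in> N"
    then have "x \<in> {0..1} - C" "x \<in> N'" using assms(2) N'(2) by auto
    then show "l x \<in> insert (l 0) (proj -` N' \<inter> Z)"
      by (cases "x = 0") (auto simp: Z_def proj_ins_left)
  qed
  ultimately show ?thesis by (rule negligible_subset)
qed

section \<open>The Cantor set\<close>

definition lam :: "real \<Rightarrow> real" where
  "lam x = l x / L"

definition rho :: "real \<Rightarrow> real" where
  "rho x = r x / L"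

text \<open>\<open>pullback {0..1}\<close> and \<open>pullback W\<close> are the sets
  \<open>A\<close> and \<open>A'\<close> of the overview. Leaving out \<open>C\<close> before taking
  the closure keeps the interiors of the inserted intervals out.\<close>

definition pullback :: "real set \<Rightarrow> real set" where
  "pullback B = closure (lam ` (B - C))"

lemma lam_le_rho: "lam x \<le> rho x" and lam_less_rho: "x \<in> C \<Longrightarrow> lam x < rho x"
  and lam_eq_rho: "x \<notin> C \<Longrightarrow> lam x = rho x"
  using ins_left_le_right[of x] ins_left_less_right[of x] ins_left_eq_right[of x] L_pos
  by (simp_all add: lam_def rho_def divide_right_mono divide_strict_right_mono)

lemma rho_less_lam: "x < y \<Longrightarrow> rho x < lam y"
  using ins_right_less_left[of x y] L_pos by (simp add: lam_def rho_def divide_strict_right_mono)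

lemma lam_dist: "\<bar>x - y\<bar> \<le> L * \<bar>lam x - lam y\<bar>"
proof -
  have "L * \<bar>lam x - lam y\<bar> = \<bar>l x - l y\<bar>"
    using L_pos by (simp add: lam_def abs_mult_pos'[symmetric] flip: diff_divide_distrib)
  then show ?thesis using ins_left_dist[of x y] by simp
qed

lemma lam_unit: "x \<in> {0..1} \<Longrightarrow> lam x \<in> {0..1}" and rho_unit: "x \<in> {0..1} \<Longrightarrow> rho x \<in> {0..1}"
  using ins_in_range[of x] L_pos by (auto simp: lam_def rho_def)

lemma between_scaled: "lam x \<le> t \<and> t \<le> rho x \<longleftrightarrow> l x \<le> L * t \<and> L * t \<le> r x"
  using L_pos by (auto simp: lam_def rho_def field_simps)

lemma lam_rho_cover: assumes "t \<in> {0..1}" shows "\<exists>x\<in>{0..1}. lam x \<le> t \<and> t \<le> rho x"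
proof -
  have "L * t \<in> {0..L}" using assms L_pos by (auto simp: mult_left_le)
  then show ?thesis using ins_intervals_cover between_scaled by blast
qed

lemma lam_rho_disjoint: "lam x \<le> t \<Longrightarrow> t \<le> rho x \<Longrightarrow> lam y \<le> t \<Longrightarrow> t \<le> rho y \<Longrightarrow> x = y"
  using between_scaled ins_intervals_disjoint by blast

lemma isCont_lam: "x \<notin> C \<Longrightarrow> isCont lam x"
  unfolding lam_def[abs_def] using isCont_ins_left L_pos by (intro continuous_intros) auto

lemma g_between:
  assumes "x \<in> {0..1}" "lam x \<le> t" "t \<le> rho x"
  shows "lam (f x) \<le> g t \<and> g t \<le> rho (f x)"
proof -
  have "L * t \<in> {l x..r x}" using assms between_scaled[of x t] by simp
  then have "G (L * t) \<in> {l (f x)..r (f x)}" using G_image_ins[OF assms(1)] by blast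
  then show ?thesis using L_pos by (simp add: g_def lam_def rho_def divide_right_mono)
qed

lemma g_pow_between:
  assumes "x \<in> {0..1}" "lam x \<le> t" "t \<le> rho x"
  shows "lam ((f ^^ n) x) \<le> (g ^^ n) t \<and> (g ^^ n) t \<le> rho ((f ^^ n) x)"
proof (induction n)
  case (Suc n)
  then show ?case using g_between[of "(f ^^ n) x" "(g ^^ n) t"] tent_pow_in_unit[OF assms(1)] by simp
qed (use assms in simp)

lemma g_lam: assumes "x \<in> {0..1} - C" shows "g (lam x) = lam (f x)"
  using G_ins_left_non_surgery[OF assms] L_pos by (simp add: g_def lam_def)

lemma g_pow_lam: assumes "x \<in> {0..1} - C" shows "(g ^^ n) (lam x) = lam ((f ^^ n) x)"
proof (induction n)
  case (Suc n)
  have "(f ^^ n) x \<in> {0..1} - C" using assms tent_pow_in_unit tent_pow_surgery_iff by blast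
  then show ?case using Suc g_lam by simp
qed simp

lemma g_endpoint:
  assumes "x \<in> {0..1}"
  shows "g (lam x) \<in> {lam (f x), rho (f x)}" "g (rho x) \<in> {lam (f x), rho (f x)}"
proof -
  have G: "g (lam x) = G (l x) / L" "g (rho x) = G (r x) / L" using L_pos by (simp_all add: g_def lam_def rho_def)
  have "G (l x) \<in> {l (f x), r (f x)}"
    using G_ins_left_half[of x] G_ins_left_reflect[of x] assms by (cases "x \<le> 1/2") auto
  then show "g (lam x) \<in> {lam (f x), rho (f x)}" unfolding G unfolding lam_def rho_def by auto
  have "G (r x) \<in> {l (f x), r (f x)}"
    using G_ins_right_half[of x] G_ins_right_reflect[of x] assms by (cases "x < 1/2") auto
  then show "g (rho x) \<in> {lam (f x), rho (f x)}" unfolding G unfolding lam_def rho_def by auto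
qed

lemma g'_endpoint:
  assumes "x \<in> {0..1}"
  shows "\<bar>g' (lam x)\<bar> = \<beta>" "\<bar>g' (rho x)\<bar> = \<beta>"
proof -
  have G: "g' (lam x) = G' (l x)" "g' (rho x) = G' (r x)" using L_pos by (simp_all add: g'_def lam_def rho_def)
  have left: "\<bar>G' (l x)\<bar> = \<beta>" if "x \<le> 1/2" for x
    using G'_left[of "l x"] H'_ins_left[OF that] ins_le_half(2)[OF that] beta_gt_1 by simp
  have right: "\<bar>G' (r x)\<bar> = \<beta>" if "x < 1/2" for x
    using G'_left[of "r x"] H'_ins_right[OF that] ins_le_half(1)[OF that] beta_gt_1 by simp
  have refl: "\<bar>G' (L - z)\<bar> = \<bar>G' z\<bar>" for z
    unfolding G'_def by (simp add: abs_minus_commute)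
  show "\<bar>g' (lam x)\<bar> = \<beta>"
    using left[of x] right[of "1 - x"] refl[of "l x"] ins_right_reflect[of x] unfolding G by (cases "x \<le> 1/2") auto
  show "\<bar>g' (rho x)\<bar> = \<beta>"
    using right[of x] left[of "1 - x"] refl[of "r x"] ins_left_reflect[of x] unfolding G by (cases "x < 1/2") auto
qed

lemma closed_pullback: "closed (pullback B)"
  by (simp add: pullback_def)

lemma pullback_mono: "B \<subseteq> B' \<Longrightarrow> pullback B \<subseteq> pullback B'"
  unfolding pullback_def by (intro closure_mono image_mono) auto

lemma pullback_unit: "B \<subseteq> {0..1} \<Longrightarrow> pullback B \<subseteq> {0..1}"
  unfolding pullback_def using lam_unit by (intro closure_minimal) auto

text \<open>Off \<open>C\<close> the map \<open>lam\<close> conjugates \<open>f\<close> to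
  \<open>g\<close>, and invariance passes to the closure by continuity.\<close>

lemma forward_invariant_pullback:
  assumes "B \<subseteq> {0..1}" "f ` B \<subseteq> B"
  shows "forward_invariant {0..1} g (pullback B)"
  unfolding forward_invariant_def
proof
  have "g ` lam ` (B - C) \<subseteq> lam ` (B - C)"
  proof (clarify)
    fix x assume x: "x \<in> B" "x \<notin> C"
    then have "f x \<in> B - C" using assms tent_surgery_iff[of x] by blast
    moreover have "g (lam x) = lam (f x)" using x assms(1) by (intro g_lam) auto
    ultimately show "g (lam x) \<in> lam ` (B - C)" by simp
  qed
  then show "g ` pullback B \<subseteq> pullback B"
    unfolding pullback_def
    by (intro image_closure_subset[OF continuous_g closed_closure])
      (rule subset_trans[OF _ closure_subset])
qed (rule pullback_unit[OF assms(1)])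

lemma pullback_avoids_gap:
  assumes "B \<subseteq> {0..1}" "lam x < t" "t < rho x" shows "t \<notin> pullback B"
proof
  assume "t \<in> pullback B"
  then have "{lam x<..<rho x} \<inter> closure (lam ` (B - C)) \<noteq> {}" using assms by (auto simp: pullback_def)
  then have "{lam x<..<rho x} \<inter> lam ` (B - C) \<noteq> {}"
    using open_Int_closure_eq_empty[of "{lam x<..<rho x}" "lam ` (B - C)"] by simp
  then obtain y where "y \<in> B - C" "lam y \<in> {lam x<..<rho x}" by blast
  then have y: "y \<in> B - C" "lam x < lam y" "lam y < rho x" by simp_all
  then have "x = y" using lam_rho_disjoint[of x "lam y" y] lam_le_rho[of y] by simp
  then show False using y by simp
qed

text \<open>The inverse of \<open>lam\<close> is Lipschitz, so a null image would force
  \<open>B - C\<close> to be null, and \<open>C\<close> is countable.\<close>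

lemma thick_pullback:
  assumes "B \<subseteq> {0..1}" "\<not> negligible B" shows "thick (pullback B)"
proof -
  have "\<not> negligible (pullback B)"
  proof
    assume "negligible (pullback B)"
    then have neg: "negligible (lam ` (B - C))"
      by (rule negligible_subset) (simp add: pullback_def closure_subset)
    let ?h = "\<lambda>t. proj (L * t)"
    have h: "?h (lam x) = x" for x using L_pos by (simp add: lam_def proj_ins_left)
    have "negligible (?h ` lam ` (B - C))"
    proof (rule negligible_Lipschitz_image[OF neg, of _ L])
      fix s t assume "s \<in> lam ` (B - C)" "t \<in> lam ` (B - C)"
      then obtain x y where "s = lam x" "t = lam y" by auto
      then show "\<bar>?h t - ?h s\<bar> \<le> L * \<bar>t - s\<bar>" using lam_dist[of y x] by (simp add: h)
    qed
    then have "negligible (B - C)" by (simp add: image_image h)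
    moreover have "negligible C" by (rule negligible_if_countable[OF countable_surgery_points])
    ultimately have "negligible ((B - C) \<union> C)" by (rule negligible_Un)
    then have "negligible B" by (rule negligible_subset) auto
    then show False using assms(2) by simp
  qed
  moreover have "pullback B \<in> sets lebesgue"
    using borel_closed[OF closed_pullback] by (simp add: sets_completionI_sets)
  ultimately show ?thesis
    by (simp add: thick_def negligible_iff_emeasure0 zero_less_iff_neq_zero)
qed

text \<open>The slope has absolute value \<open>\<beta>\<close> at all points \<open>lam x\<close>,
  hence by continuity on their closure, and the chain rule gives \<open>\<beta> ^ n\<close>. The
  constant 1/2 makes the inequality strict.\<close>

lemma hyperbolic_repelling_pullback:
  assumes "B \<subseteq> {0..1}" "f ` B \<subseteq> B" shows "hyperbolic_repelling {0..1} g (pullback B)"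
proof -
  have inv: "forward_invariant {0..1} g (pullback B)" by (rule forward_invariant_pullback[OF assms])
  have slope: "\<bar>g' t\<bar> = \<beta>" if "t \<in> pullback B" for t
  proof -
    have "\<bar>g' t\<bar> \<in> {\<beta>}"
      using that unfolding pullback_def
    proof (rule image_closure_subset[THEN subsetD, rotated 3, OF imageI])
      show "continuous_on (closure (lam ` (B - C))) (\<lambda>t. \<bar>g' t\<bar>)" by (intro continuous_intros continuous_g')
      show "(\<lambda>t. \<bar>g' t\<bar>) ` lam ` (B - C) \<subseteq> {\<beta>}" using g'_endpoint(1) assms(1) by auto
    qed simp
    then show ?thesis by simp
  qed
  have "\<exists>d. ((g ^^ n) has_real_derivative d) (at t within {0..1}) \<and> \<bar>d\<bar> = \<beta> ^ n" if t: "t \<in> pullback B" for t n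
  proof (induction n)
    case 0
    then show ?case by (intro exI[of _ 1]) (simp add: id_def)
  next
    case (Suc n)
    then obtain d where d: "((g ^^ n) has_real_derivative d) (at t within {0..1})" "\<bar>d\<bar> = \<beta> ^ n" by blast
    have "(g ^^ n) t \<in> pullback B"
      using t inv by (induction n) (auto simp: forward_invariant_def)
    then have "\<bar>g' ((g ^^ n) t) * d\<bar> = \<beta> ^ Suc n" using d(2) slope by (simp add: abs_mult)
    moreover have "((g \<circ> (g ^^ n)) has_real_derivative g' ((g ^^ n) t) * d) (at t within {0..1})"
      using d(1) g_deriv by (intro DERIV_chain) auto
    ultimately show ?case by (intro exI[of _ "g' ((g ^^ n) t) * d"]) (simp add: o_def)
  qed
  then have expand: "\<exists>d. ((g ^^ n) has_real_derivative d) (at t within {0..1}) \<and> \<bar>d\<bar> > 1 / 2 * \<beta> ^ n"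
    if "t \<in> pullback B" for t n
    using that beta_pow_pos[of n] by fastforce
  show ?thesis unfolding hyperbolic_repelling_def
    by (rule conjI[OF inv], rule exI[of _ "1/2"], rule exI[of _ \<beta>], intro conjI ballI allI expand)
      (use beta_gt_1 in auto)
qed

text \<open>Perfect: off \<open>C\<close> the map \<open>lam\<close> is continuous, and points off
  \<open>C\<close> accumulate everywhere. Totally disconnected: any two points enclose part of the
  interior of an inserted interval.\<close>

lemma Cantor_set_pullback: "Cantor_set (pullback {0..1})"
proof -
  let ?A = "pullback {0..1}"
  have "compact ?A"
    using closed_pullback bounded_subset[OF bounded_closed_interval pullback_unit[OF order_refl]]
    by (simp add: compact_eq_bounded_closed)
  moreover have "?A \<noteq> {}"
  proof -
    have "uncountable {0..1::real}" by (simp add: uncountable_closed_interval)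
    then have "uncountable ({0..1} - C)" using countable_surgery_points by (rule uncountable_minus_countable)
    then have "{0..1} - C \<noteq> {}" using countable_empty by metis
    then show ?thesis by (simp add: pullback_def)
  qed
  moreover have "\<forall>t\<in>?A. t islimpt ?A"
  proof
    have "lam x islimpt lam ` ({0..1} - C)" if x: "x \<in> {0..1} - C" for x
      unfolding islimpt_approachable
    proof (intro allI impI)
      fix e :: real assume "0 < e"
      then obtain d where d: "0 < d" "\<And>y. dist y x < d \<Longrightarrow> dist (lam y) (lam x) < e"
        using isCont_lam[of x] x unfolding continuous_at_eps_delta by blast
      define a where "a = max 0 (x - d)"
      define b where "b = min 1 (x + d)"
      have "a < b" using x d(1) by (auto simp: a_def b_def)
      then have "uncountable ({a<..<b} - insert x C)"
        using countable_surgery_points by (intro uncountable_minus_countable) (auto simp: uncountable_open_interval)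
      then have "{a<..<b} - insert x C \<noteq> {}" using countable_empty by metis
      then obtain y where y: "y \<in> {a<..<b}" "y \<noteq> x" "y \<notin> C" by blast
      then have "y \<in> {0..1} - C" "dist y x < d" by (auto simp: a_def b_def dist_real_def)
      moreover have "lam y \<noteq> lam x"
        using lam_dist[of y x] y(2) L_pos by auto
      ultimately show "\<exists>t\<in>lam ` ({0..1} - C). t \<noteq> lam x \<and> dist t (lam x) < e" using d(2) by blast
    qed
    then have sub: "lam ` ({0..1} - C) \<subseteq> {t. t islimpt lam ` ({0..1} - C)}" by blast
    fix t assume "t \<in> ?A"
    moreover have "?A \<subseteq> {t. t islimpt lam ` ({0..1} - C)}"
      unfolding pullback_def using sub closed_limpts[of "lam ` ({0..1} - C)"] by (rule closure_minimal)
    ultimately have "t islimpt lam ` ({0..1} - C)" by blast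
    then show "t islimpt ?A" by (rule islimpt_subset) (simp add: pullback_def closure_subset)
  qed
  moreover have "\<exists>x. S \<subseteq> {x}" if S: "S \<subseteq> ?A" "connected S" for S
  proof (rule ccontr)
    assume no: "\<nexists>x. S \<subseteq> {x}"
    have "\<exists>a b. a \<in> S \<and> b \<in> S \<and> a < b"
    proof (rule ccontr)
      assume *: "\<nexists>a b. a \<in> S \<and> b \<in> S \<and> a < b"
      have "S \<noteq> {}" using no by blast
      then obtain a where "a \<in> S" by blast
      then have "S \<subseteq> {a}" using * by (metis linorder_neqE_linordered_idom singletonI subsetI)
      then show False using no by blast
    qed
    then obtain a b where ab: "a \<in> S" "b \<in> S" "a < b" by blast
    have sub: "{a..b} \<subseteq> ?A" using connected_contains_Icc[OF S(2) ab(1,2)] S(1) by blast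
    have unit: "a \<in> {0..1}" "b \<in> {0..1}" using ab S(1) pullback_unit[of "{0..1}"] by auto
    obtain x where x: "x \<in> {0..1}" "lam x \<le> a" "a \<le> rho x" using lam_rho_cover[OF unit(1)] by blast
    obtain y where y: "y \<in> {0..1}" "lam y \<le> b" "b \<le> rho y" using lam_rho_cover[OF unit(2)] by blast
    \<comment> \<open>Either the two points lie over different base points, and density of
      \<open>C\<close> supplies an inserted interval between them, or they lie in the same
      one.\<close>
    have "\<exists>v. max a (lam v) < min b (rho v)"
    proof (cases "x < y")
      case True
      then obtain v where v: "v \<in> C" "x < v" "v < y"
        using surgery_points_dense[of x y] x(1) y(1) by auto
      have "a < lam v" "rho v < b" using rho_less_lam[OF v(2)] rho_less_lam[OF v(3)] x y by auto
      then show ?thesis using lam_less_rho[OF v(1)] ab(3) by (intro exI[of _ v]) auto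
    next
      case False
      have "\<not> y < x"
      proof
        assume "y < x"
        then show False using rho_less_lam[of y x] x(2) y(3) ab(3) by linarith
      qed
      then have "x = y" using False by simp
      then show ?thesis using x y ab(3) by (intro exI[of _ x]) auto
    qed
    then obtain v where v: "max a (lam v) < min b (rho v)" by blast
    then obtain t where t: "max a (lam v) < t" "t < min b (rho v)" using dense by blast
    then have "t \<in> ?A" using sub by auto
    moreover have "t \<notin> ?A" using t by (intro pullback_avoids_gap[of _ v]) auto
    ultimately show False by blast
  qed
  ultimately show ?thesis by (simp add: Cantor_set_def)
qed

end

section \<open>Limit sets\<close>

lemma strict_mono_selection:
  fixes R :: "nat \<Rightarrow> nat \<Rightarrow> bool"
  assumes "\<And>k m. \<exists>n\<ge>m. R k n"
  shows "\<exists>s::nat \<Rightarrow> nat. strict_mono s \<and> (\<forall>k. R k (s k))"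
proof -
  have "\<exists>s. \<forall>k. R k (s k) \<and> s k < s (Suc k)"
  proof (rule dependent_nat_choice)
    show "\<exists>n. R 0 n" using assms by blast
    fix n k
    obtain n' where "Suc n \<le> n'" "R (Suc k) n'" using assms by blast
    then show "\<exists>n'. R (Suc k) n' \<and> n < n'" by (intro exI[of _ n']) auto
  qed
  then obtain s where s: "\<And>k. R k (s k)" "\<And>k. s k < s (Suc k)" by blast
  have "strict_mono s" using s(2) by (simp add: strict_mono_Suc_iff)
  then show ?thesis using s(1) by blast
qed

lemma omega_limitI:
  assumes "\<And>e m. 0 < e \<Longrightarrow> \<exists>n\<ge>m. \<bar>(h ^^ n) x - y\<bar> < e"
  shows "y \<in> omega_limit h x"
proof -
  have "\<exists>n\<ge>m. \<bar>(h ^^ n) x - y\<bar> < inverse (real (Suc k))" for k m by (rule assms) simp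
  then have "\<exists>s. strict_mono s \<and> (\<forall>k. \<bar>(h ^^ s k) x - y\<bar> < inverse (real (Suc k)))"
    by (rule strict_mono_selection)
  then obtain s where s: "strict_mono s" "\<And>k. \<bar>(h ^^ s k) x - y\<bar> < inverse (real (Suc k))" by blast
  have "(\<lambda>k. (h ^^ s k) x - y) \<longlonglongrightarrow> 0"
  proof (rule Lim_null_comparison)
    show "\<forall>\<^sub>F k in sequentially. norm ((h ^^ s k) x - y) \<le> inverse (real (Suc k))"
      using s(2) by (intro always_eventually) (simp add: less_imp_le)
  qed (rule LIMSEQ_inverse_real_of_nat)
  then have "(\<lambda>k. (h ^^ s k) x) \<longlonglongrightarrow> y" by (simp add: LIM_zero_iff)
  then show ?thesis unfolding omega_limit_def using s(1) by blast
qed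

text \<open>Compactness: a subsequence staying away from \<open>S\<close> would accumulate at a
  limit point, which is in \<open>S\<close>.\<close>

lemma eventually_near_omega_limit:
  fixes h :: "real \<Rightarrow> real"
  assumes "\<And>n. (h ^^ n) x \<in> {0..1}" "omega_limit h x \<subseteq> S" "0 < e"
  shows "\<exists>N. \<forall>n\<ge>N. \<exists>y\<in>S. \<bar>(h ^^ n) x - y\<bar> < e"
proof (rule ccontr)
  assume "\<not> ?thesis"
  then have far: "\<exists>n\<ge>m. \<forall>y\<in>S. \<not> \<bar>(h ^^ n) x - y\<bar> < e" for m by blast
  have "\<exists>s. strict_mono s \<and> (\<forall>k::nat. \<forall>y\<in>S. \<not> \<bar>(h ^^ s k) x - y\<bar> < e)"
    by (rule strict_mono_selection) (rule far)
  then obtain s :: "nat \<Rightarrow> nat" where s: "strict_mono s" "\<And>k. \<forall>y\<in>S. \<not> \<bar>(h ^^ s k) x - y\<bar> < e" by blast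
  have "seq_compact {0..1::real}" by (intro compact_imp_seq_compact) simp
  then have "\<exists>y\<in>{0..1}. \<exists>q::nat \<Rightarrow> nat. strict_mono q \<and> ((\<lambda>k. (h ^^ s k) x) \<circ> q) \<longlonglongrightarrow> y"
    unfolding seq_compact_def by (elim allE[of _ "\<lambda>k. (h ^^ s k) x"] impE) (use assms(1) in auto)
  then obtain y q where q: "strict_mono (q :: nat \<Rightarrow> nat)" "((\<lambda>k. (h ^^ s k) x) \<circ> q) \<longlonglongrightarrow> y" by blast
  have "strict_mono (s \<circ> q)" using s(1) q(1) by (rule strict_mono_o)
  moreover have "(\<lambda>k. (h ^^ (s \<circ> q) k) x) \<longlonglongrightarrow> y" using q(2) by (simp add: o_def)
  ultimately have "y \<in> omega_limit h x" unfolding omega_limit_def by blast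
  then have "y \<in> S" using assms(2) by blast
  have "\<forall>\<^sub>F k in sequentially. dist (((\<lambda>k. (h ^^ s k) x) \<circ> q) k) y < e"
    using q(2) assms(3) by (rule tendstoD)
  then obtain k where "dist ((h ^^ s (q k)) x) y < e" by (auto simp: eventually_sequentially)
  then show False using s(2)[of "q k"] \<open>y \<in> S\<close> by (auto simp: dist_real_def)
qed

lemma omega_limit_subset_closed:
  assumes "closed U" "\<And>n. m \<le> n \<Longrightarrow> (h ^^ n) x \<in> U"
  shows "omega_limit h x \<subseteq> U"
proof
  fix y assume "y \<in> omega_limit h x"
  then obtain s where s: "strict_mono s" "(\<lambda>k. (h ^^ s k) x) \<longlonglongrightarrow> y" by (auto simp: omega_limit_def)
  have "(h ^^ s k) x \<in> U" if "m \<le> k" for k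
    using assms(2) seq_suble[OF s(1), of k] that by (meson order_trans)
  then have "\<forall>\<^sub>F k in sequentially. (h ^^ s k) x \<in> U" by (auto simp: eventually_sequentially)
  then show "y \<in> U" using Lim_in_closed_set[OF assms(1) _ _ s(2)] by simp
qed

text \<open>Expressed by distances, the basin is described by limits of continuous functions, from
  which measurability follows.\<close>

lemma basin_eq:
  fixes h :: "real \<Rightarrow> real"
  assumes "closed S" "S \<noteq> {}" "h ` {0..1} \<subseteq> {0..1}"
  shows "basin {0..1} h S = {x\<in>{0..1}. (\<lambda>n. infdist ((h ^^ n) x) S) \<longlonglongrightarrow> 0}"
proof (intro subset_antisym subsetI)
  fix x assume x: "x \<in> basin {0..1} h S"
  then have "x \<in> {0..1}" by (simp add: basin_def)
  then have orbit: "(h ^^ n) x \<in> {0..1}" for n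
  proof (induction n)
    case (Suc n)
    then have "h ((h ^^ n) x) \<in> {0..1}" using assms(3) by blast
    then show ?case by simp
  qed simp
  have "(\<lambda>n. infdist ((h ^^ n) x) S) \<longlonglongrightarrow> 0"
    unfolding lim_sequentially
  proof (intro allI impI)
    fix e :: real assume "0 < e"
    then obtain N where N: "\<And>n. N \<le> n \<Longrightarrow> \<exists>y\<in>S. \<bar>(h ^^ n) x - y\<bar> < e"
      using eventually_near_omega_limit[of h x S e] orbit x unfolding basin_def by blast
    have "dist (infdist ((h ^^ n) x) S) 0 < e" if n: "N \<le> n" for n
    proof -
      obtain y where "y \<in> S" "dist ((h ^^ n) x) y < e" using N[OF n] by (auto simp: dist_real_def)
      then show ?thesis using infdist_le[of y S "(h ^^ n) x"] by (simp add: infdist_nonneg)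
    qed
    then show "\<exists>N. \<forall>n\<ge>N. dist (infdist ((h ^^ n) x) S) 0 < e" by blast
  qed
  then show "x \<in> {x\<in>{0..1}. (\<lambda>n. infdist ((h ^^ n) x) S) \<longlonglongrightarrow> 0}" using \<open>x \<in> {0..1}\<close> by blast
next
  fix x assume x: "x \<in> {x\<in>{0..1}. (\<lambda>n. infdist ((h ^^ n) x) S) \<longlonglongrightarrow> 0}"
  have "omega_limit h x \<subseteq> S"
  proof
    fix y assume "y \<in> omega_limit h x"
    then obtain s where s: "strict_mono s" "(\<lambda>k. (h ^^ s k) x) \<longlonglongrightarrow> y" by (auto simp: omega_limit_def)
    have "(\<lambda>k. infdist ((h ^^ s k) x) S) \<longlonglongrightarrow> 0"
      using LIMSEQ_subseq_LIMSEQ[of "\<lambda>n. infdist ((h ^^ n) x) S" 0 s] x s(1) by (simp add: o_def)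
    moreover have "(\<lambda>k. infdist ((h ^^ s k) x) S) \<longlonglongrightarrow> infdist y S" using s(2) by (rule tendsto_infdist)
    ultimately have "infdist y S = 0" using LIMSEQ_unique by blast
    then show "y \<in> S" using in_closed_iff_infdist_zero[OF assms(1,2)] by simp
  qed
  then show "x \<in> basin {0..1} h S" using x by (simp add: basin_def)
qed

lemma basin_borel:
  fixes h :: "real \<Rightarrow> real"
  assumes "closed S" "S \<noteq> {}" "h ` {0..1} \<subseteq> {0..1}" "continuous_on UNIV h"
  shows "basin {0..1} h S \<in> sets borel"
proof -
  have "continuous_on UNIV (h ^^ n)" for n
  proof (induction n)
    case (Suc n)
    then show ?case using continuous_on_compose[OF Suc continuous_on_subset[OF assms(4)]] by simp
  qed (simp add: id_def)
  then have [measurable]: "(\<lambda>x. infdist ((h ^^ n) x) S) \<in> borel_measurable borel" for n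
    by (intro borel_measurable_continuous_onI continuous_intros)
  have "{x \<in> space borel. x \<in> {0..1} \<and> (\<lambda>n. infdist ((h ^^ n) x) S) \<longlonglongrightarrow> 0} \<in> sets borel"
    by measurable
  then show ?thesis by (simp add: basin_eq[OF assms(1-3)])
qed

text \<open>Near a repelling set the distance to it grows by a definite factor in every step, unless it is 0.\<close>

lemma finite_repelling_set_hit:
  fixes h :: "real \<Rightarrow> real"
  assumes E: "finite E" "h ` E \<subseteq> E" and B: "1 < B"
    and deriv: "\<And>y. y \<in> E \<Longrightarrow> (h has_real_derivative d y) (at y)" "\<And>y. y \<in> E \<Longrightarrow> \<bar>d y\<bar> = B"
    and orbit: "\<And>n. (h ^^ n) x \<in> {0..1}" "omega_limit h x \<subseteq> E"
  shows "\<exists>n. (h ^^ n) x \<in> E"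
proof (rule ccontr)
  assume no: "\<not> ?thesis"
  have "\<exists>\<sigma>>0. \<forall>y\<in>E. \<forall>z\<in>E. y \<noteq> z \<longrightarrow> \<sigma> \<le> \<bar>y - z\<bar>"
  proof -
    let ?D = "insert 1 ((\<lambda>(y, z). \<bar>y - z\<bar>) ` {(y, z) \<in> E \<times> E. y \<noteq> z})"
    have fin: "finite ?D" using E(1) by (auto intro: finite_subset[of _ "E \<times> E"])
    have "0 < Min ?D" using fin by (subst Min_gr_iff) auto
    moreover have "\<forall>y\<in>E. \<forall>z\<in>E. y \<noteq> z \<longrightarrow> Min ?D \<le> \<bar>y - z\<bar>"
      using fin by (intro ballI impI Min_le) auto
    ultimately show ?thesis by blast
  qed
  then obtain \<sigma> where \<sigma>: "0 < \<sigma>" "\<And>y z. y \<in> E \<Longrightarrow> z \<in> E \<Longrightarrow> y \<noteq> z \<Longrightarrow> \<sigma> \<le> \<bar>y - z\<bar>" by blast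
  \<comment> \<open>Any factor strictly between 1 and \<open>B\<close> serves: it still expands, and
    difference quotients near \<open>E\<close> exceed it.\<close>
  define \<kappa> where "\<kappa> = (1 + B) / 2"
  have \<kappa>: "1 < \<kappa>" "\<kappa> < B" using B by (auto simp: \<kappa>_def)
  have "\<exists>\<eta>>0. \<forall>z. \<bar>z - y\<bar> < \<eta> \<longrightarrow> \<kappa> * \<bar>z - y\<bar> \<le> \<bar>h z - h y\<bar> \<and> \<bar>h z - h y\<bar> < \<sigma> / 2" if y: "y \<in> E" for y
  proof -
    have "((\<lambda>z. \<bar>(h z - h y) / (z - y)\<bar>) \<longlongrightarrow> \<bar>d y\<bar>) (at y)"
      using deriv(1)[OF y] by (intro tendsto_rabs) (simp add: has_field_derivative_iff)
    then have "\<forall>\<^sub>F z in at y. \<kappa> < \<bar>(h z - h y) / (z - y)\<bar>"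
      using \<kappa>(2) deriv(2)[OF y] by (simp add: order_tendsto_iff)
    then obtain \<eta>1 where \<eta>1: "0 < \<eta>1" "\<And>z. z \<noteq> y \<Longrightarrow> dist z y < \<eta>1 \<Longrightarrow> \<kappa> < \<bar>(h z - h y) / (z - y)\<bar>"
      by (auto simp: eventually_at)
    have "isCont h y" using deriv(1)[OF y] by (rule DERIV_isCont)
    moreover have "0 < \<sigma> / 2" using \<sigma>(1) by simp
    ultimately obtain \<eta>2 where \<eta>2: "0 < \<eta>2" "\<And>z. dist z y < \<eta>2 \<Longrightarrow> dist (h z) (h y) < \<sigma> / 2"
      unfolding continuous_at_eps_delta by blast
    have "\<kappa> * \<bar>z - y\<bar> \<le> \<bar>h z - h y\<bar> \<and> \<bar>h z - h y\<bar> < \<sigma> / 2" if "\<bar>z - y\<bar> < min \<eta>1 \<eta>2" for z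
    proof
      show "\<kappa> * \<bar>z - y\<bar> \<le> \<bar>h z - h y\<bar>"
      proof (cases "z = y")
        case False
        then have "\<kappa> < \<bar>h z - h y\<bar> / \<bar>z - y\<bar>" using \<eta>1(2)[of z] that by (simp add: dist_real_def abs_divide)
        then show ?thesis using False by (simp add: pos_less_divide_eq)
      qed simp
      show "\<bar>h z - h y\<bar> < \<sigma> / 2" using \<eta>2(2)[of z] that by (simp add: dist_real_def)
    qed
    then show ?thesis using \<eta>1(1) \<eta>2(1) by (intro exI[of _ "min \<eta>1 \<eta>2"]) auto
  qed
  then obtain \<eta> where \<eta>: "\<And>y. y \<in> E \<Longrightarrow> 0 < \<eta> y"
    "\<And>y z. y \<in> E \<Longrightarrow> \<bar>z - y\<bar> < \<eta> y \<Longrightarrow> \<kappa> * \<bar>z - y\<bar> \<le> \<bar>h z - h y\<bar> \<and> \<bar>h z - h y\<bar> < \<sigma> / 2"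
    by metis
  \<comment> \<open>Small enough for the local expansion at every point of \<open>E\<close>, and at
    most half of \<open>\<sigma> / 2 + \<sigma> / 2\<close>, so that the point of \<open>E\<close>
    shadowing the next iterate is forced to be the image of the present one.\<close>
  define \<epsilon> where "\<epsilon> = Min (insert (\<sigma> / 2) (\<eta> ` E))"
  have "0 < \<epsilon>" unfolding \<epsilon>_def using E(1) \<eta>(1) \<sigma>(1) by (subst Min_gr_iff) auto
  have \<epsilon>: "\<epsilon> \<le> \<sigma> / 2" "\<And>y. y \<in> E \<Longrightarrow> \<epsilon> \<le> \<eta> y"
    unfolding \<epsilon>_def using E(1) by (intro Min_le; simp)+
  obtain N where N: "\<And>n. N \<le> n \<Longrightarrow> \<exists>y\<in>E. \<bar>(h ^^ n) x - y\<bar> < \<epsilon>"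
    using eventually_near_omega_limit[OF orbit \<open>0 < \<epsilon>\<close>] by blast
  define near where "near n = (SOME y. y \<in> E \<and> \<bar>(h ^^ n) x - y\<bar> < \<epsilon>)" for n
  have near: "near n \<in> E" "\<bar>(h ^^ n) x - near n\<bar> < \<epsilon>" if "N \<le> n" for n
    using someI_ex[of "\<lambda>y. y \<in> E \<and> \<bar>(h ^^ n) x - y\<bar> < \<epsilon>"] N[OF that] unfolding near_def by auto
  have step: "\<kappa> * \<bar>(h ^^ n) x - near n\<bar> \<le> \<bar>(h ^^ Suc n) x - near (Suc n)\<bar>" if n: "N \<le> n" for n
  proof -
    have "\<bar>(h ^^ n) x - near n\<bar> < \<eta> (near n)" using near[OF n] \<epsilon>(2) by fastforce
    then have h: "\<kappa> * \<bar>(h ^^ n) x - near n\<bar> \<le> \<bar>h ((h ^^ n) x) - h (near n)\<bar>"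
      "\<bar>h ((h ^^ n) x) - h (near n)\<bar> < \<sigma> / 2"
      using \<eta>(2)[OF near(1)[OF n]] by blast+
    have "\<bar>h ((h ^^ n) x) - near (Suc n)\<bar> < \<epsilon>" using near(2)[of "Suc n"] n by simp
    then have "\<bar>near (Suc n) - h (near n)\<bar> < \<sigma>" using h(2) \<epsilon>(1) by linarith
    moreover have "near (Suc n) \<in> E" using near(1)[of "Suc n"] n by simp
    moreover have "h (near n) \<in> E" using near(1)[OF n] E(2) by blast
    ultimately have "near (Suc n) = h (near n)" using \<sigma>(2)[of "near (Suc n)" "h (near n)"] by linarith
    then show ?thesis using h(1) by simp
  qed
  define \<delta> where "\<delta> = \<bar>(h ^^ N) x - near N\<bar>"
  have "(h ^^ N) x \<noteq> near N" using no near(1)[OF order_refl] by metis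
  then have "0 < \<delta>" by (simp add: \<delta>_def)
  have grow: "\<kappa> ^ k * \<delta> \<le> \<bar>(h ^^ (N + k)) x - near (N + k)\<bar>" for k
  proof (induction k)
    case (Suc k)
    have "\<kappa> ^ Suc k * \<delta> \<le> \<kappa> * \<bar>(h ^^ (N + k)) x - near (N + k)\<bar>"
      using mult_left_mono[OF Suc, of \<kappa>] \<kappa>(1) by (simp add: mult.assoc)
    also have "\<dots> \<le> \<bar>(h ^^ Suc (N + k)) x - near (Suc (N + k))\<bar>" by (rule step) simp
    finally show ?case by simp
  qed (simp add: \<delta>_def)
  obtain k where "\<epsilon> / \<delta> < \<kappa> ^ k" using real_arch_pow[OF \<kappa>(1)] by blast
  then have "\<epsilon> < \<kappa> ^ k * \<delta>" using \<open>0 < \<delta>\<close> by (simp add: pos_divide_less_eq)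
  then show False using grow[of k] near(2)[of "N + k"] by simp
qed

context pcf_tent
begin

section \<open>The wild attractor\<close>

definition cycle_ends :: "real set" where
  "cycle_ends = lam ` P \<union> rho ` P"

lemma crit_cycle_unit: "P \<subseteq> {0..1}"
  using crit_cycle_subset crit_orbit_unit by blast

lemma g_cycle_ends: "g ` cycle_ends \<subseteq> cycle_ends"
proof (rule image_subsetI)
  fix t assume "t \<in> cycle_ends"
  then obtain p where p: "p \<in> P" "t = lam p \<or> t = rho p" by (auto simp: cycle_ends_def)
  then have "g t \<in> {lam (f p), rho (f p)}" using g_endpoint[of p] crit_cycle_unit by auto
  then show "g t \<in> cycle_ends" using tent_crit_cycle[OF p(1)] by (auto simp: cycle_ends_def)
qed

lemma g_pow_unit: "t \<in> {0..1} \<Longrightarrow> (g ^^ n) t \<in> {0..1}"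
proof (induction n)
  case (Suc n)
  then have "g ((g ^^ n) t) \<in> {0..1}" using g_range by blast
  then show ?case by simp
qed simp

text \<open>The orbit ends up in the finitely many inserted intervals over \<open>P\<close>. Since
  \<open>pullback B\<close> misses their interiors, the limit set consists of endpoints; these
  repel, so the orbit can only approach them by landing on one.\<close>

lemma gap_orbit_hits_cycle_ends:
  assumes t: "t \<in> {0..1}" "t \<notin> lam ` ({0..1} - C)"
    and om: "omega_limit g t \<subseteq> pullback B" "B \<subseteq> {0..1}"
  shows "\<exists>n. (g ^^ n) t \<in> cycle_ends"
proof -
  obtain x where x: "x \<in> {0..1}" "lam x \<le> t" "t \<le> rho x" using lam_rho_cover[OF t(1)] by blast
  have "x \<in> C"
  proof (rule ccontr)
    assume "x \<notin> C"
    then have "t = lam x" using x lam_eq_rho[of x] by simp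
    then show False using t(2) x(1) \<open>x \<notin> C\<close> by blast
  qed
  then obtain m where m: "(f ^^ m) x \<in> P" by (auto simp: surgery_points_def)
  have P: "(f ^^ n) x \<in> P" if "m \<le> n" for n
    using that by (induction rule: dec_induct) (use m tent_crit_cycle in auto)
  let ?U = "\<Union>p\<in>P. {lam p..rho p}"
  have "omega_limit g t \<subseteq> ?U"
  proof (rule omega_limit_subset_closed)
    show "closed ?U" using finite_crit_cycle by (intro closed_UN) auto
    show "(g ^^ n) t \<in> ?U" if "m \<le> n" for n
      using P[OF that] g_pow_between[OF x, of n] by auto
  qed
  moreover have "s \<in> cycle_ends" if s: "s \<in> ?U" "s \<in> pullback B" for s
  proof -
    obtain p where p: "p \<in> P" "lam p \<le> s" "s \<le> rho p" using s(1) by auto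
    then have "s = lam p \<or> s = rho p" using pullback_avoids_gap[OF om(2), of p s] s(2) by linarith
    then show ?thesis using p(1) by (auto simp: cycle_ends_def)
  qed
  ultimately have "omega_limit g t \<subseteq> cycle_ends" using om(1) by blast
  moreover have "finite cycle_ends" using finite_crit_cycle by (simp add: cycle_ends_def)
  moreover have "\<bar>g' s\<bar> = \<beta>" if "s \<in> cycle_ends" for s
    using that g'_endpoint crit_cycle_unit by (auto simp: cycle_ends_def)
  ultimately show ?thesis
    using finite_repelling_set_hit[of cycle_ends g \<beta> g' t] g_cycle_ends beta_gt_1 g_deriv g_pow_unit[OF t(1)] by blast
qed

text \<open>\<open>g\<close> is injective on each side of 1/2, so a point has at most two
  preimages.\<close>

lemma finite_g_vimage: assumes "finite F" shows "finite (g -` F)"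
proof -
  have "inj_on g {..1/2}" by (rule strict_mono_on_imp_inj_on[OF strict_mono_g])
  moreover have "inj_on g {1/2..}"
    using strict_antimono_g unfolding monotone_on_def
    by (intro inj_onI) (metis (no_types) less_irrefl linorder_neqE_linordered_idom)
  ultimately have "finite (g -` F \<inter> {..1/2})" "finite (g -` F \<inter> {1/2..})"
    using finite_vimage_IntI[OF assms] by blast+
  then have "finite ((g -` F \<inter> {..1/2}) \<union> (g -` F \<inter> {1/2..}))" by (rule finite_UnI)
  moreover have "(g -` F \<inter> {..1/2}) \<union> (g -` F \<inter> {1/2..}) = g -` F" by auto
  ultimately show ?thesis by simp
qed

lemma countable_hits_cycle_ends: "countable {t. \<exists>n. (g ^^ n) t \<in> cycle_ends}"
proof -
  have "finite {t. (g ^^ n) t \<in> cycle_ends}" for n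
  proof (induction n)
    case 0
    then show ?case using finite_crit_cycle by (simp add: cycle_ends_def)
  next
    case (Suc n)
    have "{t. (g ^^ Suc n) t \<in> cycle_ends} = g -` {t. (g ^^ n) t \<in> cycle_ends}"
      by (auto simp add: funpow_Suc_right simp del: funpow.simps)
    then show ?case using finite_g_vimage[OF Suc] by simp
  qed
  then have "countable (\<Union>n. {t. (g ^^ n) t \<in> cycle_ends})"
    by (intro countable_UN) (auto intro: countable_finite)
  moreover have "(\<Union>n. {t. (g ^^ n) t \<in> cycle_ends}) = {t. \<exists>n. (g ^^ n) t \<in> cycle_ends}" by auto
  ultimately show ?thesis by simp
qed

lemma pullback_subset_basin:
  assumes "B \<subseteq> {0..1}" "f ` B \<subseteq> B"
  shows "pullback B \<subseteq> basin {0..1} g (pullback B)"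
proof
  fix t assume t: "t \<in> pullback B"
  have inv: "forward_invariant {0..1} g (pullback B)" by (rule forward_invariant_pullback[OF assms])
  have "(g ^^ n) t \<in> pullback B" for n
    by (induction n) (use t inv in \<open>auto simp: forward_invariant_def\<close>)
  then have "omega_limit g t \<subseteq> pullback B" by (intro omega_limit_subset_closed[OF closed_pullback, of 0])
  then show "t \<in> basin {0..1} g (pullback B)"
    using t pullback_unit[OF assms(1)] by (auto simp: basin_def)
qed

text \<open>A typical point with limit set in \<open>A0 \<subseteq> pullback W\<close> has an orbit that accumulates
  everywhere in \<open>pullback W\<close>; since \<open>A0\<close> is closed, \<open>A0 = pullback W\<close>.\<close>

lemma no_smaller_metric_attractor:
  assumes A0: "A0 \<subseteq> pullback W" "closed A0" and pos: "emeasure lebesgue (basin {0..1} g A0) > 0"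
  shows "pullback W \<subseteq> A0"
proof -
  obtain N where N: "negligible N"
    "\<And>x V m. x \<in> {0..1} - N \<Longrightarrow> (\<lambda>n. infdist ((f ^^ n) x) W) \<longlonglongrightarrow> 0 \<Longrightarrow> open V \<Longrightarrow> V \<inter> W \<noteq> {} \<Longrightarrow>
       \<exists>n\<ge>m. (f ^^ n) x \<in> V"
    by (rule tent_typical_orbit) blast
  \<comment> \<open>Exceptional points: the countable set that contains every attracted point over
    \<open>C\<close>, and the points over the null set \<open>N\<close>.\<close>
  let ?Z = "{t. \<exists>n. (g ^^ n) t \<in> cycle_ends} \<union> lam ` (N \<inter> ({0..1} - C))"
  have "negligible ?Z"
  proof (rule negligible_Un)
    show "negligible {t. \<exists>n. (g ^^ n) t \<in> cycle_ends}"
      by (rule negligible_if_countable[OF countable_hits_cycle_ends])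
    have "negligible (N \<inter> ({0..1} - C))" using N(1) by (rule negligible_subset) auto
    then have neg: "negligible (l ` (N \<inter> ({0..1} - C)))" by (rule negligible_ins_left_image) auto
    have "negligible ((\<lambda>z. z / L) ` l ` (N \<inter> ({0..1} - C)))"
      using L_pos by (intro negligible_Lipschitz_image[OF neg, of _ "1 / L"]) (simp flip: diff_divide_distrib)
    then show "negligible (lam ` (N \<inter> ({0..1} - C)))"
      by (simp add: image_image lam_def[abs_def])
  qed
  have "\<not> basin {0..1} g A0 \<subseteq> ?Z"
  proof
    assume "basin {0..1} g A0 \<subseteq> ?Z"
    then have "negligible (basin {0..1} g A0)" using \<open>negligible ?Z\<close> negligible_subset by blast
    then have "emeasure lebesgue (basin {0..1} g A0) = 0"
      by (simp add: negligible_iff_null_sets null_sets_def)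
    then show False using pos by simp
  qed
  then obtain t where "t \<in> basin {0..1} g A0" and tZ: "t \<notin> ?Z" by blast
  then have t: "t \<in> {0..1}" "omega_limit g t \<subseteq> A0" "t \<notin> ?Z" unfolding basin_def by blast+
  have "t \<in> lam ` ({0..1} - C)"
  proof (rule ccontr)
    assume "t \<notin> lam ` ({0..1} - C)"
    moreover have "omega_limit g t \<subseteq> pullback W" using t(2) A0(1) by blast
    ultimately have "\<exists>n. (g ^^ n) t \<in> cycle_ends" using gap_orbit_hits_cycle_ends[OF t(1)] W_unit by blast
    then show False using t(3) by blast
  qed
  then obtain x where x: "x \<in> {0..1} - C" "t = lam x" by blast
  then have "x \<notin> N" using t(3) by blast
  have orb: "(g ^^ n) t = lam ((f ^^ n) x)" for n using g_pow_lam[OF x(1)] x(2) by simp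
  \<comment> \<open>Distances grow at most by the factor \<open>L\<close> on the way back from
    \<open>g\<close> to \<open>f\<close>. One half of the allowance \<open>e / L\<close> goes into
    replacing a point of the closure by some \<open>lam w\<close>.\<close>
  have "(\<lambda>n. infdist ((f ^^ n) x) W) \<longlonglongrightarrow> 0"
    unfolding lim_sequentially
  proof (intro allI impI)
    fix e :: real assume "0 < e"
    then have "0 < e / (2 * L)" using L_pos by simp
    moreover have "omega_limit g t \<subseteq> pullback W" using t(2) A0(1) by blast
    ultimately obtain M where M: "\<And>n. M \<le> n \<Longrightarrow> \<exists>y\<in>pullback W. \<bar>(g ^^ n) t - y\<bar> < e / (2 * L)"
      using eventually_near_omega_limit[of g t "pullback W"] g_pow_unit[OF t(1)] by blast
    have "dist (infdist ((f ^^ n) x) W) 0 < e" if n: "M \<le> n" for n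
    proof -
      obtain y where y: "y \<in> closure (lam ` (W - C))" "\<bar>(g ^^ n) t - y\<bar> < e / (2 * L)"
        using M[OF n] by (auto simp: pullback_def)
      obtain w where w: "w \<in> W - C" "dist (lam w) y < e / (2 * L)"
        using y(1) \<open>0 < e / (2 * L)\<close> unfolding closure_approachable by blast
      have "\<bar>lam ((f ^^ n) x) - lam w\<bar> < e / (2 * L) + e / (2 * L)"
        using y(2) w(2) unfolding orb dist_real_def by linarith
      also have "\<dots> = e / L" using L_pos by (simp add: field_simps)
      finally have "L * \<bar>lam ((f ^^ n) x) - lam w\<bar> < e" using L_pos by (simp add: pos_less_divide_eq mult.commute)
      then have "dist ((f ^^ n) x) w < e" using lam_dist[of "(f ^^ n) x" w] by (simp add: dist_real_def)
      moreover have "infdist ((f ^^ n) x) W \<le> dist ((f ^^ n) x) w" using w(1) by (intro infdist_le) auto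
      ultimately show ?thesis by (simp add: infdist_nonneg)
    qed
    then show "\<exists>M. \<forall>n\<ge>M. dist (infdist ((f ^^ n) x) W) 0 < e" by blast
  qed
  then have dense: "\<exists>n\<ge>m. (f ^^ n) x \<in> V" if "open V" "V \<inter> W \<noteq> {}" for V m
    using N(2)[of x V m] x(1) \<open>x \<notin> N\<close> that by blast
  have "lam w \<in> A0" if w: "w \<in> W - C" for w
  proof -
    have "lam w \<in> omega_limit g t"
    proof (rule omega_limitI)
      fix e :: real and m assume "0 < e"
      then obtain d where d: "0 < d" "\<And>y. dist y w < d \<Longrightarrow> dist (lam y) (lam w) < e"
        using isCont_lam[of w] w unfolding continuous_at_eps_delta by blast
      have "ball w d \<inter> W \<noteq> {}" using w d(1) by (metis DiffD1 centre_in_ball disjoint_iff)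
      then obtain n where "m \<le> n" "(f ^^ n) x \<in> ball w d" using dense[OF open_ball] by blast
      then show "\<exists>n\<ge>m. \<bar>(g ^^ n) t - lam w\<bar> < e"
        using d(2)[of "(f ^^ n) x"] unfolding orb by (intro exI[of _ n]) (simp add: dist_commute dist_real_def)
    qed
    then show ?thesis using t(2) by blast
  qed
  then show ?thesis unfolding pullback_def using A0(2) by (intro closure_minimal) auto
qed

lemma not_residual_basin: "\<not> residual_in (top_of_set {0..1}) (basin {0..1} g (pullback W))"
proof
  let ?X = "top_of_set {0..1::real}" and ?Z = "{t. \<exists>n. (g ^^ n) t \<in> cycle_ends}"
  assume "residual_in ?X (basin {0..1} g (pullback W))"
  then obtain \<N> where \<N>: "countable \<N>" "\<And>S. S \<in> \<N> \<Longrightarrow> nowhere_dense_in ?X S"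
    "{0..1} - basin {0..1} g (pullback W) = \<Union>\<N>"
    by (auto simp: residual_in_def meager_in_def)
  \<comment> \<open>Any inserted interval would do: its interior is open and nonempty, and the basin
    meets it only in the countable set \<open>?Z\<close>.\<close>
  let ?O = "{lam (1/2)<..<rho (1/2)}"
  have half: "(1/2::real) \<in> {0..1}" by simp
  have unit: "?O \<subseteq> {0..1}" using lam_unit[OF half] rho_unit[OF half] by auto
  \<comment> \<open>If the basin were residual, these countably many closed sets with empty interior
    would cover \<open>?O\<close>: closures of the nowhere dense pieces of the complement, and the
    single points of \<open>?Z\<close>.\<close>
  define \<G> where "\<G> = (\<lambda>S. ?X closure_of S) ` \<N> \<union> (\<lambda>t. {t}) ` (?Z \<inter> {0..1})"
  have "countable (?Z \<inter> {0..1})" using countable_hits_cycle_ends by (rule countable_subset[rotated]) auto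
  then have "countable \<G>" unfolding \<G>_def using \<N>(1) by (intro countable_Un countable_image)
  have empty: "?X interior_of \<Union>\<G> = {}"
  proof (rule Baire_category_alt)
    have "completely_metrizable_space ?X"
      by (intro completely_metrizable_space_closedin completely_metrizable_space_euclidean) simp
    then show "completely_metrizable_space ?X \<or> locally_compact_space ?X \<and> regular_space ?X" ..
    fix T assume "T \<in> \<G>"
    then consider S where "S \<in> \<N>" "T = ?X closure_of S" | t where "t \<in> {0..1}" "T = {t}"
      unfolding \<G>_def by blast
    then show "closedin ?X T \<and> ?X interior_of T = {}"
    proof cases
      case 1
      then show ?thesis using \<N>(2)[of S] by (simp add: nowhere_dense_in_def)
    next
      case 2
      have "\<not> openin ?X {t}"
      proof
        assume "openin ?X {t}"
        then obtain V where V: "open V" "{t} = {0..1} \<inter> V" by (auto simp: openin_open)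
        have "t islimpt {0..1}" using 2(1) by (simp add: islimpt_Icc)
        then obtain s where "s \<in> {0..1}" "s \<in> V" "s \<noteq> t" using V unfolding islimpt_def by blast
        then show False using V(2) by blast
      qed
      moreover have "?X interior_of {t} \<subseteq> {t}" by (rule interior_of_subset)
      moreover have "openin ?X (?X interior_of {t})" by (rule openin_interior_of)
      ultimately have "?X interior_of {t} = {}" by (metis subset_singletonD)
      moreover have "closedin ?X {t}" using 2(1) by (simp add: closedin_closed_eq)
      ultimately show ?thesis using 2(2) by simp
    qed
  qed (rule \<open>countable \<G>\<close>)
  have "?O \<subseteq> \<Union>\<G>"
  proof
    fix t assume t: "t \<in> ?O"
    then have t01: "t \<in> {0..1}" using unit by blast
    have notin: "t \<notin> lam ` ({0..1} - C)"
    proof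
      assume "t \<in> lam ` ({0..1} - C)"
      then obtain y where y: "y \<in> {0..1} - C" "t = lam y" by blast
      then have "y = 1/2" using lam_rho_disjoint[of y t "1/2"] t lam_le_rho[of y] by simp
      then show False using y(1) half_surgery by blast
    qed
    show "t \<in> \<Union>\<G>"
    proof (cases "t \<in> basin {0..1} g (pullback W)")
      case True
      then have "omega_limit g t \<subseteq> pullback W" by (simp add: basin_def)
      then have "t \<in> ?Z" using gap_orbit_hits_cycle_ends[OF t01 notin _ W_unit] by blast
      then show ?thesis using t01 by (auto simp: \<G>_def)
    next
      case False
      then obtain S where S: "S \<in> \<N>" "t \<in> S" using \<N>(3) t01 by blast
      then have "t \<in> ?X closure_of S"
        using closure_of_subset[of S ?X] \<N>(2)[OF S(1)] by (auto simp: nowhere_dense_in_def)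
      then show ?thesis using S(1) by (auto simp: \<G>_def)
    qed
  qed
  moreover have "openin ?X ?O" using unit by (intro open_subset) auto
  ultimately have "?O \<subseteq> ?X interior_of \<Union>\<G>" by (intro interior_of_maximal)
  moreover have "?O \<noteq> {}" using lam_less_rho[OF half_surgery] by simp
  ultimately show False using empty by simp
qed

lemma wild_attractor_pullback: "wild_attractor {0..1} g (pullback W)"
  unfolding wild_attractor_def
proof
  let ?A = "pullback W"
  show "metric_attractor {0..1} g ?A"
    unfolding metric_attractor_def
  proof (intro conjI)
    show "forward_invariant {0..1} g ?A" by (rule forward_invariant_pullback[OF W_unit tent_W])
    show "closed ?A" by (rule closed_pullback)
    have pos: "0 < emeasure lebesgue ?A"
      using thick_pullback[OF W_unit W_not_negligible] by (simp add: thick_def)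
    then have "?A \<noteq> {}" by auto
    \<comment> \<open>The comparison of measures needs a measurable basin, because a non-measurable
      set would be given the value 0.\<close>
    then have "basin {0..1} g ?A \<in> sets lebesgue"
      using basin_borel[OF closed_pullback _ g_range continuous_g] by (simp add: sets_completionI_sets)
    then have "emeasure lebesgue ?A \<le> emeasure lebesgue (basin {0..1} g ?A)"
      by (intro emeasure_mono pullback_subset_basin W_unit tent_W)
    then show "0 < emeasure lebesgue (basin {0..1} g ?A)" using pos by simp
    show "\<not> (\<exists>A0. A0 \<subset> ?A \<and> forward_invariant {0..1} g A0 \<and> closed A0 \<and> emeasure lebesgue (basin {0..1} g A0) > 0)"
    proof
      assume "\<exists>A0. A0 \<subset> ?A \<and> forward_invariant {0..1} g A0 \<and> closed A0 \<and> emeasure lebesgue (basin {0..1} g A0) > 0"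
      then obtain A0 where A0: "A0 \<subset> ?A" "closed A0" "emeasure lebesgue (basin {0..1} g A0) > 0" by blast
      then have "?A \<subseteq> A0" by (intro no_smaller_metric_attractor) auto
      then show False using A0(1) by blast
    qed
  qed
qed (use not_residual_basin in \<open>simp add: topological_attractor_def\<close>)

end

theorem theoremA:
  fixes \<beta> :: real
  assumes "\<beta> \<in> finite_crit_params"
  shows "\<exists>g A A'.
    denjoy_like_surgery \<beta> g \<and>
    g ` {0..1} \<subseteq> {0..1} \<and> C1_on {0..1} g \<and> unimodal_on 0 1 g \<and>
    Cantor_set A \<and> thick A \<and> hyperbolic_repelling {0..1} g A \<and>
    A' \<subseteq> A \<and> wild_attractor {0..1} g A'"
proof -
  interpret pcf_tent \<beta> by unfold_locales (rule assms)
  have inv: "f ` {0..1} \<subseteq> {0..1}" using tent_in_unit by blast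
  have "\<not> negligible {0..1::real}"
    using W_not_negligible negligible_subset[OF _ W_unit] by blast
  then have "thick (pullback {0..1})" by (intro thick_pullback) auto
  moreover have "hyperbolic_repelling {0..1} g (pullback {0..1})"
    by (rule hyperbolic_repelling_pullback[OF order_refl inv])
  ultimately show ?thesis
    using g_surgery g_range C1_on_g unimodal_g Cantor_set_pullback pullback_mono[OF W_unit] wild_attractor_pullback
    by (intro exI[of _ g] exI[of _ "pullback {0..1}"] exI[of _ "pullback W"] conjI)
qed

end
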